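(* Let $(Z,d)$ be a complete separable metric space, let $\nu$ be a $\sigma$-finite measure on $Z$, finite on balls and with no atoms, and let $\eta\sim\Pi_\nu$ be a Poisson point process with intensity $\nu$. Let $F:\mathcal M_{\bar{\mathbb N}}(Z)\to\mathbb R$ be measurable, convex and non-decreasing, with $\mathbb E[|F(\eta)|e^{F(\eta)}]<\infty$. Then for all $0\le\lambda<1$, $$\mathrm{Ent}\left(e^{F(\eta)}\right)\le\mathbb E\left[e^{F(\eta)}\int\phi_\lambda(D_x^-F(\eta))\,\eta(dx)\right].$$
   Context: $\mathcal M_{\bar{\mathbb N}}(Z)$ is the space of locally finite configurations: Borel measures $\xi$ on $Z$ such that for every closed ball $B$, the restriction $\xi|_B$ is a finite sum of Dirac masses (repetitions allowed), with the vague topology (generated by $\xi\mapsto\int f\,d\xi$ for $f$ bounded continuous vanishing outside a ball). $\Pi_\nu$ is the law of the Poisson point process with intensity $\nu$: for pairwise disjoint measurable $A_1,\dots,A_l$ with $\nu(A_i)<\infty$, the variables $\eta(A_1),\dots,\eta(A_l)$ are independent Poisson with means $\nu(A_1),\dots,\nu(A_l)$. $\mathrm{Ent}(e^Y)=\mathbb E[Ye^Y]-\mathbb E[e^Y]\log\mathbb E[e^Y]$ for a random variable $Y$ with $\mathbb E[|Y|e^Y]<\infty$. For $\lambda\in(0,1)$, $\phi_\lambda(s)=\frac{s}{1-\lambda}-\frac{\lambda}{1-\lambda}\log\left(1+\frac s\lambda\right)$ for $s\ge0$; and $\phi_0(s)=s$. Difference operators: $D_x^-F(\xi)=F(\xi)-F(\xi-\delta_x)$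 for $x$ with $\xi(\{x\})>0$, and $D_x^+F(\xi)=F(\xi+\delta_x)-F(\xi)$ for $x\in Z$. $F$ is non-decreasing if $\xi\le\chi$ (i.e. $\xi(A)\le\chi(A)$ for all Borel $A$) implies $F(\xi)\le F(\chi)$. $F$ is convex if for every $x\in Z$ the functional $D_x^+F$ is non-decreasing. *)

theory Defs
  imports "HOL-Probability.Probability"
begin

text \<open>
  Configurations are Borel measures on \<open>Z = UNIV\<close>. The condition on a ball says that
  the restriction to the ball is the sum of the Dirac masses at the entries of a finite list;
  repeated entries give multiplicities.
\<close>

definition configurations :: "'a::metric_space measure set" where
  "configurations =
     {\<xi>. sets \<xi> = sets borel \<and>
         (\<forall>x r. \<exists>xs. \<forall>A\<in>sets borel.
            emeasure \<xi> (A \<inter> cball x r) = (\<Sum>y\<leftarrow>xs. emeasure (return borel y) A))}"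

definition vague_test_functions :: "('a::metric_space \<Rightarrow> real) set" where
  "vague_test_functions =
     {f. continuous_on UNIV f \<and> bounded (range f) \<and> (\<exists>x r. \<forall>y. y \<notin> cball x r \<longrightarrow> f y = 0)}"

definition vague_topology :: "'a::metric_space measure topology" where
  "vague_topology = topology_generated_by
     {{\<xi> \<in> configurations. (\<integral>y. f y \<partial>\<xi>) \<in> U} | f U. f \<in> vague_test_functions \<and> open U}"

lemma topspace_vague_topology: "topspace vague_topology = configurations"
proof -
  have "topspace vague_topology =
      \<Union>{{\<xi> \<in> configurations. (\<integral>y. f y \<partial>\<xi>) \<in> U} | f U. f \<in> vague_test_functions \<and> open U}"
    by (simp add: vague_topology_def topology_generated_by_topspace)
  moreover have "(\<lambda>_. 0) \<in> vague_test_functions"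
    by (auto simp: vague_test_functions_def)
  then have "configurations \<in>
      {{\<xi> \<in> configurations. (\<integral>y. f y \<partial>\<xi>) \<in> U} | f U. f \<in> vague_test_functions \<and> open U}"
    by (intro CollectI exI[of _ "\<lambda>_. 0"] exI[of _ UNIV]) auto
  ultimately show ?thesis by blast
qed

definition configuration_space :: "'a::metric_space measure measure" where
  "configuration_space = sigma configurations {U. openin vague_topology U}"

text \<open>
  A random variable with Poisson law of mean \<open>m \<ge> 0\<close>. The mean \<open>m = 0\<close> must be allowed
  (it gives the constant \<open>0\<close>), whereas \<^const>\<open>poisson_pmf\<close> requires a positive rate.
\<close>

definition poisson_variable :: "'w measure \<Rightarrow> ('w \<Rightarrow> ennreal) \<Rightarrow> real \<Rightarrow> bool" where
  "poisson_variable M X m \<longleftrightarrow> X \<in> borel_measurable M \<and>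
     (\<forall>k::nat. measure M {\<omega> \<in> space M. X \<omega> = of_nat k} = m ^ k / fact k * exp (- m))"

definition poisson_process ::
  "'w measure \<Rightarrow> 'a::metric_space measure \<Rightarrow> ('w \<Rightarrow> 'a measure) \<Rightarrow> bool" where
  "poisson_process M \<nu> \<eta> \<longleftrightarrow> prob_space M \<and> \<eta> \<in> M \<rightarrow>\<^sub>M configuration_space \<and>
     (\<forall>(l::nat) A. (\<forall>i<l. A i \<in> sets borel \<and> emeasure \<nu> (A i) < \<infinity>) \<and> disjoint_family_on A {..<l} \<longrightarrow>
        prob_space.indep_vars M (\<lambda>_. borel) (\<lambda>i \<omega>. emeasure (\<eta> \<omega>) (A i)) {..<l} \<and>
        (\<forall>i<l. poisson_variable M (\<lambda>\<omega>. emeasure (\<eta> \<omega>) (A i)) (measure \<nu> (A i))))"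

definition add_measure :: "'a measure \<Rightarrow> 'a measure \<Rightarrow> 'a measure" where
  "add_measure M N = measure_of (space M) (sets M) (\<lambda>A. emeasure M A + emeasure N A)"

lemma sets_add_measure [simp]: "sets (add_measure M N) = sets M"
  and space_add_measure [simp]: "space (add_measure M N) = space M"
  by (simp_all add: add_measure_def)

lemma emeasure_add_measure:
  assumes "sets N = sets M" "A \<in> sets M"
  shows "emeasure (add_measure M N) A = emeasure M A + emeasure N A"
  unfolding add_measure_def
proof (rule emeasure_measure_of_sigma)
  show "countably_additive (sets M) (\<lambda>A. emeasure M A + emeasure N A)"
    using assms(1) by (auto simp: countably_additive_def suminf_add[symmetric] suminf_emeasure)
qed (use assms in \<open>simp_all add: positive_def sets.sigma_algebra_axioms\<close>)

lemma add_dirac_in_configurations: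
  assumes "\<xi> \<in> configurations"
  shows "add_measure \<xi> (return borel z) \<in> configurations"
  unfolding configurations_def
proof (intro CollectI conjI allI)
  have s: "sets \<xi> = sets borel" using assms by (simp add: configurations_def)
  then show "sets (add_measure \<xi> (return borel z)) = sets borel" by simp
  fix x r
  obtain xs where xs: "\<And>A. A \<in> sets borel \<Longrightarrow>
      emeasure \<xi> (A \<inter> cball x r) = (\<Sum>y\<leftarrow>xs. emeasure (return borel y) A)"
    using assms by (auto simp: configurations_def) blast
  have "emeasure (add_measure \<xi> (return borel z)) (A \<inter> cball x r) =
      (\<Sum>y\<leftarrow>(if z \<in> cball x r then z # xs else xs). emeasure (return borel y) A)"
    if A: "A \<in> sets borel" for A
  proof -
    have "A \<inter> cball x r \<in> sets borel" using A by auto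
    then show ?thesis
      using s xs[OF A] A by (auto simp: emeasure_add_measure indicator_def add.commute)
  qed
  then show "\<exists>xs. \<forall>A\<in>sets borel. emeasure (add_measure \<xi> (return borel z)) (A \<inter> cball x r) =
      (\<Sum>y\<leftarrow>xs. emeasure (return borel y) A)" by blast
qed

lemma remove_dirac:
  assumes "\<xi> \<in> configurations" and z: "emeasure \<xi> {z} > 0"
  shows emeasure_remove_dirac: "\<And>A. A \<in> sets borel \<Longrightarrow>
      emeasure (diff_measure \<xi> (return borel z)) A = emeasure \<xi> A - emeasure (return borel z) A"
    and remove_dirac_in_configurations: "diff_measure \<xi> (return borel z) \<in> configurations"
proof -
  have s: "sets \<xi> = sets borel" using assms by (simp add: configurations_def)
  have ball: "\<exists>xs. \<forall>A\<in>sets borel. emeasure \<xi> (A \<inter> cball x r) =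
      (\<Sum>y\<leftarrow>xs. emeasure (return borel y) A)" for x r
    using assms(1) by (auto simp: configurations_def)
  have pos: "z \<in> set xs" if "\<And>A. A \<in> sets borel \<Longrightarrow>
      emeasure \<xi> (A \<inter> cball x r) = (\<Sum>y\<leftarrow>xs. emeasure (return borel y) A)"
    "z \<in> cball x r" for xs x r
  proof (rule ccontr)
    assume n: "z \<notin> set xs"
    have "emeasure \<xi> ({z} \<inter> cball x r) = (\<Sum>y\<leftarrow>xs. emeasure (return borel y) {z})"
      by (rule that) auto
    also have "\<dots> = (\<Sum>y\<leftarrow>xs. 0)"
      using n by (intro arg_cong[of _ _ sum_list] map_cong) (auto simp: indicator_def)
    also have "{z} \<inter> cball x r = {z}" using that(2) by auto
    finally show False using z by simp
  qed
  have le1: "1 \<le> emeasure \<xi> {z}"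
  proof -
    obtain xs where xs: "\<And>A. A \<in> sets borel \<Longrightarrow>
        emeasure \<xi> (A \<inter> cball z 0) = (\<Sum>y\<leftarrow>xs. emeasure (return borel y) A)"
      using ball by blast
    have "z \<in> set xs" by (rule pos[OF xs]) auto
    then have "(\<Sum>y\<leftarrow>xs. emeasure (return borel y) {z}) \<ge> emeasure (return borel z) {z}"
      by (intro member_le_sum_list) (auto intro!: rev_image_eqI)
    then show ?thesis using xs[of "{z}"] by simp
  qed
  have le: "emeasure (return borel z) A \<le> emeasure \<xi> A" if "A \<in> sets borel" for A
  proof (cases "z \<in> A")
    case True
    then have "emeasure \<xi> {z} \<le> emeasure \<xi> A"
      using that s by (intro emeasure_mono) auto
    then show ?thesis using le1 that True by (simp add: order_trans)
  qed (use that in simp)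
  show em: "emeasure (diff_measure \<xi> (return borel z)) A =
      emeasure \<xi> A - emeasure (return borel z) A" if A: "A \<in> sets borel" for A
    unfolding diff_measure_def
  proof (rule emeasure_measure_of_sigma)
    show "countably_additive (sets \<xi>) (\<lambda>A. emeasure \<xi> A - emeasure (return borel z) A)"
      unfolding countably_additive_def
    proof (intro allI impI)
      fix B :: "nat \<Rightarrow> 'a set"
      assume B: "range B \<subseteq> sets \<xi>" "disjoint_family B" "(\<Union>i. B i) \<in> sets \<xi>"
      then have Bb: "range B \<subseteq> sets (return borel z)" "\<And>i. B i \<in> sets borel" "(\<Union>i. B i) \<in> sets borel"
        using s by auto
      have fin: "(\<Sum>i. emeasure (return borel z) (B i)) \<noteq> \<top>"
        using suminf_emeasure[OF Bb(1) B(2)] Bb(3) by (simp add: indicator_def)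
      have "(\<Sum>i. emeasure \<xi> (B i)) =
          (\<Sum>i. (emeasure \<xi> (B i) - emeasure (return borel z) (B i)) + emeasure (return borel z) (B i))"
        using le Bb(2) by (intro suminf_cong) (simp add: diff_add_cancel_ennreal del: emeasure_return)
      also have "\<dots> = (\<Sum>i. emeasure \<xi> (B i) - emeasure (return borel z) (B i)) +
          (\<Sum>i. emeasure (return borel z) (B i))"
        by (intro suminf_add[symmetric]) auto
      finally have "(\<Sum>i. emeasure \<xi> (B i) - emeasure (return borel z) (B i)) =
          (\<Sum>i. emeasure \<xi> (B i)) - (\<Sum>i. emeasure (return borel z) (B i))"
        using fin by simp
      then show "(\<Sum>i. emeasure \<xi> (B i) - emeasure (return borel z) (B i)) =
          emeasure \<xi> (\<Union>i. B i) - emeasure (return borel z) (\<Union>i. B i)"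
        using suminf_emeasure[OF Bb(1) B(2)] suminf_emeasure[OF B(1,2)] by simp
    qed
    show "sigma_algebra (space \<xi>) (sets \<xi>)" by (rule sets.sigma_algebra_axioms)
  qed (use A s in \<open>simp_all add: positive_def\<close>)
  show "diff_measure \<xi> (return borel z) \<in> configurations"
    unfolding configurations_def
  proof (intro CollectI conjI allI)
    show "sets (diff_measure \<xi> (return borel z)) = sets borel" using s by simp
    fix x r
    obtain xs where xs: "\<And>A. A \<in> sets borel \<Longrightarrow>
        emeasure \<xi> (A \<inter> cball x r) = (\<Sum>y\<leftarrow>xs. emeasure (return borel y) A)"
      using ball by blast
    have "emeasure (diff_measure \<xi> (return borel z)) (A \<inter> cball x r) =
        (\<Sum>y\<leftarrow>(if z \<in> cball x r then remove1 z xs else xs). emeasure (return borel y) A)"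
      if A: "A \<in> sets borel" for A
    proof -
      have Ab: "A \<inter> cball x r \<in> sets borel" using A by auto
      show ?thesis
      proof (cases "z \<in> cball x r")
        case True
        have "(\<Sum>y\<leftarrow>xs. emeasure (return borel y) A) =
            emeasure (return borel z) A + (\<Sum>y\<leftarrow>remove1 z xs. emeasure (return borel y) A)"
          by (rule sum_list_map_remove1, rule pos[OF xs True])
        then show ?thesis
          using True em[OF Ab] xs[OF A] A Ab by (simp add: indicator_def)
      next
        case False
        then show ?thesis using em[OF Ab] xs[OF A] Ab by simp
      qed
    qed
    then show "\<exists>xs. \<forall>A\<in>sets borel. emeasure (diff_measure \<xi> (return borel z)) (A \<inter> cball x r) =
        (\<Sum>y\<leftarrow>xs. emeasure (return borel y) A)" by blast
  qed
qed

definition diff_plus ::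
  "('a::metric_space measure \<Rightarrow> real) \<Rightarrow> 'a \<Rightarrow> 'a measure \<Rightarrow> real" where
  "diff_plus F x \<xi> = F (add_measure \<xi> (return borel x)) - F \<xi>"

text \<open>Only meaningful for \<open>x\<close> with \<open>\<xi>({x}) > 0\<close>; the other points are \<open>\<xi>\<close>-negligible.\<close>

definition diff_minus ::
  "('a::metric_space measure \<Rightarrow> real) \<Rightarrow> 'a \<Rightarrow> 'a measure \<Rightarrow> real" where
  "diff_minus F x \<xi> = F \<xi> - F (diff_measure \<xi> (return borel x))"

definition nondecreasing_functional :: "('a::metric_space measure \<Rightarrow> real) \<Rightarrow> bool" where
  "nondecreasing_functional F \<longleftrightarrow>
     (\<forall>\<xi>\<in>configurations. \<forall>\<zeta>\<in>configurations.
        (\<forall>A\<in>sets borel. emeasure \<xi> A \<le> emeasure \<zeta> A) \<longrightarrow> F \<xi> \<le> F \<zeta>)"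

definition convex_functional :: "('a::metric_space measure \<Rightarrow> real) \<Rightarrow> bool" where
  "convex_functional F \<longleftrightarrow> (\<forall>x. nondecreasing_functional (diff_plus F x))"

text \<open>\<open>entropy_exp M Y\<close> is \<open>Ent(e^Y)\<close>.\<close>

definition entropy_exp :: "'w measure \<Rightarrow> ('w \<Rightarrow> real) \<Rightarrow> real" where
  "entropy_exp M Y =
     (\<integral>\<omega>. Y \<omega> * exp (Y \<omega>) \<partial>M) - (\<integral>\<omega>. exp (Y \<omega>) \<partial>M) * ln (\<integral>\<omega>. exp (Y \<omega>) \<partial>M)"

definition phi :: "real \<Rightarrow> real \<Rightarrow> real" where
  "phi l s = (if l = 0 then s
     else s / (1 - l) - l / (1 - l) * ln (1 + s / l))"

end

theory Submission
  imports Defs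
begin

text \<open>
  For \<open>s \<ge> 0\<close> one has \<open>exp (- s) - 1 + s \<le> \<phi>\<^sub>\<lambda>(s)\<close>, so it suffices to prove Wu's modified
  logarithmic Sobolev inequality
  \<open>Ent(G) \<le> E \<integral> (G(\<eta>) log (G(\<eta>) / G(\<eta> - \<delta>\<^sub>x)) - G(\<eta>) + G(\<eta> - \<delta>\<^sub>x)) \<eta>(dx)\<close> for \<open>G = exp F\<close>.
  Cut a ball into finitely many cells \<open>A\<close>. The parts of \<open>\<eta>\<close> in different cells are independent,
  hence the entropy is subadditive over the cells, and the entropy coming from one cell is at most the
  expected relative entropy integrand between \<open>G(\<eta>)\<close> and \<open>G\<close> of \<open>\<eta>\<close> without its points in \<open>A\<close>.
  Since \<open>\<nu>\<close> has no atoms, \<open>\<eta>\<close> has no multiple points, so cells of a sufficiently fine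
  partition carry at most one point and emptying them removes single points. This gives the
  inequality, first for bounded \<open>F\<close> and then, as truncation does not increase the right-hand side for
  non-decreasing \<open>F\<close>, in general.
\<close>

section \<open>Configurations and their counting sigma-algebra\<close>

text \<open>The functional is measurable for the vague Borel sets, whereas a Poisson process is
  described by its counts. Every vaguely open set turns out to be a countable union of count events,
  so all later work happens on the sigma-algebra of counts. Independence over disjoint regions
  enters as a symmetry: for two independent copies, exchanging the points outside a Borel set
  preserves the product law. No product structure on the space of configurations has to be set up,
  and the conditional expectation given the points of a region is an integral over the second copy.
  The entropy step rests on \<open>ln y \<le> y - 1\<close> alone: it is applied to the ratio of two
  successive conditional expectations, and the linear remainder has mean zero because its weight
  ignores the points of the cell being treated. The integral over the points is not known to depend
  measurably on the configuration; hence the right-hand side is handled only through monotonicity of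
  the integral as a supremum over simple functions, and measurable cell energies approximate it from
  below.\<close>

definition window :: "nat \<Rightarrow> 'a::metric_space set" where
  "window n = cball undefined (real n)"

lemma window_borel [measurable, simp]: "window n \<in> sets borel"
  by (simp add: window_def)

lemma window_mono: "m \<le> n \<Longrightarrow> window m \<subseteq> window n"
  by (simp add: window_def subset_cball)

lemma Union_window: "(\<Union>n. window n) = UNIV"
proof -
  have "\<exists>n. x \<in> window n" for x :: 'a
    using real_arch_simple[of "dist undefined x"] by (auto simp: window_def)
  then show ?thesis by blast
qed

text \<open>The centre \<open>undefined\<close> is an arbitrary fixed point. Windows are cofinal
  among the balls, so local finiteness can be tested along one increasing sequence.\<close>

lemma cball_subset_window: "\<exists>n. cball x r \<subseteq> window n"
proof -
  obtain n where n: "dist undefined x + r \<le> real n"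
    using real_arch_simple by blast
  have "cball x r \<subseteq> window n"
    unfolding window_def
  proof
    fix y assume "y \<in> cball x r"
    then show "y \<in> cball undefined (real n)"
      using n dist_triangle[of undefined y x] by simp
  qed
  then show ?thesis ..
qed

lemma sets_configuration: "\<xi> \<in> configurations \<Longrightarrow> sets \<xi> = sets borel"
  by (simp add: configurations_def)

lemma sum_list_dirac:
  assumes "A \<in> sets borel"
  shows "(\<Sum>y\<leftarrow>xs. emeasure (return borel y) A) = of_nat (card {i. i < length xs \<and> xs ! i \<in> A})"
proof -
  have "(\<Sum>y\<leftarrow>xs. emeasure (return borel y) A) = (\<Sum>i<length xs. indicator A (xs ! i) :: ennreal)"
    using assms by (simp add: sum_list_sum_nth atLeast0LessThan)
  also have "\<dots> = (\<Sum>i\<in>{i. i < length xs \<and> xs ! i \<in> A}. 1)"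
    by (intro sum.mono_neutral_cong_right) (auto simp: indicator_def)
  finally show ?thesis by simp
qed

text \<open>Atoms are indexed by \<open>i < N\<close> instead of being collected in a set, so that
  multiple points keep their multiplicity.\<close>

lemma configuration_atoms:
  assumes "\<xi> \<in> configurations"
  shows "\<exists>(N::nat) x. (\<forall>i<N. x i \<in> window n) \<and>
    (\<forall>A\<in>sets borel. emeasure \<xi> (A \<inter> window n) = of_nat (card {i. i < N \<and> x i \<in> A}))"
proof -
  obtain xs where xs: "\<And>A. A \<in> sets borel \<Longrightarrow>
      emeasure \<xi> (A \<inter> window n) = (\<Sum>y\<leftarrow>xs. emeasure (return borel y) A)"
    using assms unfolding configurations_def window_def by blast
  have em: "emeasure \<xi> (A \<inter> window n) = of_nat (card {i. i < length xs \<and> xs ! i \<in> A})"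
    if "A \<in> sets borel" for A
    using xs[OF that] sum_list_dirac[OF that] by simp
  \<comment> \<open>The complement of the window meets the window in the empty set, so no entry of
    the list can lie outside.\<close>
  have "card {i. i < length xs \<and> xs ! i \<in> - window n} = 0"
    using em[of "- window n"] by simp
  then have "xs ! i \<in> window n" if "i < length xs" for i
    using that by (auto simp: card_eq_0_iff)
  with em show ?thesis by (intro exI[of _ "length xs"] exI[of _ "\<lambda>i. xs ! i"]) blast
qed

text \<open>The points of a ball are obtained by filtering the list of a window that contains
  it.\<close>

lemma configurations_iff_windows:
  "\<xi> \<in> configurations \<longleftrightarrow> sets \<xi> = sets borel \<and>
     (\<forall>n. \<exists>xs. \<forall>A\<in>sets borel. emeasure \<xi> (A \<inter> window n) = (\<Sum>y\<leftarrow>xs. emeasure (return borel y) A))"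
  (is "?L \<longleftrightarrow> ?R")
proof
  assume ?R
  have "\<exists>xs. \<forall>A\<in>sets borel. emeasure \<xi> (A \<inter> cball x r) = (\<Sum>y\<leftarrow>xs. emeasure (return borel y) A)" for x r
  proof -
    obtain n where n: "cball x r \<subseteq> window n" using cball_subset_window by blast
    obtain xs where xs: "\<And>A. A \<in> sets borel \<Longrightarrow>
        emeasure \<xi> (A \<inter> window n) = (\<Sum>y\<leftarrow>xs. emeasure (return borel y) A)"
      using \<open>?R\<close> by blast
    have "emeasure \<xi> (A \<inter> cball x r) =
        (\<Sum>y\<leftarrow>filter (\<lambda>y. y \<in> cball x r) xs. emeasure (return borel y) A)" if A: "A \<in> sets borel" for A
    proof -
      have "A \<inter> cball x r = (A \<inter> cball x r) \<inter> window n" using n by auto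
      then have "emeasure \<xi> (A \<inter> cball x r) = (\<Sum>y\<leftarrow>xs. emeasure (return borel y) (A \<inter> cball x r))"
        using xs[of "A \<inter> cball x r"] A by simp
      also have "\<dots> = (\<Sum>y\<leftarrow>filter (\<lambda>y. y \<in> cball x r) xs. emeasure (return borel y) A)"
      proof -
        have Ab: "A \<inter> cball x r \<in> sets borel" using A by auto
        show ?thesis
          using A Ab by (induction xs) (auto simp: indicator_def simp del: mem_cball)
      qed
      finally show ?thesis .
    qed
    then show ?thesis by blast
  qed
  then show ?L using \<open>?R\<close> by (simp add: configurations_def)
qed (auto simp: configurations_def window_def)

lemma emeasure_bounded_nat:
  assumes "\<xi> \<in> configurations" "A \<in> sets borel" "A \<subseteq> window n"
  shows "\<exists>k. emeasure \<xi> A = of_nat k"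
  using configuration_atoms[OF assms(1), of n] assms by (metis Int_absorb2)

lemma configuration_eqI:
  assumes "\<xi> \<in> configurations" "\<zeta> \<in> configurations"
    and "\<And>A. A \<in> sets borel \<Longrightarrow> emeasure \<xi> A = emeasure \<zeta> A"
  shows "\<xi> = \<zeta>"
  by (rule measure_eqI) (use assms in \<open>simp_all add: sets_configuration\<close>)

text \<open>The generators are events on which the finite-dimensional Poisson laws act directly.
  Level sets suffice, since counts of bounded sets are natural numbers.\<close>

definition counting_space :: "'a::metric_space measure measure" where
  "counting_space = sigma configurations
     {{\<xi> \<in> configurations. emeasure \<xi> A = of_nat k} | A k n. A \<in> sets borel \<and> A \<subseteq> window n}"

lemma counting_sets_Pow:
  "{{\<xi> \<in> configurations. emeasure \<xi> A = of_nat k} | A k n. A \<in> sets borel \<and> A \<subseteq> window n}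
     \<subseteq> Pow configurations"
  by auto

lemma space_counting_space [simp]: "space counting_space = configurations"
  using counting_sets_Pow by (simp add: counting_space_def space_measure_of_conv)

lemma measurable_eval_bounded:
  assumes "A \<in> sets borel" "A \<subseteq> window n"
  shows "(\<lambda>\<xi>. emeasure \<xi> A) \<in> borel_measurable counting_space"
proof -
  have "(\<lambda>\<xi>. emeasure \<xi> A) \<in> counting_space \<rightarrow>\<^sub>M count_space (range of_nat)"
  proof (subst measurable_count_space_eq_countable)
    show "countable (range of_nat :: ennreal set)" by simp
    have "(\<lambda>\<xi>. emeasure \<xi> A) -` {of_nat k} \<inter> space counting_space \<in> sets counting_space" for k
    proof -
      have eq: "(\<lambda>\<xi>. emeasure \<xi> A) -` {of_nat k} \<inter> space counting_space =
         {\<xi> \<in> configurations. emeasure \<xi> A = of_nat k}" by auto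
      show ?thesis unfolding eq
        unfolding counting_space_def
        by (rule in_measure_of[OF counting_sets_Pow], rule CollectI)
          (rule exI[of _ A], rule exI[of _ k], rule exI[of _ n], use assms in simp)
    qed
    moreover have "(\<lambda>\<xi>. emeasure \<xi> A) \<in> space counting_space \<rightarrow> range of_nat"
    proof
      fix \<xi> :: "'a measure" assume "\<xi> \<in> space counting_space"
      then obtain k where "emeasure \<xi> A = of_nat k" using emeasure_bounded_nat[OF _ assms] by auto
      then show "emeasure \<xi> A \<in> range of_nat" by simp
    qed
    ultimately show "(\<lambda>\<xi>. emeasure \<xi> A) \<in> space counting_space \<rightarrow> range of_nat \<and>
        (\<forall>a\<in>range of_nat. (\<lambda>\<xi>. emeasure \<xi> A) -` {a} \<inter> space counting_space \<in> sets counting_space)"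
      by blast
  qed
  moreover have "(\<lambda>x. x) \<in> count_space (range of_nat :: ennreal set) \<rightarrow>\<^sub>M borel" by simp
  ultimately show ?thesis by (rule measurable_compose)
qed

lemma emeasure_SUP_window:
  assumes "\<xi> \<in> configurations" "A \<in> sets borel"
  shows "emeasure \<xi> A = (SUP n. emeasure \<xi> (A \<inter> window n))"
proof -
  have "(SUP n. emeasure \<xi> (A \<inter> window n)) = emeasure \<xi> (\<Union>n. A \<inter> window n)"
  proof (rule SUP_emeasure_incseq)
    show "range (\<lambda>n. A \<inter> window n) \<subseteq> sets \<xi>"
      using assms by (auto simp: sets_configuration)
    show "incseq (\<lambda>n. A \<inter> window n)"
      unfolding incseq_def using window_mono by (metis Int_mono order_refl)
  qed
  also have "(\<Union>n. A \<inter> window n) = A \<inter> (\<Union>n. window n)" by blast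
  also have "\<dots> = A" by (simp add: Union_window)
  finally show ?thesis ..
qed

lemma measurable_eval [measurable]:
  assumes "A \<in> sets borel"
  shows "(\<lambda>\<xi>. emeasure \<xi> A) \<in> borel_measurable counting_space"
proof (subst measurable_cong[OF emeasure_SUP_window[OF _ assms]])
  show "(\<lambda>\<xi>. SUP n. emeasure \<xi> (A \<inter> window n)) \<in> borel_measurable counting_space"
    by (intro borel_measurable_SUP measurable_eval_bounded) (use assms in auto)
qed simp

lemma measurable_counting_space_nat:
  assumes "\<And>\<omega>. \<omega> \<in> space M \<Longrightarrow> f \<omega> \<in> configurations"
    and "\<And>A n k. A \<in> sets borel \<Longrightarrow> A \<subseteq> window n \<Longrightarrow>
      {\<omega> \<in> space M. emeasure (f \<omega>) A = of_nat k} \<in> sets M"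
  shows "f \<in> M \<rightarrow>\<^sub>M counting_space"
  unfolding counting_space_def
proof (rule measurable_measure_of[OF counting_sets_Pow])
  fix y assume "y \<in> {{\<xi> \<in> configurations. emeasure \<xi> A = of_nat k} |
      A k n. A \<in> sets (borel :: 'b measure) \<and> A \<subseteq> window n}"
  then obtain A k n where y: "y = {\<xi> \<in> configurations. emeasure \<xi> A = of_nat k}"
    and A: "A \<in> sets borel" "A \<subseteq> window n" by blast
  have "f -` y \<inter> space M = {\<omega> \<in> space M. emeasure (f \<omega>) A = of_nat k}"
    using assms(1) y by auto
  then show "f -` y \<inter> space M \<in> sets M" using assms(2)[OF A] by simp
qed (use assms(1) in auto)

lemma measurable_counting_space:
  fixes f :: "'w \<Rightarrow> 'a::metric_space measure"
  assumes "\<And>\<omega>. \<omega> \<in> space M \<Longrightarrow> f \<omega> \<in> configurations"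
    and "\<And>A n. A \<in> sets borel \<Longrightarrow> A \<subseteq> window n \<Longrightarrow> (\<lambda>\<omega>. emeasure (f \<omega>) A) \<in> borel_measurable M"
  shows "f \<in> M \<rightarrow>\<^sub>M counting_space"
proof (rule measurable_counting_space_nat[OF assms(1)])
  fix A :: "'a set" and n k :: nat assume A: "A \<in> sets borel" "A \<subseteq> window n"
  have "(\<lambda>\<omega>. emeasure (f \<omega>) A) -` {of_nat k} \<inter> space M \<in> sets M"
    using assms(2)[OF A] by (rule measurable_sets) simp
  also have "(\<lambda>\<omega>. emeasure (f \<omega>) A) -` {of_nat k} \<inter> space M = {\<omega> \<in> space M. emeasure (f \<omega>) A = of_nat k}"
    by auto
  finally show "{\<omega> \<in> space M. emeasure (f \<omega>) A = of_nat k} \<in> sets M" .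
qed

section \<open>Nested finite partitions of a window\<close>

definition base_set :: "nat \<Rightarrow> 'a::{metric_space, second_countable_topology} set" where
  "base_set = from_nat_into (SOME B. countable B \<and> topological_basis B)"

lemma base_set:
  shows open_base_set: "open (base_set i :: 'a::{metric_space, second_countable_topology} set)"
    and base_set_base: "\<And>W x. open W \<Longrightarrow> x \<in> W \<Longrightarrow>
      \<exists>i. (x :: 'a) \<in> base_set i \<and> base_set i \<subseteq> W"
proof -
  obtain B :: "'a set set" where "countable B \<and> topological_basis B"
    using ex_countable_basis by blast
  from someI[of "\<lambda>B. countable B \<and> topological_basis B", OF this]
  obtain B :: "'a set set" where B: "countable B" "topological_basis B"
    "base_set = from_nat_into B" unfolding base_set_def by blast
  have ne: "B \<noteq> {}"
    using B(2) by (metis UNIV_I empty_iff open_UNIV topological_basisE)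
  show "open (base_set i :: 'a set)"
    unfolding B(3) by (rule topological_basis_open[OF B(2) from_nat_into[OF ne]])
  fix W and x :: 'a assume "open W" "x \<in> W"
  then obtain V where "V \<in> B" "x \<in> V" "V \<subseteq> W" using topological_basisE[OF B(2)] by blast
  then show "\<exists>i. x \<in> base_set i \<and> base_set i \<subseteq> W"
    unfolding B(3) using from_nat_into_surj[OF B(1)] by metis
qed

text \<open>The binary number whose digits record membership in the first \<open>m\<close> base
  sets. Its fibres are the atoms of the algebra generated by these sets, so they get finer as
  \<open>m\<close> grows.\<close>

definition code :: "nat \<Rightarrow> 'a::{metric_space, second_countable_topology} \<Rightarrow> nat" where
  "code m x = (\<Sum>i<m. if x \<in> base_set i then 2 ^ i else 0)"

lemma code_less: "code m x < 2 ^ m"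
  unfolding code_def by (induction m) auto

lemma code_Suc: "code (Suc m) x = code m x + (if x \<in> base_set m then 2 ^ m else 0)"
  by (simp add: code_def)

lemma code_eq_iff: "code m x = code m y \<longleftrightarrow> (\<forall>i<m. x \<in> base_set i \<longleftrightarrow> y \<in> base_set i)"
proof (induction m)
  case (Suc m)
  have "code (Suc m) x = code (Suc m) y \<longleftrightarrow> code m x = code m y \<and> (x \<in> base_set m \<longleftrightarrow> y \<in> base_set m)"
    using code_less[of m x] code_less[of m y] by (auto simp: code_Suc)
  then show ?case using Suc by (auto simp: less_Suc_eq)
qed (simp add: code_def)

lemma measurable_code [measurable]: "code m \<in> borel \<rightarrow>\<^sub>M count_space (UNIV :: nat set)"
proof -
  have [measurable]: "base_set i \<in> sets borel" for i by (rule borel_open[OF open_base_set])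
  have "(\<lambda>x. \<Sum>i<m. if x \<in> base_set i then 2 ^ i else 0 :: nat) \<in> borel \<rightarrow>\<^sub>M count_space UNIV"
    by measurable
  then show ?thesis unfolding code_def .
qed

text \<open>Once a base set between \<open>x\<close> and \<open>W\<close> is among the first
  \<open>m\<close>, its digit decides. This is the sense in which fine cells become small.\<close>

lemma code_separates_open:
  assumes "open W" "x \<in> W"
  shows "\<exists>m0. \<forall>m\<ge>m0. \<forall>y. code m y = code m x \<longrightarrow> y \<in> W"
proof -
  obtain i where "x \<in> base_set i" "base_set i \<subseteq> W" using base_set_base[OF assms] by blast
  then show ?thesis by (intro exI[of _ "Suc i"]) (auto simp: code_eq_iff)
qed

lemma code_mono: "code m x = code m y \<Longrightarrow> k \<le> m \<Longrightarrow> code k x = code k y"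
  by (auto simp: code_eq_iff)

definition cell :: "nat \<Rightarrow> nat \<Rightarrow> nat \<Rightarrow> 'a::{metric_space, second_countable_topology} set" where
  "cell m n j = {x \<in> window n. code m x = j}"

lemma cell_borel [measurable, simp]:
  "cell m n j \<in> sets (borel :: 'a::{metric_space, second_countable_topology} measure)"
proof -
  have "(code m :: 'a \<Rightarrow> nat) -` {j} \<inter> space borel \<in> sets borel"
    by (rule measurable_sets[OF measurable_code]) simp
  moreover have "(cell m n j :: 'a set) = window n \<inter> (code m -` {j} \<inter> space borel)" by (auto simp: cell_def)
  ultimately show ?thesis by simp
qed

lemma cell_subset_window: "cell m n j \<subseteq> window n"
  by (auto simp: cell_def)

lemma disjoint_cells: "disjoint_family (cell m n)"
  by (auto simp: disjoint_family_on_def cell_def)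

lemma Union_cells: "(\<Union>j<2^m. cell m n j) = window n"
  using code_less by (auto simp: cell_def)

section \<open>The vague Borel sets\<close>

text \<open>Restricted to the window, \<xi> is the image under \<open>x\<close> of the counting
  measure on \<open>{..<N}\<close>, which turns the Bochner integral into a finite sum.\<close>

lemma integral_configuration:
  fixes f :: "'a::metric_space \<Rightarrow> real" and N :: nat
  assumes \<xi>: "\<xi> \<in> configurations" and x: "\<forall>i<N. x i \<in> window n"
    and em: "\<forall>A\<in>sets borel. emeasure \<xi> (A \<inter> window n) = of_nat (card {i. i < N \<and> x i \<in> A})"
    and f: "f \<in> borel_measurable borel" "\<And>y. y \<notin> window n \<Longrightarrow> f y = 0"
  shows "(\<integral>y. f y \<partial>\<xi>) = (\<Sum>i<N. f (x i))"
proof -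
  have s: "sets \<xi> = sets borel" using \<xi> by (rule sets_configuration)
  have eq: "density \<xi> (indicator (window n)) = distr (count_space {..<N}) borel x"
  proof (rule measure_eqI)
    fix A assume "A \<in> sets (density \<xi> (indicator (window n)))"
    then have A: "A \<in> sets borel" using s by simp
    have "emeasure (density \<xi> (indicator (window n))) A = emeasure \<xi> (A \<inter> window n)"
      using A s by (subst emeasure_restricted) (auto simp: Int_commute)
    also have "\<dots> = of_nat (card {i. i < N \<and> x i \<in> A})" using em A by blast
    also have "\<dots> = emeasure (distr (count_space {..<N}) borel x) A"
    proof -
      have "x -` A \<inter> {..<N} = {i. i < N \<and> x i \<in> A}" by auto
      then show ?thesis using A by (subst emeasure_distr) (auto intro!: emeasure_count_space_finite[symmetric])
    qed
    finally show "emeasure (density \<xi> (indicator (window n))) A =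
      emeasure (distr (count_space {..<N}) borel x) A" .
  qed (use s in simp)
  have fm: "f \<in> borel_measurable \<xi>" using f(1) s by (simp cong: measurable_cong_sets)
  have wm: "indicator (window n) \<in> borel_measurable \<xi>" using s by simp
  have "(\<integral>y. f y \<partial>\<xi>) = (\<integral>y. indicator (window n) y *\<^sub>R f y \<partial>\<xi>)"
    by (intro Bochner_Integration.integral_cong) (auto simp: indicator_def f(2))
  also have "\<dots> = (\<integral>y. f y \<partial>density \<xi> (\<lambda>y. ennreal (indicator (window n) y)))"
    using fm wm by (intro integral_density[symmetric]) auto
  also have "\<dots> = (\<integral>y. f y \<partial>distr (count_space {..<N}) borel x)"
    by (simp add: ennreal_indicator eq)
  also have "\<dots> = (\<Sum>i<N. f (x i))"
    using f(1) by (subst integral_distr) (auto simp: lebesgue_integral_count_space_finite)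
  finally show ?thesis .
qed

section \<open>A countable network for the vague topology\<close>

definition cell_events :: "'a::{metric_space, second_countable_topology} measure set set" where
  "cell_events = range (\<lambda>(m, n, j, k::nat). {\<xi> \<in> configurations. emeasure \<xi> (cell m n j) = of_nat k})"

text \<open>The members need not be vaguely open; what counts is that there are countably many and
  that every vaguely open set is a union of some of them. Intersecting with
  \<open>configurations\<close> gives the right value for \<open>T = {}\<close>.\<close>

definition cell_base :: "'a::{metric_space, second_countable_topology} measure set set" where
  "cell_base = (\<lambda>T. configurations \<inter> \<Inter>T) ` {T. finite T \<and> T \<subseteq> cell_events}"

lemma countable_cell_base: "countable cell_base"
  unfolding cell_base_def cell_events_def
  by (intro countable_image countable_Collect_finite_subset) auto

lemma cell_events_sets: "cell_events \<subseteq> sets counting_space"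
proof
  fix S :: "'a measure set" assume "S \<in> cell_events"
  then obtain m n j k where S: "S = {\<xi> \<in> configurations. emeasure \<xi> (cell m n j) = of_nat (k::nat)}"
    by (auto simp: cell_events_def)
  have "(\<lambda>\<xi>. emeasure \<xi> (cell m n j :: 'a set)) -` {of_nat k} \<inter> space counting_space \<in> sets counting_space"
    by (rule measurable_sets[OF measurable_eval]) auto
  also have "(\<lambda>\<xi>. emeasure \<xi> (cell m n j :: 'a set)) -` {of_nat k} \<inter> space counting_space = S"
    using S by auto
  finally show "S \<in> sets counting_space" .
qed

lemma cell_base_sets: "cell_base \<subseteq> sets counting_space"
proof
  fix W :: "'a measure set" assume "W \<in> cell_base"
  then obtain T where T: "finite T" "T \<subseteq> cell_events" "W = configurations \<inter> \<Inter>T"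
    by (auto simp: cell_base_def)
  have "space counting_space \<inter> \<Inter>T \<in> sets counting_space"
  proof (cases "T = {}")
    case False
    have "\<Inter>T \<in> sets counting_space"
      using sets.finite_INT[OF T(1) False, of "\<lambda>S. S"] T(2) cell_events_sets by auto
    then show ?thesis by (intro sets.Int sets.top)
  qed (simp only: Inter_empty Int_UNIV_right sets.top)
  then show "W \<in> sets counting_space" using T(3) by simp
qed

lemma cell_base_Int: "V \<in> cell_base \<Longrightarrow> W \<in> cell_base \<Longrightarrow> V \<inter> W \<in> cell_base"
  unfolding cell_base_def
proof (elim imageE)
  fix S T assume "V = configurations \<inter> \<Inter>S" "S \<in> {T. finite T \<and> T \<subseteq> cell_events}"
    "W = configurations \<inter> \<Inter>T" "T \<in> {T. finite T \<and> T \<subseteq> cell_events}"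
  then show "V \<inter> W \<in> (\<lambda>T. configurations \<inter> \<Inter>T) ` {T. finite T \<and> T \<subseteq> cell_events}"
    by (intro image_eqI[of _ _ "S \<union> T"]) auto
qed

text \<open>If \<open>f\<close> is nearly constant on each occupied cell, the cell counts determine
  its sum over the points up to \<open>d\<close> per point. Two configurations with equal counts can
  then be compared through the same step sum.\<close>

lemma sum_step_approximation:
  fixes f :: "'a::{metric_space, second_countable_topology} \<Rightarrow> real" and N :: nat
  assumes x: "\<forall>i<N. x i \<in> window n"
    and k: "\<And>j. j < 2 ^ m \<Longrightarrow> card {i. i < N \<and> x i \<in> cell m n j} = k j"
    and \<gamma>: "\<And>y. k (code m y) > 0 \<Longrightarrow> \<bar>f y - \<gamma> (code m y)\<bar> \<le> d"
  shows "\<bar>(\<Sum>i<N. f (x i)) - (\<Sum>j<2^m. real (k j) * \<gamma> j)\<bar> \<le> d * real (\<Sum>j<2^m. k j)"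
    and "N = (\<Sum>j<2^m. k j)"
proof -
  have cell: "{i \<in> {..<N}. code m (x i) = j} = {i. i < N \<and> x i \<in> cell m n j}" for j
    using x by (auto simp: cell_def)
  have im: "(\<lambda>i. code m (x i)) ` {..<N} \<subseteq> {..<2^m}" using code_less by auto
  have "(\<Sum>i<N. \<gamma> (code m (x i))) = (\<Sum>j<2^m. \<Sum>i\<in>{i \<in> {..<N}. code m (x i) = j}. \<gamma> (code m (x i)))"
    by (rule sum.group[OF _ _ im, symmetric]) auto
  also have "\<dots> = (\<Sum>j<2^m. real (k j) * \<gamma> j)"
  proof (intro sum.cong refl)
    fix j :: nat assume j: "j \<in> {..<2^m}"
    have "(\<Sum>i\<in>{i \<in> {..<N}. code m (x i) = j}. \<gamma> (code m (x i))) = (\<Sum>i\<in>{i \<in> {..<N}. code m (x i) = j}. \<gamma> j)"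
      by (intro sum.cong) auto
    then show "(\<Sum>i\<in>{i \<in> {..<N}. code m (x i) = j}. \<gamma> (code m (x i))) = real (k j) * \<gamma> j"
      using k j unfolding cell by simp
  qed
  finally have step: "(\<Sum>i<N. \<gamma> (code m (x i))) = (\<Sum>j<2^m. real (k j) * \<gamma> j)" .
  have "(\<Sum>i<N. 1::nat) = (\<Sum>j<2^m. \<Sum>i\<in>{i \<in> {..<N}. code m (x i) = j}. 1)"
    by (rule sum.group[OF _ _ im, symmetric]) auto
  also have "\<dots> = (\<Sum>j<2^m. k j)"
  proof (intro sum.cong refl)
    fix j :: nat assume "j \<in> {..<2^m}"
    then show "(\<Sum>i\<in>{i \<in> {..<N}. code m (x i) = j}. 1) = k j"
      unfolding cell using k by simp
  qed
  finally show N: "N = (\<Sum>j<2^m. k j)" by simp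
  have "\<bar>f (x i) - \<gamma> (code m (x i))\<bar> \<le> d" if i: "i < N" for i
  proof (rule \<gamma>)
    have "i \<in> {i'. i' < N \<and> x i' \<in> cell m n (code m (x i))}" using i x by (auto simp: cell_def)
    then have "card {i'. i' < N \<and> x i' \<in> cell m n (code m (x i))} > 0"
      by (subst card_gt_0_iff) auto
    then show "k (code m (x i)) > 0" using k[OF code_less[of m "x i"]] by simp
  qed
  then have "\<bar>\<Sum>i<N. f (x i) - \<gamma> (code m (x i))\<bar> \<le> (\<Sum>i<N. d)"
    by (intro order.trans[OF sum_abs] sum_mono) auto
  then show "\<bar>(\<Sum>i<N. f (x i)) - (\<Sum>j<2^m. real (k j) * \<gamma> j)\<bar> \<le> d * real (\<Sum>j<2^m. k j)"
    unfolding step[symmetric] sum_subtractf N[symmetric] by (simp add: mult.commute)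
qed

text \<open>Only finitely many atoms of \<zeta> lie in a window outside which \<open>f\<close>
  vanishes, so continuity at these atoms yields one common level \<open>m\<close>. Prescribing all
  counts at that level forces the points of \<xi> in the window into cells occupied by \<zeta>,
  where \<open>f\<close> is nearly constant.\<close>

lemma cell_base_subbasic:
  fixes f :: "'a::{metric_space, second_countable_topology} \<Rightarrow> real"
  assumes \<zeta>: "\<zeta> \<in> configurations" and f: "f \<in> vague_test_functions"
    and U: "open U" "(\<integral>y. f y \<partial>\<zeta>) \<in> U"
  shows "\<exists>W\<in>cell_base. \<zeta> \<in> W \<and> W \<subseteq> {\<xi> \<in> configurations. (\<integral>y. f y \<partial>\<xi>) \<in> U}"
proof -
  obtain e where e: "e > 0" "\<And>z. \<bar>z - (\<integral>y. f y \<partial>\<zeta>)\<bar> < e \<Longrightarrow> z \<in> U"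
    using U unfolding open_dist dist_real_def by blast
  have cont: "continuous_on UNIV f" using f by (simp add: vague_test_functions_def)
  then have fm: "f \<in> borel_measurable borel" by (rule borel_measurable_continuous_onI)
  obtain x r where xr: "\<And>y. y \<notin> cball x r \<Longrightarrow> f y = 0"
    using f unfolding vague_test_functions_def by blast
  obtain n where "cball x r \<subseteq> window n" using cball_subset_window by blast
  then have f0: "\<And>y. y \<notin> window n \<Longrightarrow> f y = 0" using xr by blast
  obtain N and y :: "nat \<Rightarrow> 'a" where y: "\<forall>i<N. y i \<in> window n"
    "\<forall>A\<in>sets borel. emeasure \<zeta> (A \<inter> window n) = of_nat (card {i. i < N \<and> y i \<in> A})"
    using configuration_atoms[OF \<zeta>, of n] by blast
  \<comment> \<open>Each of the two sums differs from the step sum by at most \<open>d * N\<close>.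
    The \<open>+ 1\<close> makes the total error strictly less than \<open>e\<close> and keeps
    \<open>d\<close> positive when \<zeta> has no point in the window.\<close>
  define d where "d = e / (2 * (real N + 1))"
  have d: "d > 0" using e by (simp add: d_def)
  have "\<exists>m0. \<forall>m\<ge>m0. \<forall>z. code m z = code m (y i) \<longrightarrow> \<bar>f z - f (y i)\<bar> < d" for i
  proof -
    have "open {z. \<bar>f z - f (y i)\<bar> < d}"
      by (intro open_Collect_less continuous_intros cont)
    from code_separates_open[OF this, of "y i"] d show ?thesis by auto
  qed
  then obtain m0 where m0: "\<And>i m z. m \<ge> m0 i \<Longrightarrow> code m z = code m (y i) \<Longrightarrow> \<bar>f z - f (y i)\<bar> < d"
    by metis
  \<comment> \<open>The sum serves as a common upper bound of finitely many levels.\<close>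
  define m where "m = (\<Sum>i<N. m0 i)"
  have m: "m \<ge> m0 i" if "i < N" for i
    unfolding m_def using that by (intro member_le_sum) auto
  define k where "k j = card {i. i < N \<and> y i \<in> cell m n j}" for j
  \<comment> \<open>The value of \<open>f\<close> at some atom of \<zeta> in the cell. For
    unoccupied cells the choice is arbitrary, but there the weight \<open>k j\<close> is
    zero.\<close>
  define \<gamma> where "\<gamma> j = f (y (SOME i. i < N \<and> code m (y i) = j))" for j
  have \<gamma>: "\<bar>f z - \<gamma> (code m z)\<bar> \<le> d" if "k (code m z) > 0" for z
  proof -
    from that obtain i where "i < N \<and> code m (y i) = code m z"
      unfolding k_def card_gt_0_iff cell_def by auto
    then have "(SOME i. i < N \<and> code m (y i) = code m z) < N \<and>
        code m (y (SOME i. i < N \<and> code m (y i) = code m z)) = code m z"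
      by (rule someI)
    then show ?thesis unfolding \<gamma>_def using m0[OF m] by fastforce
  qed
  have cell_Int: "(cell m n j :: 'a set) \<inter> window n = cell m n j" for j
    using cell_subset_window by blast
  have k\<zeta>: "emeasure \<zeta> (cell m n j) = of_nat (k j)" for j
    using y(2)[rule_format, of "cell m n j"] unfolding k_def cell_Int by simp
  define T where "T = (\<lambda>j. {\<xi> \<in> configurations. emeasure \<xi> (cell m n j :: 'a set) = of_nat (k j)}) ` {..<2^m}"
  define W where "W = configurations \<inter> \<Inter>T"
  have "T \<subseteq> cell_events"
    unfolding T_def cell_events_def by (auto intro!: rev_image_eqI[of "(m, n, j, k j)" for j])
  then have "W \<in> cell_base" unfolding cell_base_def W_def T_def by (intro imageI) auto
  moreover have "\<zeta> \<in> W" unfolding W_def T_def using k\<zeta> \<zeta> by auto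
  moreover have "(\<integral>y. f y \<partial>\<xi>) \<in> U" if "\<xi> \<in> W" for \<xi>
  proof -
    have \<xi>: "\<xi> \<in> configurations" using that by (simp add: W_def)
    have k\<xi>: "emeasure \<xi> (cell m n j) = of_nat (k j)" if "j < 2^m" for j
      using \<open>\<xi> \<in> W\<close> that unfolding W_def T_def by auto
    obtain N' and x :: "nat \<Rightarrow> 'a" where x: "\<forall>i<N'. x i \<in> window n"
      "\<forall>A\<in>sets borel. emeasure \<xi> (A \<inter> window n) = of_nat (card {i. i < N' \<and> x i \<in> A})"
      using configuration_atoms[OF \<xi>, of n] by blast
    have kx: "card {i. i < N' \<and> x i \<in> cell m n j} = k j" if "j < 2^m" for j
      using x(2)[rule_format, of "cell m n j"] k\<xi>[OF that] unfolding cell_Int by simp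
    have kd: "card {i. i < N \<and> y i \<in> cell m n j} = k j" for j
      by (simp add: k_def)
    have ax: "\<bar>(\<Sum>i<N'. f (x i)) - (\<Sum>j<2^m. real (k j) * \<gamma> j)\<bar> \<le> d * real (\<Sum>j<2^m. k j)"
      by (rule sum_step_approximation(1)[OF x(1)]) (use kx \<gamma> in auto)
    have ay: "\<bar>(\<Sum>i<N. f (y i)) - (\<Sum>j<2^m. real (k j) * \<gamma> j)\<bar> \<le> d * real (\<Sum>j<2^m. k j)"
      by (rule sum_step_approximation(1)[OF y(1)]) (use kd \<gamma> in auto)
    have N: "N = (\<Sum>j<2^m. k j)"
      by (rule sum_step_approximation(2)[OF y(1)]) (use kd \<gamma> in auto)
    have "2 * d * real N < e" using e by (simp add: d_def field_simps)
    then have "\<bar>(\<Sum>i<N'. f (x i)) - (\<Sum>i<N. f (y i))\<bar> < e"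
      using ax ay unfolding N[symmetric] by linarith
    then show ?thesis
      using e(2) integral_configuration[OF \<xi> x fm f0] integral_configuration[OF \<zeta> y fm f0] by simp
  qed
  ultimately show ?thesis using W_def by blast
qed

text \<open>Induction on the generation of the topology: the intersection case is the reason for
  closing the cell events under finite intersections.\<close>

lemma vague_open_cell_base:
  assumes "openin vague_topology V" "\<zeta> \<in> V"
  shows "\<exists>W\<in>cell_base. \<zeta> \<in> W \<and> W \<subseteq> V"
  using assms unfolding vague_topology_def openin_topology_generated_by_iff
proof (induction V)
  case (Int a b)
  then obtain W W' where "W \<in> cell_base" "\<zeta> \<in> W \<and> W \<subseteq> a" "W' \<in> cell_base" "\<zeta> \<in> W' \<and> W' \<subseteq> b"
    by blast
  then show ?case by (intro bexI[of _ "W \<inter> W'"] cell_base_Int) auto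
next
  case (UN K)
  then obtain k where "k \<in> K" "\<zeta> \<in> k" by blast
  with UN obtain W where "W \<in> cell_base" "\<zeta> \<in> W \<and> W \<subseteq> k" by blast
  with \<open>k \<in> K\<close> show ?case by blast
next
  case (Basis s)
  then obtain f U where s: "s = {\<xi> \<in> configurations. (\<integral>y. f y \<partial>\<xi>) \<in> U}"
    "f \<in> vague_test_functions" "open U" by blast
  with Basis show ?case using cell_base_subbasic[of \<zeta> f U] by simp
qed simp

text \<open>Since \<open>cell_base\<close> is countable, the union of all members inside a vaguely
  open set is a countable union of count events.\<close>

lemma sets_configuration_space_subset:
  "sets (configuration_space :: 'a::{metric_space, second_countable_topology} measure measure)
     \<subseteq> sets counting_space"
proof -
  have open_sets: "V \<in> sets counting_space" if V: "openin vague_topology V" for V :: "'a measure set"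
  proof -
    have "V = \<Union>{W \<in> cell_base. W \<subseteq> V}" using vague_open_cell_base[OF V] by blast
    also have "\<dots> \<in> sets counting_space"
      using countable_cell_base cell_base_sets by (intro sets.countable_Union) (auto intro: countable_subset)
    finally show ?thesis .
  qed
  have "{U. openin vague_topology U} \<subseteq> Pow (configurations :: 'a measure set)"
    using openin_subset topspace_vague_topology by fastforce
  then have "sets (configuration_space :: 'a measure measure) =
      sigma_sets configurations {U. openin vague_topology U}"
    by (simp add: configuration_space_def)
  also have "\<dots> \<subseteq> sets counting_space"
    using sets.sigma_sets_subset[of "{U. openin vague_topology U}" counting_space] open_sets by auto
  finally show ?thesis .
qed

lemma space_configuration_space [simp]: "space configuration_space = configurations"
proof -
  have "{U. openin vague_topology U} \<subseteq> Pow (configurations :: 'a::metric_space measure set)"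
    using openin_subset topspace_vague_topology by fastforce
  then show ?thesis by (simp add: configuration_space_def space_measure_of_conv)
qed

lemma measurable_counting_from_configuration_space:
  assumes "F \<in> configuration_space \<rightarrow>\<^sub>M N"
  shows "F \<in> (counting_space :: 'a::{metric_space, second_countable_topology} measure measure) \<rightarrow>\<^sub>M N"
proof -
  have "(\<lambda>\<xi>. \<xi>) \<in> counting_space \<rightarrow>\<^sub>M (configuration_space :: 'a measure measure)"
    using sets_configuration_space_subset
    by (intro measurableI) (auto simp: sets.sets_into_space)
  then show ?thesis using assms by (rule measurable_compose)
qed

section \<open>Resampling of a Poisson configuration\<close>

definition restr :: "'a set \<Rightarrow> 'a::metric_space measure \<Rightarrow> 'a measure" where
  "restr C \<xi> = density \<xi> (indicator C)"

lemma emeasure_restr: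
  assumes "\<xi> \<in> configurations" "C \<in> sets borel" "A \<in> sets borel"
  shows "emeasure (restr C \<xi>) A = emeasure \<xi> (A \<inter> C)"
  using assms by (simp add: restr_def emeasure_restricted sets_configuration Int_commute)

lemma restr_configuration:
  assumes "\<xi> \<in> configurations" "C \<in> sets borel"
  shows "restr C \<xi> \<in> configurations"
  unfolding configurations_iff_windows
proof (intro conjI allI)
  show "sets (restr C \<xi>) = sets borel" using assms by (simp add: restr_def sets_configuration)
  fix n
  obtain xs where xs: "\<And>A. A \<in> sets borel \<Longrightarrow>
      emeasure \<xi> (A \<inter> window n) = (\<Sum>y\<leftarrow>xs. emeasure (return borel y) A)"
    using assms unfolding configurations_iff_windows by blast
  have "emeasure (restr C \<xi>) (A \<inter> window n) =
      (\<Sum>y\<leftarrow>filter (\<lambda>y. y \<in> C) xs. emeasure (return borel y) A)" if A: "A \<in> sets borel" for A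
  proof -
    have AC: "A \<inter> C \<in> sets borel" using A assms by auto
    have "emeasure (restr C \<xi>) (A \<inter> window n) = emeasure \<xi> ((A \<inter> C) \<inter> window n)"
      using assms A by (subst emeasure_restr) (auto simp: Int_ac)
    also have "\<dots> = (\<Sum>y\<leftarrow>xs. emeasure (return borel y) (A \<inter> C))" using xs[OF AC] .
    also have "\<dots> = (\<Sum>y\<leftarrow>filter (\<lambda>y. y \<in> C) xs. emeasure (return borel y) A)"
      using A AC by (induction xs) (auto simp: indicator_def)
    finally show ?thesis .
  qed
  then show "\<exists>xs. \<forall>A\<in>sets borel. emeasure (restr C \<xi>) (A \<inter> window n) =
      (\<Sum>y\<leftarrow>xs. emeasure (return borel y) A)" by blast
qed

lemma add_configuration:
  assumes "\<xi> \<in> configurations" "\<zeta> \<in> configurations"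
  shows "add_measure \<xi> \<zeta> \<in> configurations"
  unfolding configurations_iff_windows
proof (intro conjI allI)
  show "sets (add_measure \<xi> \<zeta>) = sets borel" using assms by (simp add: sets_configuration)
  fix n
  obtain xs where xs: "\<And>A. A \<in> sets borel \<Longrightarrow>
      emeasure \<xi> (A \<inter> window n) = (\<Sum>y\<leftarrow>xs. emeasure (return borel y) A)"
    using assms unfolding configurations_iff_windows by blast
  obtain ys where ys: "\<And>A. A \<in> sets borel \<Longrightarrow>
      emeasure \<zeta> (A \<inter> window n) = (\<Sum>y\<leftarrow>ys. emeasure (return borel y) A)"
    using assms unfolding configurations_iff_windows by blast
  have "emeasure (add_measure \<xi> \<zeta>) (A \<inter> window n) = (\<Sum>y\<leftarrow>xs @ ys. emeasure (return borel y) A)"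
    if A: "A \<in> sets borel" for A
    using A assms xs[OF A] ys[OF A] by (simp add: emeasure_add_measure sets_configuration)
  then show "\<exists>xs. \<forall>A\<in>sets borel. emeasure (add_measure \<xi> \<zeta>) (A \<inter> window n) =
      (\<Sum>y\<leftarrow>xs. emeasure (return borel y) A)" by blast
qed

text \<open>If \<zeta> is an independent copy, this is \<xi> with its points outside
  \<open>C\<close> resampled.\<close>

definition glue :: "'a set \<Rightarrow> 'a::metric_space measure \<Rightarrow> 'a measure \<Rightarrow> 'a measure" where
  "glue C \<xi> \<zeta> = add_measure (restr C \<xi>) (restr (- C) \<zeta>)"

lemma glue_configuration:
  "\<xi> \<in> configurations \<Longrightarrow> \<zeta> \<in> configurations \<Longrightarrow> C \<in> sets borel \<Longrightarrow> glue C \<xi> \<zeta> \<in> configurations"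
  unfolding glue_def by (intro add_configuration restr_configuration) auto

lemma emeasure_glue:
  assumes "\<xi> \<in> configurations" "\<zeta> \<in> configurations" "C \<in> sets borel" "A \<in> sets borel"
  shows "emeasure (glue C \<xi> \<zeta>) A = emeasure \<xi> (A \<inter> C) + emeasure \<zeta> (A - C)"
proof -
  have "sets (restr C \<xi>) = sets borel" "sets (restr (- C) \<zeta>) = sets borel"
    using assms by (auto intro!: sets_configuration restr_configuration)
  then show ?thesis
    using assms by (simp add: glue_def emeasure_add_measure emeasure_restr Diff_eq)
qed

lemma measurable_glue [measurable]:
  assumes "C \<in> sets borel"
  shows "(\<lambda>p. glue C (fst p) (snd p)) \<in> counting_space \<Otimes>\<^sub>M counting_space \<rightarrow>\<^sub>M counting_space"
proof (rule measurable_counting_space)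
  fix p :: "'a measure \<times> 'a measure" assume "p \<in> space (counting_space \<Otimes>\<^sub>M counting_space)"
  then show "glue C (fst p) (snd p) \<in> configurations"
    using assms by (intro glue_configuration) (auto simp: space_pair_measure)
next
  fix A :: "'a set" and n :: nat assume A: "A \<in> sets borel"
  have [measurable]: "A \<inter> C \<in> sets borel" "A - C \<in> sets borel" using A assms by auto
  have "(\<lambda>p. emeasure (fst p) (A \<inter> C) + emeasure (snd p) (A - C))
      \<in> borel_measurable (counting_space \<Otimes>\<^sub>M counting_space)"
    by measurable
  then show "(\<lambda>p. emeasure (glue C (fst p) (snd p)) A) \<in> borel_measurable (counting_space \<Otimes>\<^sub>M counting_space)"
    using A assms by (subst measurable_cong[OF emeasure_glue]) (auto simp: space_pair_measure)
qed

lemma measurable_restr [measurable]: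
  assumes "C \<in> sets borel"
  shows "restr C \<in> counting_space \<rightarrow>\<^sub>M counting_space"
proof (rule measurable_counting_space)
  fix A :: "'a set" and n :: nat assume A: "A \<in> sets borel"
  have [measurable]: "A \<inter> C \<in> sets borel" using A assms by auto
  have "(\<lambda>\<xi>. emeasure \<xi> (A \<inter> C)) \<in> borel_measurable counting_space" by measurable
  then show "(\<lambda>\<xi>. emeasure (restr C \<xi>) A) \<in> borel_measurable counting_space"
    using A assms by (subst measurable_cong[OF emeasure_restr]) auto
qed (use assms in \<open>auto intro: restr_configuration\<close>)

text \<open>\<open>C\<close> is the part that stays: the two copies exchange their points outside
  \<open>C\<close>. Invariance of the product law under this map is the form in which the
  independence of the process is used.\<close>

definition swap_parts :: "'a set \<Rightarrow> 'a::metric_space measure \<times> 'a measure \<Rightarrow> 'a measure \<times> 'a measure" where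
  "swap_parts C p = (glue C (fst p) (snd p), glue C (snd p) (fst p))"

lemma measurable_swap_parts [measurable]:
  assumes "C \<in> sets borel"
  shows "swap_parts C \<in> counting_space \<Otimes>\<^sub>M counting_space \<rightarrow>\<^sub>M counting_space \<Otimes>\<^sub>M counting_space"
proof -
  have "(\<lambda>p. (snd p, fst p)) \<in> counting_space \<Otimes>\<^sub>M counting_space \<rightarrow>\<^sub>M
      counting_space \<Otimes>\<^sub>M (counting_space :: 'a measure measure)" by measurable
  from measurable_compose[OF this measurable_glue[OF assms]]
  have "(\<lambda>p. glue C (snd p) (fst p)) \<in> counting_space \<Otimes>\<^sub>M counting_space \<rightarrow>\<^sub>M counting_space" by simp
  then show ?thesis unfolding swap_parts_def using measurable_glue[OF assms] by (rule measurable_Pair[rotated])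
qed

section \<open>Generators of the product sigma-algebra\<close>

definition side :: "bool \<Rightarrow> 'b \<times> 'b \<Rightarrow> 'b" where
  "side s p = (if s then fst p else snd p)"

text \<open>Each constraint carries the coordinate that it concerns. A conjunction is then a union
  of index sets, which makes the cylinders a \<pi>-system.\<close>

definition cylinder :: "(bool \<times> 'a set \<times> nat) set \<Rightarrow> ('a::metric_space measure \<times> 'a measure) set" where
  "cylinder T = {p \<in> configurations \<times> configurations.
     \<forall>(s, B, k)\<in>T. emeasure (side s p) B = of_nat k}"

definition cylinders :: "('a::metric_space measure \<times> 'a measure) set set" where
  "cylinders = cylinder ` {T. finite T \<and> (\<forall>(s, B, k)\<in>T. B \<in> sets borel \<and> (\<exists>n. B \<subseteq> window n))}"

lemma measurable_side [measurable]: "side s \<in> M \<Otimes>\<^sub>M M \<rightarrow>\<^sub>M M"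
  by (cases s) (simp_all add: side_def[abs_def])

lemma cylinder_single_sets:
  assumes "B \<in> sets borel"
  shows "{p \<in> configurations \<times> configurations. emeasure (side s p) B = of_nat k}
    \<in> sets (counting_space \<Otimes>\<^sub>M counting_space)"
proof -
  have "(\<lambda>p. emeasure (side s p) B) \<in> borel_measurable (counting_space \<Otimes>\<^sub>M counting_space)"
    by (rule measurable_compose[OF measurable_side measurable_eval[OF assms]])
  then have "(\<lambda>p. emeasure (side s p) B) -` {of_nat k} \<inter> space (counting_space \<Otimes>\<^sub>M counting_space)
      \<in> sets (counting_space \<Otimes>\<^sub>M counting_space)"
    by (rule measurable_sets) simp
  also have "(\<lambda>p. emeasure (side s p) B) -` {of_nat k} \<inter> space (counting_space \<Otimes>\<^sub>M counting_space) =
      {p \<in> configurations \<times> configurations. emeasure (side s p) B = of_nat k}"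
    by (auto simp: space_pair_measure)
  finally show ?thesis .
qed

lemma cylinder_sets:
  fixes T :: "(bool \<times> 'a::metric_space set \<times> nat) set"
  assumes "finite T" "\<forall>(s, B, k)\<in>T. B \<in> sets borel"
  shows "cylinder T \<in> sets (counting_space \<Otimes>\<^sub>M counting_space)"
  using assms
proof (induction T)
  case empty
  have "(cylinder {} :: ('a measure \<times> 'a measure) set) = space (counting_space \<Otimes>\<^sub>M counting_space)"
    by (auto simp: cylinder_def space_pair_measure)
  then show ?case by (simp only: sets.top)
next
  case (insert t T)
  obtain s B k where t: "t = (s, B, k)" by (cases t)
  have "cylinder (insert t T) = {p \<in> configurations \<times> configurations. emeasure (side s p) B = of_nat k} \<inter> cylinder T"
    by (auto simp: cylinder_def t)
  then show ?case using insert cylinder_single_sets[of B s k] by (auto simp: t)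
qed

text \<open>Both projections are measurable for the sigma-algebra generated by the cylinders, hence
  so is the identity into the product; this gives the inclusion that is not immediate.\<close>

lemma sets_pair_counting_space:
  "sets (counting_space \<Otimes>\<^sub>M counting_space) =
     sigma_sets (configurations \<times> configurations) (cylinders :: ('a::metric_space measure \<times> 'a measure) set set)"
proof
  have Pow: "(cylinders :: ('a measure \<times> 'a measure) set set) \<subseteq> Pow (configurations \<times> configurations)"
    by (auto simp: cylinders_def cylinder_def)
  define N where "N = sigma (configurations \<times> configurations) (cylinders :: ('a measure \<times> 'a measure) set set)"
  have spN: "space N = configurations \<times> configurations" using Pow by (simp add: N_def space_measure_of_conv)
  have setsN: "sets N = sigma_sets (configurations \<times> configurations) cylinders"
    using Pow by (simp add: N_def)
  have m: "side s \<in> N \<rightarrow>\<^sub>M counting_space" for s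
  proof (rule measurable_counting_space_nat)
    show "side s p \<in> configurations" if "p \<in> space N" for p
      using that by (auto simp: spN side_def)
    fix A :: "'a set" and n k assume "A \<in> sets borel" "A \<subseteq> window n"
    then have "cylinder {(s, A, k)} \<in> cylinders" unfolding cylinders_def by (intro imageI) auto
    then have "cylinder {(s, A, k)} \<in> sets N" unfolding setsN by (rule sigma_sets.Basic)
    moreover have "{p \<in> space N. emeasure (side s p) A = of_nat k} = cylinder {(s, A, k)}"
      by (auto simp: spN cylinder_def)
    ultimately show "{p \<in> space N. emeasure (side s p) A = of_nat k} \<in> sets N" by simp
  qed
  have "(\<lambda>p. (side True p, side False p)) \<in> N \<rightarrow>\<^sub>M counting_space \<Otimes>\<^sub>M counting_space"
    by (intro measurable_Pair m)
  then have id: "(\<lambda>p. p) \<in> N \<rightarrow>\<^sub>M counting_space \<Otimes>\<^sub>M counting_space" by (simp add: side_def)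
  show "sets (counting_space \<Otimes>\<^sub>M counting_space) \<subseteq> sigma_sets (configurations \<times> configurations)
      (cylinders :: ('a measure \<times> 'a measure) set set)"
  proof
    fix S :: "('a measure \<times> 'a measure) set" assume S: "S \<in> sets (counting_space \<Otimes>\<^sub>M counting_space)"
    then have "S \<subseteq> space N" using sets.sets_into_space by (fastforce simp: spN space_pair_measure)
    then have "(\<lambda>p. p) -` S \<inter> space N = S" by auto
    then show "S \<in> sigma_sets (configurations \<times> configurations) cylinders"
      using measurable_sets[OF id S] setsN by simp
  qed
  have "cylinders \<subseteq> sets (counting_space \<Otimes>\<^sub>M (counting_space :: 'a measure measure))"
    unfolding cylinders_def by (auto intro!: cylinder_sets)
  then show "sigma_sets (configurations \<times> configurations) cylinders
      \<subseteq> sets (counting_space \<Otimes>\<^sub>M (counting_space :: 'a measure measure))"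
    using sets.sigma_sets_subset[of cylinders "counting_space \<Otimes>\<^sub>M (counting_space :: 'a measure measure)"]
    by (simp add: space_pair_measure)
qed

lemma Int_stable_cylinders: "Int_stable cylinders"
  unfolding Int_stable_def cylinders_def
proof (intro ballI, elim imageE)
  fix a b :: "('a measure \<times> 'a measure) set" and S T
  assume "a = cylinder S" "S \<in> {T. finite T \<and> (\<forall>(s, B, k)\<in>T. B \<in> sets borel \<and> (\<exists>n. B \<subseteq> window n))}"
    "b = cylinder T" "T \<in> {T. finite T \<and> (\<forall>(s, B, k)\<in>T. B \<in> sets borel \<and> (\<exists>n. B \<subseteq> window n))}"
  then show "a \<inter> b \<in> cylinder ` {T. finite T \<and> (\<forall>(s, B, k)\<in>T. B \<in> sets borel \<and> (\<exists>n. B \<subseteq> window n))}"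
    by (intro image_eqI[of _ _ "S \<union> T"]) (auto simp: cylinder_def ball_Un)
qed

text \<open>The atoms of the algebra generated by \<open>\<B>\<close> and \<open>C\<close>,
  addressed by their membership pattern. Each one lies inside or outside \<open>C\<close>, so an
  exchange moves its points as a whole.\<close>

definition atom :: "'a set set \<Rightarrow> 'a set \<Rightarrow> 'a set set \<times> bool \<Rightarrow> 'a set" where
  "atom \<B> C i = {x. {B \<in> \<B>. x \<in> B} = fst i \<and> (x \<in> C \<longleftrightarrow> snd i)}"

text \<open>The index \<open>{}\<close> is left out: it belongs to the unbounded complement of the union.\<close>

definition atom_index :: "'a set set \<Rightarrow> ('a set set \<times> bool) set" where
  "atom_index \<B> = (Pow \<B> - {{}}) \<times> UNIV"

lemma finite_atom_index: "finite \<B> \<Longrightarrow> finite (atom_index \<B>)"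
  by (simp add: atom_index_def)

lemma disjoint_atoms: "disjoint_family_on (atom \<B> C) I"
proof (unfold disjoint_family_on_def, intro ballI impI)
  fix i j :: "'a set set \<times> bool" assume "i \<noteq> j"
  have "i = j" if "x \<in> atom \<B> C i" "x \<in> atom \<B> C j" for x
    using that unfolding atom_def by (intro prod_eqI) blast+
  then show "atom \<B> C i \<inter> atom \<B> C j = {}" using \<open>i \<noteq> j\<close> by blast
qed

lemma Union_atoms: "B \<in> \<B> \<Longrightarrow> (\<Union>i\<in>{i \<in> atom_index \<B>. B \<in> fst i}. atom \<B> C i) = B"
proof (intro equalityI subsetI)
  fix x assume B: "B \<in> \<B>" "x \<in> B"
  then have "({B \<in> \<B>. x \<in> B}, x \<in> C) \<in> {i \<in> atom_index \<B>. B \<in> fst i}"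
    by (auto simp: atom_index_def)
  moreover have "x \<in> atom \<B> C ({B \<in> \<B>. x \<in> B}, x \<in> C)" by (simp add: atom_def)
  ultimately show "x \<in> (\<Union>i\<in>{i \<in> atom_index \<B>. B \<in> fst i}. atom \<B> C i)" by blast
next
  fix x assume "x \<in> (\<Union>i\<in>{i \<in> atom_index \<B>. B \<in> fst i}. atom \<B> C i)"
  then obtain i where i: "B \<in> fst i" "x \<in> atom \<B> C i" by blast
  then have "{B \<in> \<B>. x \<in> B} = fst i" by (simp add: atom_def)
  with i(1) show "x \<in> B" by blast
qed

lemma atom_subset:
  assumes "i \<in> atom_index \<B>"
  shows "\<exists>B\<in>\<B>. atom \<B> C i \<subseteq> B"
proof -
  have "fst i \<in> Pow \<B> - {{}}" using assms by (simp add: atom_index_def mem_Times_iff)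
  then obtain B where "B \<in> fst i" "B \<in> \<B>" by blast
  moreover have "x \<in> B" if "x \<in> atom \<B> C i" for x
    using that \<open>B \<in> fst i\<close> unfolding atom_def by blast
  ultimately show ?thesis by blast
qed

lemma atom_borel:
  assumes "finite \<B>" "\<B> \<subseteq> sets M" "C \<in> sets M" "space M = UNIV"
  shows "atom \<B> C i \<in> sets M"
proof -
  have eq: "atom \<B> C i = (if fst i \<subseteq> \<B> then {x \<in> space M. (\<forall>B\<in>\<B>. x \<in> B \<longleftrightarrow> B \<in> fst i) \<and> (x \<in> C \<longleftrightarrow> snd i)} else {})"
  proof (cases "fst i \<subseteq> \<B>")
    case True
    then have "{B \<in> \<B>. x \<in> B} = fst i \<longleftrightarrow> (\<forall>B\<in>\<B>. x \<in> B \<longleftrightarrow> B \<in> fst i)" for x by blast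
    with True assms(4) show ?thesis by (simp add: atom_def)
  next
    case False
    then have "{B \<in> \<B>. x \<in> B} \<noteq> fst i" for x by blast
    with False show ?thesis by (simp add: atom_def)
  qed
  have "{x \<in> space M. (\<forall>B\<in>\<B>. x \<in> B \<longleftrightarrow> B \<in> fst i) \<and> (x \<in> C \<longleftrightarrow> snd i)} \<in> sets M"
  proof (intro sets.sets_Collect_conj sets.sets_Collect_finite_All assms(1))
    fix B assume "B \<in> \<B>"
    then have [measurable]: "B \<in> sets M" using assms by auto
    show "{x \<in> space M. (x \<in> B) = (B \<in> fst i)} \<in> sets M" by measurable
  next
    have [measurable]: "C \<in> sets M" using assms by auto
    show "{x \<in> space M. (x \<in> C) = snd i} \<in> sets M" by measurable
  qed
  then show ?thesis unfolding eq by simp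
qed

text \<open>Here all counts on both sides are fixed on disjoint sets, so the product law of the
  event is an explicit product of Poisson weights.\<close>

definition atom_cylinder where
  "atom_cylinder \<B> C \<kappa> = {p \<in> configurations \<times> configurations.
     \<forall>s. \<forall>i\<in>atom_index \<B>. emeasure (side s p) (atom \<B> C i) = of_nat (\<kappa> (s, i))}"

text \<open>A count on \<open>B\<close> is the sum of the counts on its atoms, and the union runs
  over all ways to distribute the prescribed counts. It can be infinite, because a set may be
  constrained on one side only, but it is countable.\<close>

lemma cylinder_eq_Union_atom_cylinders:
  fixes C :: "'a::metric_space set"
  assumes T: "finite T" "\<forall>(s, B, k)\<in>T. B \<in> sets borel \<and> (\<exists>n. B \<subseteq> window n)" and C: "C \<in> sets borel"
  defines "\<B> \<equiv> (\<lambda>(s, B, k). B) ` T"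
  shows "cylinder T = (\<Union>\<kappa>\<in>{\<kappa> \<in> (UNIV \<times> atom_index \<B>) \<rightarrow>\<^sub>E UNIV.
      \<forall>(s, B, k)\<in>T. (\<Sum>i\<in>{i \<in> atom_index \<B>. B \<in> fst i}. \<kappa> (s, i)) = k}. atom_cylinder \<B> C \<kappa>)"
    (is "_ = (\<Union>\<kappa>\<in>?K. _)")
proof -
  have \<B>: "finite \<B>" "\<B> \<subseteq> sets borel" "\<And>B. B \<in> \<B> \<Longrightarrow> \<exists>n. B \<subseteq> window n"
    using T unfolding \<B>_def by auto
  have meas: "atom \<B> C i \<in> sets borel" for i by (intro atom_borel \<B> C) simp
  have total: "emeasure \<xi> B = (\<Sum>i\<in>{i \<in> atom_index \<B>. B \<in> fst i}. emeasure \<xi> (atom \<B> C i))"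
    if "\<xi> \<in> configurations" "B \<in> \<B>" for \<xi> B
    using that meas finite_atom_index[OF \<B>(1)]
    by (subst sum_emeasure) (auto simp: disjoint_atoms sets_configuration Union_atoms)
  show ?thesis
  proof (intro equalityI subsetI)
    fix p assume p: "p \<in> cylinder T"
    then have conf: "side s p \<in> configurations" for s by (auto simp: cylinder_def side_def)
    define k where "k s i = (SOME k. emeasure (side s p) (atom \<B> C i) = of_nat k)" for s i
    have k: "emeasure (side s p) (atom \<B> C i) = of_nat (k s i)" if "i \<in> atom_index \<B>" for s i
    proof -
      have "\<exists>k. emeasure (side s p) (atom \<B> C i) = of_nat k"
        using atom_subset[OF that, of C] \<B>(3) emeasure_bounded_nat[OF conf meas] by (meson order_trans)
      then show ?thesis unfolding k_def by (rule someI_ex)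
    qed
    \<comment> \<open>The restriction makes the family of counts extensional, so that different
      indices belong to disjoint events.\<close>
    define \<kappa> where "\<kappa> = restrict (\<lambda>(s, i). k s i) (UNIV \<times> atom_index \<B>)"
    have \<kappa>: "i \<in> atom_index \<B> \<Longrightarrow> \<kappa> (s, i) = k s i" for s i by (simp add: \<kappa>_def)
    have "(\<Sum>i\<in>{i \<in> atom_index \<B>. B \<in> fst i}. \<kappa> (s, i)) = m" if t: "(s, B, m) \<in> T" for s B m
    proof -
      have "B \<in> \<B>" using t unfolding \<B>_def by force
      have "of_nat m = emeasure (side s p) B" using p t by (auto simp: cylinder_def)
      also have "\<dots> = (\<Sum>i\<in>{i \<in> atom_index \<B>. B \<in> fst i}. of_nat (k s i))"
        unfolding total[OF conf \<open>B \<in> \<B>\<close>] by (intro sum.cong) (auto simp: k)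
      also have "\<dots> = of_nat (\<Sum>i\<in>{i \<in> atom_index \<B>. B \<in> fst i}. k s i)" by simp
      finally have "m = (\<Sum>i\<in>{i \<in> atom_index \<B>. B \<in> fst i}. k s i)" by (simp only: of_nat_eq_iff)
      then show ?thesis by (simp add: \<kappa>)
    qed
    then have "\<kappa> \<in> ?K" by (auto simp: \<kappa>_def)
    moreover have "p \<in> atom_cylinder \<B> C \<kappa>"
      using p k by (auto simp: atom_cylinder_def cylinder_def \<kappa>)
    ultimately show "p \<in> (\<Union>\<kappa>\<in>?K. atom_cylinder \<B> C \<kappa>)" by blast
  next
    fix p assume "p \<in> (\<Union>\<kappa>\<in>?K. atom_cylinder \<B> C \<kappa>)"
    then obtain \<kappa> where \<kappa>: "\<kappa> \<in> ?K" "p \<in> atom_cylinder \<B> C \<kappa>" by blast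
    then have conf: "side s p \<in> configurations" for s by (auto simp: atom_cylinder_def side_def)
    have "emeasure (side s p) B = of_nat m" if t: "(s, B, m) \<in> T" for s B m
    proof -
      have "B \<in> \<B>" using t unfolding \<B>_def by force
      have "emeasure (side s p) B = (\<Sum>i\<in>{i \<in> atom_index \<B>. B \<in> fst i}. of_nat (\<kappa> (s, i)))"
        unfolding total[OF conf \<open>B \<in> \<B>\<close>] using \<kappa>(2) by (intro sum.cong) (auto simp: atom_cylinder_def)
      also have "\<dots> = of_nat (\<Sum>i\<in>{i \<in> atom_index \<B>. B \<in> fst i}. \<kappa> (s, i))" by simp
      also have "\<dots> = of_nat m" using \<kappa>(1) t by auto
      finally show ?thesis .
    qed
    then show "p \<in> cylinder T" using \<kappa>(2) by (auto simp: cylinder_def atom_cylinder_def)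
  qed
qed

lemma disjoint_atom_cylinders:
  "disjoint_family_on (atom_cylinder \<B> C) ((UNIV \<times> atom_index \<B>) \<rightarrow>\<^sub>E UNIV)"
proof (unfold disjoint_family_on_def, intro ballI impI)
  fix \<kappa> \<kappa>' :: "bool \<times> 'a set set \<times> bool \<Rightarrow> nat"
  assume k: "\<kappa> \<in> (UNIV \<times> atom_index \<B>) \<rightarrow>\<^sub>E UNIV" "\<kappa>' \<in> (UNIV \<times> atom_index \<B>) \<rightarrow>\<^sub>E UNIV" "\<kappa> \<noteq> \<kappa>'"
  then obtain s i where si: "i \<in> atom_index \<B>" "\<kappa> (s, i) \<noteq> \<kappa>' (s, i)"
    using PiE_ext[OF k(1,2)] by auto
  show "atom_cylinder \<B> C \<kappa> \<inter> atom_cylinder \<B> C \<kappa>' = {}"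
  proof (rule ccontr)
    assume "atom_cylinder \<B> C \<kappa> \<inter> atom_cylinder \<B> C \<kappa>' \<noteq> {}"
    then obtain p where "p \<in> atom_cylinder \<B> C \<kappa>" "p \<in> atom_cylinder \<B> C \<kappa>'" by blast
    then have "(of_nat (\<kappa> (s, i)) :: ennreal) = of_nat (\<kappa>' (s, i))"
      using si(1) unfolding atom_cylinder_def by (metis (mono_tags, lifting) mem_Collect_eq)
    then show False using si(2) by (simp only: of_nat_eq_iff)
  qed
qed

section \<open>Invariance of the product law under exchanges\<close>

definition poisson_weight :: "real \<Rightarrow> nat \<Rightarrow> real" where
  "poisson_weight m k = m ^ k / fact k * exp (- m)"

text \<open>The assumption \<open>fdd\<close> merges independence and the Poisson marginals into one
  product formula. It speaks of bounded sets, where the intensity is finite and every count is a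
  natural number.\<close>

locale poisson_law = prob_space P for P :: "'a::{metric_space, second_countable_topology} measure measure" +
  fixes \<nu> :: "'a measure"
  assumes sets_P [measurable_cong]: "sets P = sets counting_space"
    and sets_intensity: "sets \<nu> = sets borel"
    and intensity_window: "emeasure \<nu> (window n) < \<infinity>"
    and no_atoms: "emeasure \<nu> {x} = 0"
    and fdd: "\<And>(l::nat) A k. (\<And>i. i < l \<Longrightarrow> A i \<in> sets borel \<and> (\<exists>n. A i \<subseteq> window n)) \<Longrightarrow>
      disjoint_family_on A {..<l} \<Longrightarrow>
      measure P {\<xi> \<in> configurations. \<forall>i<l. emeasure \<xi> (A i) = of_nat (k i)} =
        (\<Prod>i<l. poisson_weight (measure \<nu> (A i)) (k i))"
begin

lemma space_P [simp]: "space P = configurations"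
  using sets_eq_imp_space_eq[OF sets_P] by simp

lemma fdd_finite:
  assumes I: "finite I" and A: "\<And>i. i \<in> I \<Longrightarrow> A i \<in> sets borel \<and> (\<exists>n. A i \<subseteq> window n)"
    and disj: "disjoint_family_on A I"
  shows "measure P {\<xi> \<in> configurations. \<forall>i\<in>I. emeasure \<xi> (A i) = of_nat (k i)} =
    (\<Prod>i\<in>I. poisson_weight (measure \<nu> (A i)) (k i))"
proof -
  obtain h where h: "bij_betw h {..<card I} I"
    using ex_bij_betw_nat_finite[OF I] by (auto simp: atLeast0LessThan)
  have im: "h i \<in> I" if "i < card I" for i using h that by (auto simp: bij_betw_def)
  have "disjoint_family_on (\<lambda>i. A (h i)) {..<card I}"
    using disj h im unfolding disjoint_family_on_def bij_betw_def inj_on_def by blast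
  from fdd[OF _ this, of "\<lambda>i. k (h i)"]
  have "measure P {\<xi> \<in> configurations. \<forall>i<card I. emeasure \<xi> (A (h i)) = of_nat (k (h i))} =
      (\<Prod>i<card I. poisson_weight (measure \<nu> (A (h i))) (k (h i)))"
    using A im by blast
  also have "\<dots> = (\<Prod>i\<in>I. poisson_weight (measure \<nu> (A i)) (k i))"
    by (rule prod.reindex_bij_betw[OF h])
  also have "{\<xi> \<in> configurations. \<forall>i<card I. emeasure \<xi> (A (h i)) = of_nat (k (h i))} =
      {\<xi> \<in> configurations. \<forall>i\<in>I. emeasure \<xi> (A i) = of_nat (k i)}"
  proof -
    have "h ` {..<card I} = I" using h by (simp add: bij_betw_def)
    then have "(\<forall>i\<in>I. R i) \<longleftrightarrow> (\<forall>i<card I. R (h i))" for R by (metis imageE lessThan_iff im)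
    then show ?thesis by simp
  qed
  finally show ?thesis .
qed

lemma prob_configurations [simp]: "prob configurations = 1"
  using prob_space by simp

sublocale pair: pair_prob_space P P ..

lemma sets_pair_P: "sets (P \<Otimes>\<^sub>M P) = sets (counting_space \<Otimes>\<^sub>M counting_space)"
  by (intro sets_pair_measure_cong sets_P)

text \<open>The factors are grouped by index and not by side, so that interchanging the two counts
  at any single index visibly leaves the value unchanged.\<close>

lemma pair_rectangle:
  fixes \<kappa> :: "bool \<times> 'i \<Rightarrow> nat"
  assumes I: "finite I" and A: "\<And>i. i \<in> I \<Longrightarrow> A i \<in> sets borel \<and> (\<exists>n. A i \<subseteq> window n)"
    and disj: "disjoint_family_on A I"
  shows "emeasure (P \<Otimes>\<^sub>M P) {p \<in> configurations \<times> configurations.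
      \<forall>s. \<forall>i\<in>I. emeasure (side s p) (A i) = of_nat (\<kappa> (s, i))} =
    ennreal (\<Prod>i\<in>I. poisson_weight (measure \<nu> (A i)) (\<kappa> (True, i)) *
      poisson_weight (measure \<nu> (A i)) (\<kappa> (False, i)))"
proof -
  define S where "S s = {\<xi> \<in> configurations. \<forall>i\<in>I. emeasure \<xi> (A i) = of_nat (\<kappa> (s, i))}" for s
  have S: "S s \<in> sets P" for s
  proof -
    have "{\<xi> \<in> space P. \<forall>i\<in>I. emeasure \<xi> (A i) = of_nat (\<kappa> (s, i))} \<in> sets P"
    proof (intro sets.sets_Collect_finite_All I)
      fix i assume "i \<in> I"
      then have [measurable]: "A i \<in> sets borel" using A by blast
      show "{\<xi> \<in> space P. emeasure \<xi> (A i) = of_nat (\<kappa> (s, i))} \<in> sets P" by measurable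
    qed
    then show ?thesis by (simp add: S_def)
  qed
  have eq: "{p \<in> configurations \<times> configurations.
      \<forall>s. \<forall>i\<in>I. emeasure (side s p) (A i) = of_nat (\<kappa> (s, i))} = S True \<times> S False"
    by (auto simp: S_def side_def all_bool_eq)
  have "emeasure (P \<Otimes>\<^sub>M P) (S True \<times> S False) = emeasure P (S True) * emeasure P (S False)"
    using S by (intro emeasure_pair_measure_Times)
  also have "\<dots> = ennreal (measure P (S True) * measure P (S False))"
    by (simp add: emeasure_eq_measure ennreal_mult)
  also have "measure P (S True) * measure P (S False) =
      (\<Prod>i\<in>I. poisson_weight (measure \<nu> (A i)) (\<kappa> (True, i)) *
        poisson_weight (measure \<nu> (A i)) (\<kappa> (False, i)))"
    unfolding S_def by (simp add: fdd_finite[OF assms] prod.distrib)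
  finally show ?thesis unfolding eq .
qed

text \<open>The exchange permutes the atom cylinders: at atoms outside \<open>C\<close> the two
  counts trade places, and both copies give them the same Poisson weights. Every cylinder is a
  countable disjoint union of atom cylinders, and the cylinders form a generating
  \<pi>-system.\<close>

lemma distr_swap_parts:
  assumes C: "C \<in> sets borel"
  shows "distr (P \<Otimes>\<^sub>M P) (P \<Otimes>\<^sub>M P) (swap_parts C) = P \<Otimes>\<^sub>M P"
proof -
  have sw [measurable]: "swap_parts C \<in> P \<Otimes>\<^sub>M P \<rightarrow>\<^sub>M P \<Otimes>\<^sub>M P"
    using measurable_swap_parts[OF C] by (simp cong: measurable_cong_sets add: sets_pair_P)
  define Q where "Q = distr (P \<Otimes>\<^sub>M P) (P \<Otimes>\<^sub>M P) (swap_parts C)"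
  have sp: "space (P \<Otimes>\<^sub>M P) = configurations \<times> configurations" by (simp add: space_pair_measure)
  have atoms: "emeasure Q (atom_cylinder \<B> C \<kappa>) = emeasure (P \<Otimes>\<^sub>M P) (atom_cylinder \<B> C \<kappa>)"
    and atoms_sets: "atom_cylinder \<B> C \<kappa> \<in> sets (P \<Otimes>\<^sub>M P)"
    if \<B>: "finite \<B>" "\<B> \<subseteq> sets borel" "\<And>B. B \<in> \<B> \<Longrightarrow> \<exists>n. B \<subseteq> window n" for \<B> \<kappa>
  proof -
    have meas: "atom \<B> C i \<in> sets borel" for i by (intro atom_borel \<B> C) simp
    then have at: "atom \<B> C i \<in> sets borel \<and> (\<exists>n. atom \<B> C i \<subseteq> window n)" if "i \<in> atom_index \<B>" for i
      using atom_subset[OF that, of C] \<B>(3) by (meson order_trans)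
    show sets: "atom_cylinder \<B> C \<kappa> \<in> sets (P \<Otimes>\<^sub>M P)"
    proof -
      have "atom_cylinder \<B> C \<kappa> = cylinder ((\<lambda>(s, i). (s, atom \<B> C i, \<kappa> (s, i))) ` (UNIV \<times> atom_index \<B>))"
        by (auto simp: atom_cylinder_def cylinder_def)
      then show ?thesis unfolding sets_pair_P using finite_atom_index[OF \<B>(1)] meas
        by (auto intro!: cylinder_sets)
    qed
    \<comment> \<open>\<open>snd i\<close> tells whether the atom lies in \<open>C\<close>, where
      both sides keep their counts.\<close>
    define \<kappa>' where "\<kappa>' = (\<lambda>(s, i). \<kappa> (if snd i then s else \<not> s, i))"
    have flip: "emeasure (side s (swap_parts C p)) (atom \<B> C i) =
        emeasure (side (if snd i then s else \<not> s) p) (atom \<B> C i)"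
      if p: "p \<in> configurations \<times> configurations" for s p i
    proof -
      have "atom \<B> C i \<inter> C = (if snd i then atom \<B> C i else {})"
        "atom \<B> C i - C = (if snd i then {} else atom \<B> C i)"
        by (cases "snd i"; auto simp: atom_def)+
      then show ?thesis using p
        by (cases "snd i"; cases s) (simp_all add: side_def swap_parts_def emeasure_glue[OF _ _ C meas] mem_Times_iff Diff_eq_empty_iff[THEN iffD2])
    qed
    have "emeasure Q (atom_cylinder \<B> C \<kappa>) =
        emeasure (P \<Otimes>\<^sub>M P) (swap_parts C -` atom_cylinder \<B> C \<kappa> \<inter> space (P \<Otimes>\<^sub>M P))"
      unfolding Q_def by (rule emeasure_distr[OF sw sets])
    also have "swap_parts C -` atom_cylinder \<B> C \<kappa> \<inter> space (P \<Otimes>\<^sub>M P) = atom_cylinder \<B> C \<kappa>'"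
    proof (intro equalityI subsetI)
      fix p assume "p \<in> swap_parts C -` atom_cylinder \<B> C \<kappa> \<inter> space (P \<Otimes>\<^sub>M P)"
      then have p: "p \<in> configurations \<times> configurations" "swap_parts C p \<in> atom_cylinder \<B> C \<kappa>"
        by (auto simp: sp)
      have "emeasure (side s p) (atom \<B> C i) = of_nat (\<kappa>' (s, i))" if "i \<in> atom_index \<B>" for s i
        using p(2) flip[OF p(1), of "if snd i then s else \<not> s" i] that
        unfolding atom_cylinder_def \<kappa>'_def by (auto split: if_splits)
      then show "p \<in> atom_cylinder \<B> C \<kappa>'" using p(1) by (simp add: atom_cylinder_def)
    next
      fix p assume p: "p \<in> atom_cylinder \<B> C \<kappa>'"
      then have conf: "p \<in> configurations \<times> configurations" by (simp add: atom_cylinder_def)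
      have "emeasure (side s (swap_parts C p)) (atom \<B> C i) = of_nat (\<kappa> (s, i))"
        if "i \<in> atom_index \<B>" for s i
        using p flip[OF conf, of s i] that unfolding atom_cylinder_def \<kappa>'_def by (auto split: if_splits)
      moreover have "swap_parts C p \<in> configurations \<times> configurations"
        using conf C by (auto simp: swap_parts_def glue_configuration)
      ultimately show "p \<in> swap_parts C -` atom_cylinder \<B> C \<kappa> \<inter> space (P \<Otimes>\<^sub>M P)"
        using conf by (simp add: atom_cylinder_def sp)
    qed
    also have "emeasure (P \<Otimes>\<^sub>M P) (atom_cylinder \<B> C \<kappa>') = emeasure (P \<Otimes>\<^sub>M P) (atom_cylinder \<B> C \<kappa>)"
      unfolding atom_cylinder_def
      by (subst (1 2) pair_rectangle[OF finite_atom_index[OF \<B>(1)] at disjoint_atoms])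
        (auto intro!: arg_cong[of _ _ ennreal] prod.cong simp: \<kappa>'_def)
    finally show "emeasure Q (atom_cylinder \<B> C \<kappa>) = emeasure (P \<Otimes>\<^sub>M P) (atom_cylinder \<B> C \<kappa>)" .
  qed
  have "Q = P \<Otimes>\<^sub>M P"
  proof (rule measure_eqI_generator_eq[where E = cylinders and \<Omega> = "configurations \<times> configurations"
        and A = "\<lambda>_. configurations \<times> configurations"])
    show "Int_stable (cylinders :: ('a measure \<times> 'a measure) set set)" by (rule Int_stable_cylinders)
    show "cylinders \<subseteq> Pow (configurations \<times> configurations)" by (auto simp: cylinders_def cylinder_def)
    show "sets Q = sigma_sets (configurations \<times> configurations) cylinders"
      "sets (P \<Otimes>\<^sub>M P) = sigma_sets (configurations \<times> configurations) cylinders"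
      by (simp_all add: Q_def sets_pair_P sets_pair_counting_space)
    have "cylinder {} \<in> (cylinders :: ('a measure \<times> 'a measure) set set)"
      unfolding cylinders_def by (intro imageI) auto
    then show "range (\<lambda>_. configurations \<times> configurations) \<subseteq> (cylinders :: ('a measure \<times> 'a measure) set set)"
      by (auto simp: cylinder_def)
    interpret Q: prob_space Q unfolding Q_def by (rule pair.prob_space_distr[OF sw])
    show "emeasure Q (configurations \<times> configurations) \<noteq> \<infinity>" by simp
    fix X :: "('a measure \<times> 'a measure) set" assume "X \<in> cylinders"
    then obtain T where T: "finite T" "\<forall>(s, B, k)\<in>T. B \<in> sets borel \<and> (\<exists>n. B \<subseteq> window n)"
      and X: "X = cylinder T" by (auto simp: cylinders_def)
    \<comment> \<open>The atoms are adapted to the given cylinder: they come from the sets in its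
      own constraints.\<close>
    define \<B> where "\<B> = (\<lambda>(s, B, k). B) ` T"
    have \<B>: "finite \<B>" "\<B> \<subseteq> sets borel" "\<And>B. B \<in> \<B> \<Longrightarrow> \<exists>n. B \<subseteq> window n"
      using T unfolding \<B>_def by auto
    define K where "K = {\<kappa> \<in> (UNIV \<times> atom_index \<B>) \<rightarrow>\<^sub>E UNIV.
      \<forall>(s, B, k)\<in>T. (\<Sum>i\<in>{i \<in> atom_index \<B>. B \<in> fst i}. \<kappa> (s, i)) = k}"
    have XU: "X = (\<Union>\<kappa>\<in>K. atom_cylinder \<B> C \<kappa>)"
      unfolding X K_def \<B>_def by (rule cylinder_eq_Union_atom_cylinders[OF T C])
    have "countable (((UNIV :: bool set) \<times> atom_index \<B>) \<rightarrow>\<^sub>E (UNIV :: nat set))"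
      using finite_atom_index[OF \<B>(1)] by (intro countable_PiE) auto
    then have K: "countable K" by (rule countable_subset[rotated]) (auto simp: K_def)
    have disj: "disjoint_family_on (atom_cylinder \<B> C) K"
      by (rule disjoint_family_on_mono[OF _ disjoint_atom_cylinders]) (auto simp: K_def)
    have "emeasure R X = (\<integral>\<^sup>+\<kappa>. emeasure R (atom_cylinder \<B> C \<kappa>) \<partial>count_space K)"
      if "sets R = sets (P \<Otimes>\<^sub>M P)" for R
      unfolding XU using atoms_sets[OF \<B>] that K disj by (intro emeasure_UN_countable) auto
    note X_eq = this
    have "sets Q = sets (P \<Otimes>\<^sub>M P)" by (simp add: Q_def)
    from X_eq[OF this] X_eq[OF refl] show "emeasure Q X = emeasure (P \<Otimes>\<^sub>M P) X"
      by (simp only: atoms[OF \<B>])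
  qed auto
  then show ?thesis by (simp add: Q_def)
qed


lemma integral_swap_parts:
  fixes H :: "'a measure \<times> 'a measure \<Rightarrow> real"
  assumes "C \<in> sets borel" and H [measurable]: "H \<in> borel_measurable (P \<Otimes>\<^sub>M P)"
  shows "(\<integral>p. H (swap_parts C p) \<partial>(P \<Otimes>\<^sub>M P)) = (\<integral>p. H p \<partial>(P \<Otimes>\<^sub>M P))"
proof -
  have "swap_parts C \<in> P \<Otimes>\<^sub>M P \<rightarrow>\<^sub>M P \<Otimes>\<^sub>M P"
    using measurable_swap_parts[OF assms(1)] by (simp cong: measurable_cong_sets add: sets_pair_P)
  from integral_distr[OF this H] show ?thesis by (simp add: distr_swap_parts[OF assms(1)])
qed

lemma measurable_glue_P:
  assumes "C \<in> sets borel"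
  shows "(\<lambda>p. glue C (fst p) (snd p)) \<in> P \<Otimes>\<^sub>M P \<rightarrow>\<^sub>M P"
  using measurable_glue[OF assms] by (simp cong: measurable_cong_sets add: sets_pair_P sets_P)

end

section \<open>Identities for glued configurations\<close>

lemma glue_swap_parts:
  assumes "\<xi> \<in> configurations" "\<zeta> \<in> configurations" "A \<in> sets borel" "C \<in> sets borel" "C \<inter> A = {}"
  shows "glue (C \<union> A) (glue (- A) \<xi> \<zeta>) (glue (- A) \<zeta> \<xi>) = glue C \<xi> \<zeta>"
proof (rule configuration_eqI)
  fix B :: "'a set" assume B: "B \<in> sets borel"
  have conf: "glue (- A) \<xi> \<zeta> \<in> configurations" "glue (- A) \<zeta> \<xi> \<in> configurations"
    using assms by (auto intro!: glue_configuration)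
  have sets: "B \<inter> (C \<union> A) \<in> sets borel" "B - (C \<union> A) \<in> sets borel" using assms B by auto
  have s: "sets \<zeta> = sets borel" using assms(2) by (rule sets_configuration)
  have "B \<inter> (C \<union> A) \<inter> - A = B \<inter> C" "B \<inter> (C \<union> A) - - A = B \<inter> A"
    "(B - (C \<union> A)) \<inter> - A = B - (C \<union> A)" "(B - (C \<union> A)) - - A = {}"
    using assms(5) by auto
  then have "emeasure (glue (C \<union> A) (glue (- A) \<xi> \<zeta>) (glue (- A) \<zeta> \<xi>)) B =
      emeasure \<xi> (B \<inter> C) + (emeasure \<zeta> (B \<inter> A) + emeasure \<zeta> (B - (C \<union> A)))"
    using assms B conf sets by (simp add: emeasure_glue add.assoc)
  also have "emeasure \<zeta> (B \<inter> A) + emeasure \<zeta> (B - (C \<union> A)) = emeasure \<zeta> ((B \<inter> A) \<union> (B - (C \<union> A)))"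
    using assms B s by (intro plus_emeasure) auto
  also have "(B \<inter> A) \<union> (B - (C \<union> A)) = B - C" using assms(5) by auto
  finally show "emeasure (glue (C \<union> A) (glue (- A) \<xi> \<zeta>) (glue (- A) \<zeta> \<xi>)) B = emeasure (glue C \<xi> \<zeta>) B"
    using assms B by (simp add: emeasure_glue)
qed (use assms in \<open>auto intro!: glue_configuration\<close>)

text \<open>The region \<open>C\<close> does not see what is replaced inside \<open>A\<close>. Hence
  an average that keeps only the points in \<open>C\<close> is unchanged when the points in
  \<open>A\<close> are resampled.\<close>

lemma glue_glue_left:
  assumes "\<xi> \<in> configurations" "\<zeta> \<in> configurations" "\<theta> \<in> configurations"
    and "A \<in> sets borel" "C \<in> sets borel" "C \<inter> A = {}"
  shows "glue C (glue (- A) \<xi> \<zeta>) \<theta> = glue C \<xi> \<theta>"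
proof (rule configuration_eqI)
  fix B :: "'a set" assume B: "B \<in> sets borel"
  have "B \<inter> C \<inter> - A = B \<inter> C" "B \<inter> C - - A = {}" using assms(6) by auto
  then show "emeasure (glue C (glue (- A) \<xi> \<zeta>) \<theta>) B = emeasure (glue C \<xi> \<theta>) B"
    using assms B by (simp add: emeasure_glue glue_configuration)
qed (use assms in \<open>auto intro!: glue_configuration\<close>)

lemma restr_glue:
  assumes "\<xi> \<in> configurations" "\<zeta> \<in> configurations" "C \<in> sets borel"
  shows "restr C (glue C \<xi> \<zeta>) = restr C \<xi>"
proof (rule configuration_eqI)
  fix B :: "'a set" assume B: "B \<in> sets borel"
  have "B \<inter> C \<inter> C = B \<inter> C" "B \<inter> C - C = {}" by auto
  then show "emeasure (restr C (glue C \<xi> \<zeta>)) B = emeasure (restr C \<xi>) B"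
    using assms B by (simp add: emeasure_glue emeasure_restr glue_configuration Diff_eq_empty_iff[THEN iffD2])
qed (use assms in \<open>auto intro!: glue_configuration restr_configuration\<close>)

lemma glue_empty:
  assumes "\<xi> \<in> configurations" "\<zeta> \<in> configurations"
  shows "glue {} \<xi> \<zeta> = \<zeta>"
  by (rule configuration_eqI) (use assms in \<open>auto simp: emeasure_glue intro!: glue_configuration\<close>)

section \<open>Subadditivity of entropy\<close>

text \<open>The Bregman divergence of \<open>t * ln t\<close>, which is the integrand of relative
  entropy when the two masses may differ.\<close>

definition relent :: "real \<Rightarrow> real \<Rightarrow> real" where
  "relent b a = b * ln (b / a) - b + a"

text \<open>This is \<open>ln y \<le> y - 1\<close> at \<open>y = a * x / b\<close>; it expresses
  the convex duality between \<open>t * ln t\<close> and the exponential, with \<open>x\<close> as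
  the exponential of the dual variable.\<close>

lemma relent_young:
  assumes "a > 0" "b > 0" "x > 0"
  shows "b * ln x \<le> relent b a + a * x - a"
proof -
  have "b * ln (a * x / b) \<le> b * (a * x / b - 1)"
    using assms by (intro mult_left_mono ln_le_minus_one) auto
  then show ?thesis
    using assms by (simp add: relent_def ln_mult ln_div algebra_simps)
qed

lemma relent_nonneg: "a > 0 \<Longrightarrow> b > 0 \<Longrightarrow> relent b a \<ge> 0"
  using relent_young[of a b 1] by simp

lemma relent_self [simp]: "relent b b = 0"
  by (cases "b = 0") (simp_all add: relent_def)

text \<open>The two positive bounds keep all logarithms bounded and settle every question of
  integrability. The intended \<open>G\<close> is the exponential of a truncated functional.\<close>

locale bounded_functional = poisson_law P \<nu> for P :: "'a::{metric_space, second_countable_topology} measure measure" and \<nu> +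
  fixes G :: "'a measure \<Rightarrow> real" and a b :: real
  assumes G [measurable]: "G \<in> borel_measurable P"
    and a: "0 < a" and G_ge: "\<And>\<xi>. \<xi> \<in> configurations \<Longrightarrow> a \<le> G \<xi>"
    and G_le: "\<And>\<xi>. \<xi> \<in> configurations \<Longrightarrow> G \<xi> \<le> b"
begin

definition average :: "'a set \<Rightarrow> 'a measure \<Rightarrow> real" where
  "average C \<xi> = (\<integral>\<zeta>. G (glue C \<xi> \<zeta>) \<partial>P)"

lemma measurable_G_glue [measurable]:
  "C \<in> sets borel \<Longrightarrow> (\<lambda>p. G (glue C (fst p) (snd p))) \<in> borel_measurable (P \<Otimes>\<^sub>M P)"
  using measurable_compose[OF measurable_glue_P G] .

lemma measurable_G_glue_section:
  "C \<in> sets borel \<Longrightarrow> \<xi> \<in> configurations \<Longrightarrow> (\<lambda>\<zeta>. G (glue C \<xi> \<zeta>)) \<in> borel_measurable P"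
  using measurable_compose[OF measurable_Pair1'[of \<xi> P P] measurable_G_glue[of C]] by simp

lemma integrable_bounded:
  fixes f :: "'b \<Rightarrow> real"
  assumes "finite_measure M" "f \<in> borel_measurable M" "\<And>x. x \<in> space M \<Longrightarrow> \<bar>f x\<bar> \<le> B"
  shows "integrable M f"
  by (rule finite_measure.integrable_const_bound[OF assms(1), of _ B]) (use assms in auto)

lemma finite_P: "finite_measure P" "finite_measure (P \<Otimes>\<^sub>M P)"
  by unfold_locales

lemma space_pair: "p \<in> space (P \<Otimes>\<^sub>M P) \<longleftrightarrow> fst p \<in> configurations \<and> snd p \<in> configurations"
  by (simp add: space_pair_measure mem_Times_iff)

lemma G_abs: "\<xi> \<in> configurations \<Longrightarrow> \<bar>G \<xi>\<bar> \<le> b"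
  using G_ge[of \<xi>] G_le[of \<xi>] a by simp

lemma integrable_G_glue_section:
  assumes "C \<in> sets borel" "\<xi> \<in> configurations"
  shows "integrable P (\<lambda>\<zeta>. G (glue C \<xi> \<zeta>))"
  by (rule integrable_bounded[where B = b])
    (use assms finite_P measurable_G_glue_section G_abs in \<open>auto simp: glue_configuration\<close>)

lemma measurable_average [measurable]:
  assumes "C \<in> sets borel"
  shows "average C \<in> borel_measurable P"
proof -
  have "(\<lambda>(\<xi>, \<zeta>). G (glue C \<xi> \<zeta>)) \<in> borel_measurable (P \<Otimes>\<^sub>M P)"
    using measurable_G_glue[OF assms] by (simp add: case_prod_beta')
  then show ?thesis unfolding average_def[abs_def] by (rule borel_measurable_lebesgue_integral)
qed

lemma average_bounds:
  assumes "C \<in> sets borel" "\<xi> \<in> configurations"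
  shows "a \<le> average C \<xi>" "average C \<xi> \<le> b"
proof -
  have "\<And>\<zeta>. \<zeta> \<in> space P \<Longrightarrow> glue C \<xi> \<zeta> \<in> configurations"
    using assms by (simp add: glue_configuration)
  then show "a \<le> average C \<xi>" "average C \<xi> \<le> b"
    unfolding average_def
    by (auto intro!: integral_ge_const integral_le_const integrable_G_glue_section assms AE_I2 G_ge G_le)
qed

lemma average_abs: "C \<in> sets borel \<Longrightarrow> \<xi> \<in> configurations \<Longrightarrow> \<bar>average C \<xi>\<bar> \<le> b"
  using average_bounds[of C \<xi>] a by linarith

lemma integral_mult_average:
  assumes C: "C \<in> sets borel" and h [measurable]: "h \<in> borel_measurable P"
    and hB: "\<And>\<xi>. \<xi> \<in> configurations \<Longrightarrow> \<bar>h \<xi>\<bar> \<le> B"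
  shows "(\<integral>\<xi>. h \<xi> * average C \<xi> \<partial>P) = (\<integral>p. h (fst p) * G (glue C (fst p) (snd p)) \<partial>(P \<Otimes>\<^sub>M P))"
proof -
  have "integrable (P \<Otimes>\<^sub>M P) (\<lambda>p. h (fst p) * G (glue C (fst p) (snd p)))"
  proof (rule integrable_bounded[where B = "B * b"])
    show "(\<lambda>p. h (fst p) * G (glue C (fst p) (snd p))) \<in> borel_measurable (P \<Otimes>\<^sub>M P)"
      using C by measurable
    fix p assume "p \<in> space (P \<Otimes>\<^sub>M P)"
    then have p: "fst p \<in> configurations" "glue C (fst p) (snd p) \<in> configurations"
      using C by (auto simp: space_pair glue_configuration)
    show "\<bar>h (fst p) * G (glue C (fst p) (snd p))\<bar> \<le> B * b"
      unfolding abs_mult using hB[OF p(1)] G_abs[OF p(2)] by (intro mult_mono) auto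
  qed (rule finite_P)
  from pair.integral_fst'[OF this] show ?thesis by (simp add: average_def)
qed

text \<open>
  \<open>average\<close> is the conditional expectation of \<open>G\<close> given the points in \<open>C\<close>; resampling the points
  in \<open>A\<close> shows that \<open>h\<close>, not depending on these points, does not see the difference.
\<close>

lemma integral_average_Un:
  assumes A: "A \<in> sets borel" and C: "C \<in> sets borel" and CA: "C \<inter> A = {}"
    and h [measurable]: "h \<in> borel_measurable P"
    and hB: "\<And>\<xi>. \<xi> \<in> configurations \<Longrightarrow> \<bar>h \<xi>\<bar> \<le> B"
    and inv: "\<And>\<xi> \<zeta>. \<xi> \<in> configurations \<Longrightarrow> \<zeta> \<in> configurations \<Longrightarrow> h (glue (- A) \<xi> \<zeta>) = h \<xi>"
  shows "(\<integral>\<xi>. h \<xi> * average (C \<union> A) \<xi> \<partial>P) = (\<integral>\<xi>. h \<xi> * average C \<xi> \<partial>P)"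
proof -
  have nA: "- A \<in> sets borel" and CA': "C \<union> A \<in> sets borel" using A C by auto
  define H where "H p = h (fst p) * G (glue (C \<union> A) (fst p) (snd p))" for p
  have Hm: "H \<in> borel_measurable (P \<Otimes>\<^sub>M P)" unfolding H_def[abs_def] using CA' by measurable
  have "(\<integral>\<xi>. h \<xi> * average (C \<union> A) \<xi> \<partial>P) = (\<integral>p. H p \<partial>(P \<Otimes>\<^sub>M P))"
    using integral_mult_average[OF CA' h hB] by (simp add: H_def)
  also have "\<dots> = (\<integral>p. H (swap_parts (- A) p) \<partial>(P \<Otimes>\<^sub>M P))"
    using integral_swap_parts[OF nA Hm] by simp
  also have "\<dots> = (\<integral>p. h (fst p) * G (glue C (fst p) (snd p)) \<partial>(P \<Otimes>\<^sub>M P))"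
  proof (intro Bochner_Integration.integral_cong refl)
    fix p assume "p \<in> space (P \<Otimes>\<^sub>M P)"
    then show "H (swap_parts (- A) p) = h (fst p) * G (glue C (fst p) (snd p))"
      using A C CA by (simp add: space_pair H_def swap_parts_def inv glue_swap_parts)
  qed
  also have "\<dots> = (\<integral>\<xi>. h \<xi> * average C \<xi> \<partial>P)"
    using integral_mult_average[OF C h hB] by simp
  finally show ?thesis .
qed

lemma measurable_G_restr [measurable]: "C \<in> sets borel \<Longrightarrow> (\<lambda>\<xi>. G (restr C \<xi>)) \<in> borel_measurable P"
  using measurable_restr[of C] by (intro measurable_compose[OF _ G]) (simp cong: measurable_cong_sets add: sets_P)

lemma b_pos: "0 < b"
proof -
  obtain \<xi> :: "'a measure" where "\<xi> \<in> configurations" using not_empty by auto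
  from G_ge[OF this] G_le[OF this] a show ?thesis by linarith
qed

lemma ln_abs_le:
  assumes "a \<le> x" "x \<le> b" shows "\<bar>ln x\<bar> \<le> \<bar>ln a\<bar> + \<bar>ln b\<bar>"
proof -
  have "ln a \<le> ln x" "ln x \<le> ln b" using assms a b_pos by auto
  then show ?thesis by linarith
qed

definition relent_bound :: real where
  "relent_bound = b * (2 * (\<bar>ln a\<bar> + \<bar>ln b\<bar>)) + b + b"

lemma relent_le_bound:
  assumes "\<xi> \<in> configurations" "C \<in> sets borel"
  shows "relent (G \<xi>) (G (restr C \<xi>)) \<le> relent_bound"
proof -
  have conf: "restr C \<xi> \<in> configurations" using assms by (rule restr_configuration)
  note * = G_ge[OF assms(1)] G_le[OF assms(1)] G_ge[OF conf] G_le[OF conf]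
  have "\<bar>ln (G \<xi> / G (restr C \<xi>))\<bar> \<le> 2 * (\<bar>ln a\<bar> + \<bar>ln b\<bar>)"
    using ln_abs_le[OF *(1,2)] ln_abs_le[OF *(3,4)] * a by (simp add: ln_div)
  then have "\<bar>G \<xi> * ln (G \<xi> / G (restr C \<xi>))\<bar> \<le> b * (2 * (\<bar>ln a\<bar> + \<bar>ln b\<bar>))"
    unfolding abs_mult using * a by (intro mult_mono) auto
  then show ?thesis
    unfolding relent_def relent_bound_def using G_abs[OF assms(1)] G_abs[OF conf] by linarith
qed

lemma relent_G_nonneg:
  "\<xi> \<in> configurations \<Longrightarrow> C \<in> sets borel \<Longrightarrow> 0 \<le> relent (G \<xi>) (G (restr C \<xi>))"
  using G_ge[of \<xi>] G_ge[OF restr_configuration, of \<xi> C] a by (intro relent_nonneg) auto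

lemma integrable_relent:
  assumes "C \<in> sets borel"
  shows "integrable P (\<lambda>\<xi>. relent (G \<xi>) (G (restr C \<xi>)))"
proof (rule integrable_bounded[where B = relent_bound])
  show "(\<lambda>\<xi>. relent (G \<xi>) (G (restr C \<xi>))) \<in> borel_measurable P"
    unfolding relent_def using assms by measurable
  show "\<bar>relent (G \<xi>) (G (restr C \<xi>))\<bar> \<le> relent_bound" if "\<xi> \<in> space P" for \<xi>
    using that assms relent_le_bound[of \<xi> C] relent_G_nonneg[of \<xi> C] by simp
qed (rule finite_P)

lemma integrable_G_ln_average:
  assumes "C \<in> sets borel"
  shows "integrable P (\<lambda>\<xi>. G \<xi> * ln (average C \<xi>))"
proof (rule integrable_bounded[where B = "b * (\<bar>ln a\<bar> + \<bar>ln b\<bar>)"])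
  show "(\<lambda>\<xi>. G \<xi> * ln (average C \<xi>)) \<in> borel_measurable P" using assms by measurable
  fix \<xi> assume "\<xi> \<in> space P"
  then show "\<bar>G \<xi> * ln (average C \<xi>)\<bar> \<le> b * (\<bar>ln a\<bar> + \<bar>ln b\<bar>)"
    unfolding abs_mult using G_abs average_bounds[OF assms] b_pos
    by (intro mult_mono ln_abs_le) auto
qed (rule finite_P)

text \<open>\<open>relent_young\<close> is applied pointwise to the ratio of the two averages. The
  linear remainder is \<open>h\<close> times the difference of the averages, and it has mean zero
  because \<open>h\<close> ignores the points in \<open>A\<close>. Subadditivity and the bound for a
  single cell thus come out of one inequality.\<close>

lemma entropy_increment:
  assumes A: "A \<in> sets borel" and C: "C \<in> sets borel" and CA: "C \<inter> A = {}"
  shows "(\<integral>\<xi>. G \<xi> * ln (average (C \<union> A) \<xi>) \<partial>P) - (\<integral>\<xi>. G \<xi> * ln (average C \<xi>) \<partial>P) \<le>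
    (\<integral>\<xi>. relent (G \<xi>) (G (restr (- A) \<xi>)) \<partial>P)"
proof -
  have nA: "- A \<in> sets borel" and CA': "C \<union> A \<in> sets borel" using A C by auto
  \<comment> \<open>The slope of Young's inequality divided by \<open>average C\<close>; since
    \<open>C\<close> and \<open>A\<close> are disjoint, neither factor depends on the points in
    \<open>A\<close>.\<close>
  define h where "h \<xi> = G (restr (- A) \<xi>) / average C \<xi>" for \<xi>
  have hm [measurable]: "h \<in> borel_measurable P"
    unfolding h_def[abs_def] using nA C by measurable
  have hB: "\<bar>h \<xi>\<bar> \<le> b / a" if "\<xi> \<in> configurations" for \<xi>
    unfolding h_def abs_divide using that G_abs[OF restr_configuration[OF that nA]] average_bounds(1)[OF C that] a
    by (intro frac_le) auto
  have inv: "h (glue (- A) \<xi> \<zeta>) = h \<xi>" if "\<xi> \<in> configurations" "\<zeta> \<in> configurations" for \<xi> \<zeta>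
  proof -
    have "average C (glue (- A) \<xi> \<zeta>) = average C \<xi>"
      unfolding average_def
      by (intro Bochner_Integration.integral_cong refl) (use that A C CA in \<open>simp add: glue_glue_left\<close>)
    then show ?thesis using that nA by (simp add: h_def restr_glue)
  qed
  have int_h: "integrable P (\<lambda>\<xi>. h \<xi> * average D \<xi>)" if "D \<in> sets borel" for D
  proof (rule integrable_bounded[where B = "b / a * b"])
    show "(\<lambda>\<xi>. h \<xi> * average D \<xi>) \<in> borel_measurable P" using that by measurable
    fix \<xi> assume "\<xi> \<in> space P"
    then show "\<bar>h \<xi> * average D \<xi>\<bar> \<le> b / a * b"
      unfolding abs_mult using hB average_abs[OF that] a b_pos by (intro mult_mono) auto
  qed (rule finite_P)
  have "(\<integral>\<xi>. G \<xi> * ln (average (C \<union> A) \<xi>) \<partial>P) - (\<integral>\<xi>. G \<xi> * ln (average C \<xi>) \<partial>P) =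
      (\<integral>\<xi>. G \<xi> * ln (average (C \<union> A) \<xi>) - G \<xi> * ln (average C \<xi>) \<partial>P)"
    using C CA' by (intro Bochner_Integration.integral_diff[symmetric] integrable_G_ln_average)
  also have "\<dots> \<le> (\<integral>\<xi>. relent (G \<xi>) (G (restr (- A) \<xi>)) + (h \<xi> * average (C \<union> A) \<xi> - h \<xi> * average C \<xi>) \<partial>P)"
  proof (rule integral_mono)
    fix \<xi> assume "\<xi> \<in> space P"
    then have conf: "\<xi> \<in> configurations" "restr (- A) \<xi> \<in> configurations"
      using nA by (auto intro: restr_configuration)
    have pos: "average C \<xi> > 0" "average (C \<union> A) \<xi> > 0" "G \<xi> > 0" "G (restr (- A) \<xi>) > 0"
      using average_bounds(1)[OF C conf(1)] average_bounds(1)[OF CA' conf(1)] G_ge[OF conf(1)] G_ge[OF conf(2)] a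
      by auto
    then have "average (C \<union> A) \<xi> / average C \<xi> > 0" by simp
    from relent_young[OF pos(4,3) this]
    show "G \<xi> * ln (average (C \<union> A) \<xi>) - G \<xi> * ln (average C \<xi>) \<le>
        relent (G \<xi>) (G (restr (- A) \<xi>)) + (h \<xi> * average (C \<union> A) \<xi> - h \<xi> * average C \<xi>)"
      using pos by (simp add: ln_div h_def algebra_simps)
  next
    show "integrable P (\<lambda>\<xi>. G \<xi> * ln (average (C \<union> A) \<xi>) - G \<xi> * ln (average C \<xi>))"
      using C CA' by (intro Bochner_Integration.integrable_diff integrable_G_ln_average)
    show "integrable P (\<lambda>\<xi>. relent (G \<xi>) (G (restr (- A) \<xi>)) + (h \<xi> * average (C \<union> A) \<xi> - h \<xi> * average C \<xi>))"
      using nA C CA' by (intro Bochner_Integration.integrable_diff Bochner_Integration.integrable_add integrable_relent int_h)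
  qed
  also have "\<dots> = (\<integral>\<xi>. relent (G \<xi>) (G (restr (- A) \<xi>)) \<partial>P)"
    using nA C CA' integral_average_Un[OF A C CA hm hB inv]
    by (simp add: integrable_relent int_h)
  finally show ?thesis .
qed

lemma average_empty: "\<xi> \<in> configurations \<Longrightarrow> average {} \<xi> = (\<integral>\<zeta>. G \<zeta> \<partial>P)"
  unfolding average_def by (intro Bochner_Integration.integral_cong refl) (simp add: glue_empty)

text \<open>The increments telescope, beginning with \<open>average {}\<close>, which is the
  constant mean of \<open>G\<close>.\<close>

lemma entropy_tensorization:
  fixes A :: "nat \<Rightarrow> 'a set"
  assumes A: "\<And>j. A j \<in> sets borel" and disj: "disjoint_family A"
  shows "(\<integral>\<xi>. G \<xi> * ln (average (\<Union>j<K. A j) \<xi>) \<partial>P) - (\<integral>\<xi>. G \<xi> \<partial>P) * ln (\<integral>\<xi>. G \<xi> \<partial>P) \<le>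
    (\<Sum>j<K. \<integral>\<xi>. relent (G \<xi>) (G (restr (- A j) \<xi>)) \<partial>P)"
proof (induction K)
  case 0
  have "(\<integral>\<xi>. G \<xi> * ln (average {} \<xi>) \<partial>P) = (\<integral>\<xi>. G \<xi> * ln (\<integral>\<zeta>. G \<zeta> \<partial>P) \<partial>P)"
    by (intro Bochner_Integration.integral_cong refl) (simp add: average_empty)
  then show ?case by simp
next
  case (Suc K)
  have "A j \<inter> A K = {}" if "j < K" for j
    using disj that unfolding disjoint_family_on_def by (metis UNIV_I less_irrefl)
  then have "(\<Union>j<K. A j) \<inter> A K = {}" by blast
  moreover have "(\<Union>j<K. A j) \<in> sets borel" using A by (intro sets.finite_UN) auto
  moreover have "(\<Union>j<Suc K. A j) = (\<Union>j<K. A j) \<union> A K"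
    unfolding lessThan_Suc by blast
  ultimately show ?case
    using Suc.IH entropy_increment[OF A[of K], of "\<Union>j<K. A j"] by simp
qed

end

section \<open>Simple points and mean counts\<close>

text \<open>Simple functions below \<open>f\<close> pull back to measurable functions below the
  composition with \<open>T\<close>, whatever \<open>f\<close> is. For a non-measurable
  \<open>f\<close> only this direction is available.\<close>

lemma nn_integral_distr_le:
  assumes T: "T \<in> M \<rightarrow>\<^sub>M N"
  shows "(\<integral>\<^sup>+y. f y \<partial>distr M N T) \<le> (\<integral>\<^sup>+x. f (T x) \<partial>M)"
  unfolding nn_integral_def[of "distr M N T"]
proof (rule SUP_least)
  fix g assume "g \<in> {g. simple_function (distr M N T) g \<and> g \<le> f}"
  then have g: "simple_function (distr M N T) g" "g \<le> f" by auto
  have "integral\<^sup>S (distr M N T) g = (\<integral>\<^sup>+y. g y \<partial>distr M N T)"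
    using g(1) by (simp add: nn_integral_eq_simple_integral)
  also have "\<dots> = (\<integral>\<^sup>+x. g (T x) \<partial>M)"
    using T borel_measurable_simple_function[OF g(1)] by (intro nn_integral_distr) simp_all
  also have "\<dots> \<le> (\<integral>\<^sup>+x. f (T x) \<partial>M)"
    using g(2) by (intro nn_integral_mono) (simp add: le_fun_def)
  finally show "integral\<^sup>S (distr M N T) g \<le> (\<integral>\<^sup>+x. f (T x) \<partial>M)" .
qed

text \<open>The corresponding combination of point indicators is a measurable function below
  \<open>f\<close>, so no measurability of \<open>f\<close> enters.\<close>

lemma sum_le_nn_integral_points:
  assumes S: "finite S" and sets: "\<And>x. x \<in> S \<Longrightarrow> {x} \<in> sets M"
  shows "(\<Sum>x\<in>S. f x * emeasure M {x}) \<le> (\<integral>\<^sup>+x. f x \<partial>M)"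
proof -
  have "(\<Sum>x\<in>S. f x * emeasure M {x}) = (\<Sum>x\<in>S. \<integral>\<^sup>+y. f x * indicator {x} y \<partial>M)"
    using sets by (intro sum.cong) (auto simp: nn_integral_cmult_indicator)
  also have "\<dots> = (\<integral>\<^sup>+y. (\<Sum>x\<in>S. f x * indicator {x} y) \<partial>M)"
    using sets by (intro nn_integral_sum[symmetric]) auto
  also have "\<dots> \<le> (\<integral>\<^sup>+y. f y \<partial>M)"
  proof (intro nn_integral_mono)
    fix y
    have "(\<Sum>x\<in>S. f x * indicator {x} y) = (\<Sum>x\<in>S. if x = y then f x else 0)"
      by (intro sum.cong) (auto simp: indicator_def)
    also have "\<dots> \<le> f y" using S by simp
    finally show "(\<Sum>x\<in>S. f x * indicator {x} y) \<le> f y" .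
  qed
  finally show ?thesis .
qed

text \<open>A count of one leaves exactly one index of the atom list in \<open>A\<close>. This links
  emptying a set, which suits independence, to the removal of one Dirac mass in
  \<open>diff_minus\<close>.\<close>

lemma single_point:
  fixes \<xi> :: "'a::metric_space measure"
  assumes \<xi>: "\<xi> \<in> configurations" and A: "A \<in> sets borel" "A \<subseteq> window n" and one: "emeasure \<xi> A = 1"
  shows "\<exists>x\<in>A. emeasure \<xi> {x} = 1 \<and> restr (- A) \<xi> = diff_measure \<xi> (return borel x)"
proof -
  have s: "sets \<xi> = sets borel" using \<xi> by (rule sets_configuration)
  obtain N :: nat and x where x: "\<forall>i<N. x i \<in> window n"
    and em: "\<forall>A\<in>sets borel. emeasure \<xi> (A \<inter> window n) = of_nat (card {i. i < N \<and> x i \<in> A})"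
    using configuration_atoms[OF \<xi>, of n] by blast
  have "of_nat (card {i. i < N \<and> x i \<in> A}) = (1::ennreal)"
    using em A one by (metis Int_absorb2)
  then have "card {i. i < N \<and> x i \<in> A} = 1" by (metis of_nat_1 of_nat_eq_iff)
  then obtain i where i: "{i. i < N \<and> x i \<in> A} = {i}" by (auto simp: card_1_singleton_iff)
  then have iA: "i < N" "x i \<in> A" by auto
  have xw: "{x i} \<inter> window n = {x i}" using iA A(2) by auto
  have uniq: "i' = i" if "i' < N" "x i' \<in> A" for i' using i that by blast
  have "{i'. i' < N \<and> x i' \<in> {x i}} = {i}"
  proof (intro equalityI subsetI)
    fix i' assume "i' \<in> {i'. i' < N \<and> x i' \<in> {x i}}"
    then show "i' \<in> {i}" using uniq[of i'] iA(2) by simp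
  qed (use iA in simp)
  then have pt: "emeasure \<xi> {x i} = 1" using em[rule_format, of "{x i}"] unfolding xw by simp
  have rest: "emeasure \<xi> (B \<inter> A) = indicator B (x i)" if B: "B \<in> sets borel" for B
  proof -
    have "B \<inter> A \<in> sets borel" using A B by auto
    moreover have "(B \<inter> A) \<inter> window n = B \<inter> A" using A(2) by auto
    ultimately have "emeasure \<xi> (B \<inter> A) = of_nat (card {i. i < N \<and> x i \<in> B \<inter> A})"
      using em by metis
    also have "{i. i < N \<and> x i \<in> B \<inter> A} = {i'. i' = i \<and> x i \<in> B}"
    proof (intro Collect_cong iffI)
      fix i' assume "i' < N \<and> x i' \<in> B \<inter> A"
      then show "i' = i \<and> x i \<in> B" using uniq[of i'] by simp
    qed (use iA in simp)
    finally show ?thesis by (cases "x i \<in> B") simp_all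
  qed
  have "restr (- A) \<xi> = diff_measure \<xi> (return borel (x i))"
  proof (rule configuration_eqI)
    show "restr (- A) \<xi> \<in> configurations" using A by (intro restr_configuration \<xi>) auto
    have pos: "emeasure \<xi> {x i} > 0" using pt by simp
    show "diff_measure \<xi> (return borel (x i)) \<in> configurations"
      using remove_dirac_in_configurations[OF \<xi> pos] .
    fix B :: "'a set" assume B: "B \<in> sets borel"
    have "emeasure \<xi> B = emeasure \<xi> ((B \<inter> - A) \<union> (B \<inter> A))" by (rule arg_cong[of _ _ "emeasure \<xi>"]) auto
    also have "\<dots> = emeasure \<xi> (B \<inter> - A) + emeasure \<xi> (B \<inter> A)"
      using A B s by (intro plus_emeasure[symmetric]) auto
    finally have "emeasure \<xi> B = emeasure \<xi> (B \<inter> - A) + indicator B (x i)" using rest[OF B] by simp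
    then show "emeasure (restr (- A) \<xi>) B = emeasure (diff_measure \<xi> (return borel (x i))) B"
      using A B by (simp add: emeasure_remove_dirac[OF \<xi> pos] emeasure_restr[OF \<xi>] indicator_def)
  qed
  then show ?thesis using iA pt by blast
qed

lemma restr_null:
  assumes \<xi>: "\<xi> \<in> configurations" and A: "A \<in> sets borel" and zero: "emeasure \<xi> A = 0"
  shows "restr (- A) \<xi> = \<xi>"
proof (rule configuration_eqI)
  have s: "sets \<xi> = sets borel" using \<xi> by (rule sets_configuration)
  fix B :: "'a set" assume B: "B \<in> sets borel"
  have "emeasure \<xi> (B \<inter> A) \<le> emeasure \<xi> A" using A s by (intro emeasure_mono) auto
  then have "emeasure \<xi> (B \<inter> A) = 0" using zero by simp
  moreover have "emeasure \<xi> B = emeasure \<xi> ((B \<inter> - A) \<union> (B \<inter> A))" by (rule arg_cong[of _ _ "emeasure \<xi>"]) auto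
  moreover have "\<dots> = emeasure \<xi> (B \<inter> - A) + emeasure \<xi> (B \<inter> A)"
    using A B s by (intro plus_emeasure[symmetric]) auto
  ultimately show "emeasure (restr (- A) \<xi>) B = emeasure \<xi> B" using A B by (simp add: emeasure_restr[OF \<xi>])
qed (use assms in \<open>auto intro: restr_configuration\<close>)

text \<open>Multiply \<open>1 - m \<le> exp (- m)\<close> by \<open>1 + m\<close>. The left side is
  the probability of at least two points.\<close>

lemma one_minus_poisson_le:
  fixes m :: real
  assumes "m \<ge> 0"
  shows "1 - poisson_weight m 0 - poisson_weight m 1 \<le> m ^ 2"
proof -
  have "exp (- m) \<ge> 1 - m" using exp_ge_add_one_self[of "- m"] by simp
  then have "(1 - m) * (1 + m) \<le> exp (- m) * (1 + m)" using assms by (intro mult_right_mono) auto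
  then show ?thesis by (simp add: poisson_weight_def algebra_simps power2_eq_square)
qed

context poisson_law
begin

lemma intensity_finite: "A \<subseteq> window n \<Longrightarrow> emeasure \<nu> A < \<infinity>"
  using emeasure_mono[of A "window n" \<nu>] intensity_window[of n] sets_intensity by (simp add: le_less_trans)

lemma prob_eq_nat:
  assumes "A \<in> sets borel" "A \<subseteq> window n"
  shows "prob {\<xi> \<in> configurations. emeasure \<xi> A = of_nat k} = poisson_weight (measure \<nu> A) k"
  using fdd[of 1 "\<lambda>_. A" "\<lambda>_. k"] assms by (auto simp: disjoint_family_on_def)

lemma prob_two_points:
  assumes A: "A \<in> sets borel" "A \<subseteq> window n"
  shows "emeasure P {\<xi> \<in> configurations. \<not> emeasure \<xi> A \<le> 1} \<le> emeasure \<nu> A * emeasure \<nu> A"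
proof -
  define E where "E k = {\<xi> \<in> configurations. emeasure \<xi> A = of_nat k}" for k
  have E: "E k \<in> events" for k
  proof -
    have "{\<xi> \<in> space P. emeasure \<xi> A = of_nat k} \<in> events" using A(1) by measurable
    then show ?thesis by (simp add: E_def)
  qed
  have le1: "emeasure \<xi> A \<le> 1 \<longleftrightarrow> emeasure \<xi> A = of_nat 0 \<or> emeasure \<xi> A = of_nat 1"
    if conf: "\<xi> \<in> configurations" for \<xi>
  proof -
    obtain k where "emeasure \<xi> A = of_nat k" using emeasure_bounded_nat[OF conf A] by blast
    then show ?thesis by (metis of_nat_0 of_nat_1 of_nat_le_iff of_nat_eq_iff le_Suc_eq le_zero_eq One_nat_def)
  qed
  have eq: "{\<xi> \<in> configurations. \<not> emeasure \<xi> A \<le> 1} = space P - (E 0 \<union> E 1)"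
    using le1 by (auto simp: E_def)
  have pE: "prob (E k) = poisson_weight (measure \<nu> A) k" for k
    unfolding E_def by (rule prob_eq_nat[OF A])
  have "E 0 \<inter> E 1 = {}" by (auto simp: E_def)
  then have "prob (E 0 \<union> E 1) = prob (E 0) + prob (E 1)"
    using E by (intro finite_measure_Union) auto
  then have "prob (space P - (E 0 \<union> E 1)) = 1 - poisson_weight (measure \<nu> A) 0 - poisson_weight (measure \<nu> A) 1"
    using E pE by (subst prob_compl) auto
  also have "\<dots> \<le> measure \<nu> A ^ 2" by (rule one_minus_poisson_le) simp
  finally have "emeasure P (space P - (E 0 \<union> E 1)) \<le> ennreal (measure \<nu> A ^ 2)"
    by (simp add: emeasure_eq_measure ennreal_leI)
  also have "\<dots> = emeasure \<nu> A * emeasure \<nu> A"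
  proof -
    have "emeasure \<nu> A = ennreal (measure \<nu> A)"
      using intensity_finite[OF A(2)] by (intro emeasure_eq_ennreal_measure) auto
    then show ?thesis by (simp add: power2_eq_square ennreal_mult)
  qed
  finally show ?thesis unfolding eq .
qed

text \<open>The sum is the integral over the window of the intensity of the cell around
  \<open>x\<close>. These cells decrease to \<open>{x}\<close>, a null set, and the intensity of the
  window dominates.\<close>

lemma sum_squared_intensity_tendsto:
  "(\<lambda>m. \<Sum>j<2^m. emeasure \<nu> (cell m n j) * emeasure \<nu> (cell m n j)) \<longlonglongrightarrow> 0"
proof -
  have cell_sets [measurable]: "cell m n j \<in> sets \<nu>" for m j using sets_intensity by simp
  have window_sets [measurable]: "window n \<in> sets \<nu>" using sets_intensity by simp
  define u where "u m x = (\<Sum>j<2^m. emeasure \<nu> (cell m n j) * indicator (cell m n j) x)" for m and x :: 'a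
  have u_eq: "u m x = (if x \<in> window n then emeasure \<nu> (cell m n (code m x)) else 0)" for m x
  proof -
    have "u m x = (\<Sum>j<2^m. if j = code m x then (if x \<in> window n then emeasure \<nu> (cell m n j) else 0) else 0)"
      unfolding u_def by (intro sum.cong) (auto simp: cell_def indicator_def)
    then show ?thesis using code_less[of m x] by simp
  qed
  have int: "(\<integral>\<^sup>+x. u m x \<partial>\<nu>) = (\<Sum>j<2^m. emeasure \<nu> (cell m n j) * emeasure \<nu> (cell m n j))" for m
    unfolding u_def by (subst nn_integral_sum) (auto simp: nn_integral_cmult_indicator)
  have "(\<lambda>m. \<integral>\<^sup>+x. u m x \<partial>\<nu>) \<longlonglongrightarrow> (\<integral>\<^sup>+x. 0 \<partial>\<nu>)"
  proof (rule nn_integral_dominated_convergence[where w = "\<lambda>x. emeasure \<nu> (window n) * indicator (window n) x"])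
    show "u m \<in> borel_measurable \<nu>" for m unfolding u_def by measurable
    show "(\<integral>\<^sup>+x. emeasure \<nu> (window n) * indicator (window n) x \<partial>\<nu>) < \<infinity>"
      using intensity_window[of n] by (subst nn_integral_cmult_indicator) (auto simp: ennreal_mult_less_top)
    show "AE x in \<nu>. u m x \<le> emeasure \<nu> (window n) * indicator (window n) x" for m
      using cell_subset_window by (intro AE_I2) (auto simp: u_eq intro!: emeasure_mono)
    show "AE x in \<nu>. (\<lambda>m. u m x) \<longlonglongrightarrow> 0"
    proof (intro AE_I2)
      fix x :: 'a
      show "(\<lambda>m. u m x) \<longlonglongrightarrow> 0"
      proof (cases "x \<in> window n")
        case True
        have "(\<lambda>m. emeasure \<nu> (cell m n (code m x))) \<longlonglongrightarrow> emeasure \<nu> (\<Inter>m. cell m n (code m x))"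
        proof (rule Lim_emeasure_decseq)
          show "decseq (\<lambda>m. cell m n (code m x))"
            unfolding decseq_def cell_def by (auto intro: code_mono)
          show "emeasure \<nu> (cell m n (code m x)) \<noteq> \<infinity>" for m
            using intensity_finite[OF cell_subset_window] by (simp add: less_top)
        qed auto
        moreover have "(\<Inter>m. cell m n (code m x)) = {x}"
        proof (intro equalityI subsetI)
          fix y :: 'a assume y: "y \<in> (\<Inter>m. cell m n (code m x))"
          show "y \<in> {x}"
          proof (rule ccontr)
            assume "y \<notin> {x}"
            then have "open (- {y})" "x \<in> - {y}" by auto
            from code_separates_open[OF this] obtain m where "code m y = code m x \<longrightarrow> y \<in> - {y}" by blast
            then show False using y by (auto simp: cell_def)
          qed
        qed (use True in \<open>auto simp: cell_def\<close>)
        ultimately show ?thesis using True no_atoms[of x] by (simp add: u_eq)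
      qed (simp add: u_eq)
    qed
  qed auto
  then show ?thesis by (simp add: int)
qed

text \<open>A configuration that fails has an overfull cell at every level. This event is contained
  in the one for any fixed level, whose probability is at most the sum of squared
  intensities.\<close>

lemma AE_simple: "AE \<xi> in P. \<exists>m. \<forall>j<2^m. emeasure \<xi> (cell m n j) \<le> 1"
proof -
  define B where "B m = {\<xi> \<in> configurations :: 'a measure set. \<exists>j<2^m. \<not> emeasure \<xi> (cell m n j) \<le> 1}" for m
  have B: "B m \<in> events" for m
  proof -
    have "{\<xi> \<in> space P. \<exists>j\<in>{..<2^m}. \<not> emeasure \<xi> (cell m n j) \<le> 1} \<in> events" by measurable
    moreover have "B m = {\<xi> \<in> space P. \<exists>j\<in>{..<2^m}. \<not> emeasure \<xi> (cell m n j) \<le> 1}"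
      unfolding B_def by (simp only: space_P Bex_def lessThan_iff)
    ultimately show ?thesis by simp
  qed
  have "emeasure P (B m) \<le> (\<Sum>j<2^m. emeasure \<nu> (cell m n j) * emeasure \<nu> (cell m n j))" for m
  proof -
    have "B m = (\<Union>j<2^m. {\<xi> \<in> configurations. \<not> emeasure \<xi> (cell m n j) \<le> 1})"
      by (auto simp: B_def)
    also have "emeasure P \<dots> \<le> (\<Sum>j<2^m. emeasure P {\<xi> \<in> configurations. \<not> emeasure \<xi> (cell m n j) \<le> 1})"
    proof (rule emeasure_subadditive_finite)
      have "{\<xi> \<in> space P. \<not> emeasure \<xi> (cell m n j) \<le> 1} \<in> events" for j by measurable
      then show "(\<lambda>j. {\<xi> \<in> configurations. \<not> emeasure \<xi> (cell m n j) \<le> 1}) ` {..<2 ^ m} \<subseteq> events" by auto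
    qed simp
    also have "\<dots> \<le> (\<Sum>j<2^m. emeasure \<nu> (cell m n j) * emeasure \<nu> (cell m n j))"
      by (intro sum_mono prob_two_points[OF _ cell_subset_window]) simp
    finally show ?thesis .
  qed
  note le = this
  have "emeasure P (\<Inter>m. B m) \<le> (\<Sum>j<2^m. emeasure \<nu> (cell m n j) * emeasure \<nu> (cell m n j))" for m
    by (rule order_trans[OF emeasure_mono le]) (use B in auto)
  then have "emeasure P (\<Inter>m. B m) \<le> 0"
    by (intro LIMSEQ_le_const[OF sum_squared_intensity_tendsto]) blast
  moreover have "(\<Inter>m. B m) \<in> events" using B by (intro sets.countable_INT) auto
  ultimately have "(\<Inter>m. B m) \<in> null_sets P" by (simp add: null_sets_def)
  then show ?thesis
    by (rule AE_I') (simp add: B_def, blast)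
qed

text \<open>Each cell of a finer level lies in a cell of the coarser one. One good level therefore
  makes all later levels good, as a bound on a limsup requires.\<close>

lemma simple_cells_mono:
  fixes \<xi> :: "'a measure"
  assumes \<xi>: "\<xi> \<in> configurations" and simple: "\<forall>j<2^m. emeasure \<xi> (cell m n j) \<le> 1" and "m \<le> m'"
  shows "emeasure \<xi> (cell m' n j) \<le> 1"
proof (cases "cell m' n j = ({} :: 'a set)")
  case False
  then obtain x :: 'a where x: "x \<in> cell m' n j" by blast
  have "cell m' n j \<subseteq> cell m n (code m x)"
    using x \<open>m \<le> m'\<close> by (auto simp: cell_def intro: code_mono)
  then have "emeasure \<xi> (cell m' n j) \<le> emeasure \<xi> (cell m n (code m x))"
    using sets_configuration[OF \<xi>] by (intro emeasure_mono) auto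
  also have "\<dots> \<le> 1" using simple code_less by blast
  finally show ?thesis .
qed simp

text \<open>This will make the point count of a window an integrable majorant for the cell energies,
  uniformly in the partition.\<close>

lemma mean_count_finite: "(\<integral>\<^sup>+\<xi>. emeasure \<xi> (window n) \<partial>P) < \<infinity>"
proof -
  define m where "m = measure \<nu> (window n)"
  define E where "E k = {\<xi> \<in> configurations :: 'a measure set. emeasure \<xi> (window n) = of_nat k}" for k
  have E [measurable]: "E k \<in> events" for k
  proof -
    have "{\<xi> \<in> space P. emeasure \<xi> (window n) = of_nat k} \<in> events" by measurable
    then show ?thesis by (simp add: E_def)
  qed
  have "(\<integral>\<^sup>+\<xi>. emeasure \<xi> (window n) \<partial>P) = (\<integral>\<^sup>+\<xi>. (\<Sum>k. of_nat k * indicator (E k) \<xi>) \<partial>P)"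
  proof (intro nn_integral_cong)
    fix \<xi> assume "\<xi> \<in> space P"
    then have conf: "\<xi> \<in> configurations" by simp
    obtain k where k: "emeasure \<xi> (window n) = of_nat k"
      using emeasure_bounded_nat[OF conf window_borel order_refl] by blast
    have ind: "indicator (E i) \<xi> = (if i = k then 1 else 0 :: ennreal)" for i
      using conf by (auto simp: E_def k indicator_def)
    have "(\<Sum>i. of_nat i * indicator (E i) \<xi>) = (\<Sum>i\<in>{k}. of_nat i * indicator (E i) \<xi> :: ennreal)"
      by (rule suminf_finite) (auto simp: ind)
    then show "emeasure \<xi> (window n) = (\<Sum>k. of_nat k * indicator (E k) \<xi>)" by (simp add: ind k)
  qed
  also have "\<dots> = (\<Sum>k. of_nat k * emeasure P (E k))"
    by (subst nn_integral_suminf) (auto simp: nn_integral_cmult_indicator)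
  also have "\<dots> = (\<Sum>k. ennreal (real k * poisson_weight m k))"
  proof (intro suminf_cong)
    fix k
    have "prob (E k) = poisson_weight m k"
      unfolding E_def m_def by (rule prob_eq_nat[OF window_borel order_refl])
    then show "of_nat k * emeasure P (E k) = ennreal (real k * poisson_weight m k)"
      by (simp add: emeasure_eq_measure ennreal_mult' ennreal_of_nat_eq_real_of_nat)
  qed
  also have "\<dots> < \<infinity>"
  proof -
    have "summable (\<lambda>k. real (Suc k) * poisson_weight m (Suc k))"
    proof -
      \<comment> \<open>The factor \<open>Suc k\<close> cancels in the factorial, and the
        exponential series remains.\<close>
      have eq: "real (Suc k) * poisson_weight m (Suc k) = m * exp (- m) * (m ^ k /\<^sub>R fact k)" for k
        by (simp add: poisson_weight_def divide_inverse inverse_mult_distrib mult_ac del: of_nat_Suc)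
      show ?thesis unfolding eq by (intro summable_mult summable_exp_generic)
    qed
    then have "summable (\<lambda>k. real k * poisson_weight m k)" by (subst (asm) summable_Suc_iff)
    moreover have "0 \<le> real k * poisson_weight m k" for k
      by (simp add: poisson_weight_def m_def)
    ultimately have "(\<Sum>k. ennreal (real k * poisson_weight m k)) \<noteq> top"
      by (intro ennreal_suminf_neq_top) auto
    then show ?thesis by (simp add: less_top)
  qed
  finally show ?thesis .
qed

end

section \<open>Exhaustion by windows\<close>

context poisson_law
begin

lemma configurations_event [simp]: "configurations \<in> events"
  using sets.top[of P] by simp

text \<open>The glued configuration is the first coordinate of an exchange, and exchanges preserve
  the product law.\<close>

lemma glue_marginal:
  assumes "C \<in> sets borel"
  shows "distr (P \<Otimes>\<^sub>M P) P (\<lambda>p. glue C (fst p) (snd p)) = P"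
proof -
  have fst: "distr (P \<Otimes>\<^sub>M P) P fst = P"
  proof (rule measure_eqI)
    fix A assume "A \<in> sets (distr (P \<Otimes>\<^sub>M P) P fst)"
    then have A: "A \<in> events" by simp
    have "emeasure (distr (P \<Otimes>\<^sub>M P) P fst) A = emeasure (P \<Otimes>\<^sub>M P) (fst -` A \<inter> space (P \<Otimes>\<^sub>M P))"
      using A by (intro emeasure_distr) auto
    also have "fst -` A \<inter> space (P \<Otimes>\<^sub>M P) = A \<times> space P"
      using sets.sets_into_space[OF A] by (auto simp: space_pair_measure)
    also have "emeasure (P \<Otimes>\<^sub>M P) \<dots> = emeasure P A * emeasure P (space P)"
      using A by (intro emeasure_pair_measure_Times) auto
    finally show "emeasure (distr (P \<Otimes>\<^sub>M P) P fst) A = emeasure P A"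
      using emeasure_space_1 by simp
  qed simp
  have sw: "swap_parts C \<in> P \<Otimes>\<^sub>M P \<rightarrow>\<^sub>M P \<Otimes>\<^sub>M P"
    using measurable_swap_parts[OF assms] by (simp cong: measurable_cong_sets add: sets_pair_P)
  have "distr (P \<Otimes>\<^sub>M P) P (\<lambda>p. glue C (fst p) (snd p)) = distr (P \<Otimes>\<^sub>M P) P (fst \<circ> swap_parts C)"
    by (simp add: swap_parts_def comp_def)
  also have "\<dots> = distr (distr (P \<Otimes>\<^sub>M P) (P \<Otimes>\<^sub>M P) (swap_parts C)) P fst"
    by (rule distr_distr[symmetric, OF _ sw]) simp
  also have "\<dots> = P" unfolding distr_swap_parts[OF assms] by (rule fst)
  finally show ?thesis .
qed

lemma fst_marginal: "distr (P \<Otimes>\<^sub>M P) P fst = P"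
proof -
  have "distr (P \<Otimes>\<^sub>M P) P (\<lambda>p. glue UNIV (fst p) (snd p)) = distr (P \<Otimes>\<^sub>M P) P fst"
  proof (rule distr_cong)
    fix p assume "p \<in> space (P \<Otimes>\<^sub>M P)"
    then have p: "fst p \<in> configurations" "snd p \<in> configurations" by (auto simp: space_pair_measure)
    show "glue UNIV (fst p) (snd p) = fst p"
      by (rule configuration_eqI) (use p in \<open>auto simp: emeasure_glue intro!: glue_configuration\<close>)
  qed auto
  then show ?thesis using glue_marginal[of UNIV] by simp
qed

text \<open>The mean effect on \<open>u\<close> of resampling all points outside a window. Its
  convergence to zero plays the part of martingale convergence for the averages over growing
  windows.\<close>

definition resampling_distance :: "('a measure \<Rightarrow> real) \<Rightarrow> nat \<Rightarrow> real" where
  "resampling_distance u n = (\<integral>p. \<bar>u (glue (window n) (fst p) (snd p)) - u (fst p)\<bar> \<partial>(P \<Otimes>\<^sub>M P))"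

lemma
  assumes u: "integrable P u"
  shows integrable_glue: "integrable (P \<Otimes>\<^sub>M P) (\<lambda>p. u (glue (window n) (fst p) (snd p)) :: real)"
    and integral_glue: "(\<integral>p. u (glue (window n) (fst p) (snd p)) \<partial>(P \<Otimes>\<^sub>M P)) = (\<integral>\<xi>. u \<xi> \<partial>P)"
    and integrable_fst: "integrable (P \<Otimes>\<^sub>M P) (\<lambda>p. u (fst p))"
    and integral_fst: "(\<integral>p. u (fst p) \<partial>(P \<Otimes>\<^sub>M P)) = (\<integral>\<xi>. u \<xi> \<partial>P)"
proof -
  have um: "u \<in> borel_measurable P" using u by auto
  note g = measurable_glue_P[OF window_borel, of n]
  note f = measurable_fst[of P P]
  show "integrable (P \<Otimes>\<^sub>M P) (\<lambda>p. u (glue (window n) (fst p) (snd p)))"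
    using integrable_distr_eq[OF g um] u by (simp add: glue_marginal)
  show "(\<integral>p. u (glue (window n) (fst p) (snd p)) \<partial>(P \<Otimes>\<^sub>M P)) = (\<integral>\<xi>. u \<xi> \<partial>P)"
    using integral_distr[OF g um] by (simp add: glue_marginal)
  show "integrable (P \<Otimes>\<^sub>M P) (\<lambda>p. u (fst p))"
    using integrable_distr_eq[OF f um] u by (simp add: fst_marginal)
  show "(\<integral>p. u (fst p) \<partial>(P \<Otimes>\<^sub>M P)) = (\<integral>\<xi>. u \<xi> \<partial>P)"
    using integral_distr[OF f um] by (simp add: fst_marginal)
qed

lemma integrable_resampling:
  fixes u :: "'a measure \<Rightarrow> real"
  shows "integrable P u \<Longrightarrow>
    integrable (P \<Otimes>\<^sub>M P) (\<lambda>p. \<bar>u (glue (window n) (fst p) (snd p)) - u (fst p)\<bar>)"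
  by (intro integrable_abs Bochner_Integration.integrable_diff integrable_glue integrable_fst)

lemma resampling_distance_nonneg: "0 \<le> resampling_distance u n"
  unfolding resampling_distance_def by (intro integral_nonneg_AE AE_I2) auto

text \<open>Triangle inequality through \<open>v\<close>. The original and the resampled
  configuration have the same law and contribute one error each, whence the factor 2.\<close>

lemma resampling_distance_approx:
  assumes u: "integrable P u" and v: "integrable P v"
  shows "resampling_distance u n \<le> resampling_distance v n + 2 * (\<integral>\<xi>. \<bar>u \<xi> - v \<xi>\<bar> \<partial>P)"
proof -
  have uv: "integrable P (\<lambda>\<xi>. \<bar>u \<xi> - v \<xi>\<bar>)" using u v by auto
  let ?g = "\<lambda>p. glue (window n) (fst p) (snd p)"
  have "resampling_distance u n \<le>
      (\<integral>p. \<bar>v (?g p) - v (fst p)\<bar> + (\<bar>u (?g p) - v (?g p)\<bar> + \<bar>u (fst p) - v (fst p)\<bar>) \<partial>(P \<Otimes>\<^sub>M P))"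
    unfolding resampling_distance_def
    by (intro integral_mono integrable_resampling[OF u] Bochner_Integration.integrable_add
        integrable_resampling[OF v] integrable_glue[OF uv] integrable_fst[OF uv]) linarith
  also have "\<dots> = resampling_distance v n + ((\<integral>\<xi>. \<bar>u \<xi> - v \<xi>\<bar> \<partial>P) + (\<integral>\<xi>. \<bar>u \<xi> - v \<xi>\<bar> \<partial>P))"
    using integrable_resampling[OF v, of n] integrable_glue[OF uv, of n] integrable_fst[OF uv]
    by (simp add: resampling_distance_def integral_glue[OF uv] integral_fst[OF uv])
  finally show ?thesis by simp
qed

lemma resampling_distance_tendsto_limit:
  assumes u: "integrable P u" and v: "\<And>k. integrable P (v k)"
    and lim: "(\<lambda>k. \<integral>\<xi>. \<bar>u \<xi> - v k \<xi>\<bar> \<partial>P) \<longlonglongrightarrow> 0"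
    and R: "\<And>k. resampling_distance (v k) \<longlonglongrightarrow> 0"
  shows "resampling_distance u \<longlonglongrightarrow> 0"
proof (rule LIMSEQ_I)
  fix e :: real assume e: "e > 0"
  \<comment> \<open>The approximation error enters twice, so \<open>e / 4\<close> leaves
    \<open>e / 2\<close> for the resampling distance of \<open>v k\<close>.\<close>
  obtain k where k: "(\<integral>\<xi>. \<bar>u \<xi> - v k \<xi>\<bar> \<partial>P) < e / 4"
    using LIMSEQ_D[OF lim, of "e / 4"] e by (auto simp: abs_less_iff)
  obtain n0 where n0: "\<And>n. n \<ge> n0 \<Longrightarrow> resampling_distance (v k) n < e / 2"
    using LIMSEQ_D[OF R, of "e / 2" k] e
    by (auto simp: resampling_distance_nonneg)
  have "norm (resampling_distance u n - 0) < e" if "n \<ge> n0" for n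
    using resampling_distance_approx[OF u v[of k], of n] n0[OF that] k resampling_distance_nonneg[of u n] by simp
  then show "\<exists>n0. \<forall>n\<ge>n0. norm (resampling_distance u n - 0) < e" by blast
qed

lemma integrable_indicator_event: "S \<in> events \<Longrightarrow> integrable P (indicator S :: _ \<Rightarrow> real)"
  by (simp add: emeasure_eq_measure)

text \<open>Induction on the generated sigma-algebra: a count event is unaffected as soon as the
  window contains its set, a complement has the same distance, and a countable union is the limit in
  mean of finite unions.\<close>

lemma resampling_distance_indicator:
  assumes "S \<in> events"
  shows "resampling_distance (indicator S) \<longlonglongrightarrow> 0"
proof -
  define E where "E = {{\<xi> \<in> configurations. emeasure \<xi> A = of_nat k} |
    (A :: 'a set) k n. A \<in> sets borel \<and> A \<subseteq> window n}"
  have "E \<subseteq> Pow configurations" by (auto simp: E_def)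
  then have events: "events = sigma_sets configurations E"
    unfolding sets_P counting_space_def E_def[symmetric] by simp
  have "S \<in> sigma_sets configurations E" using assms events by simp
  then show ?thesis
  proof (induction S rule: sigma_sets.induct)
    case (Basic S)
    then obtain A k n0 where S: "S = {\<xi> \<in> configurations. emeasure \<xi> A = of_nat k}"
      and A: "A \<in> sets borel" "A \<subseteq> window n0" unfolding E_def by blast
    have "resampling_distance (indicator S) n = 0" if n: "n \<ge> n0" for n
    proof -
      have An: "A \<inter> window n = A" "A - window n = {}" using A(2) window_mono[OF n] by auto
      have "resampling_distance (indicator S) n = (\<integral>p. 0 \<partial>(P \<Otimes>\<^sub>M P))"
        unfolding resampling_distance_def
      proof (intro Bochner_Integration.integral_cong refl)
        fix p assume "p \<in> space (P \<Otimes>\<^sub>M P)"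
        then have p: "fst p \<in> configurations" "snd p \<in> configurations" by (auto simp: space_pair_measure)
        have "emeasure (glue (window n) (fst p) (snd p)) A = emeasure (fst p) A"
          using emeasure_glue[OF p window_borel A(1), of n] unfolding An by simp
        then show "\<bar>indicator S (glue (window n) (fst p) (snd p)) - indicator S (fst p)\<bar> = (0::real)"
          using p by (simp add: S indicator_def glue_configuration)
      qed
      then show ?thesis by simp
    qed
    then show ?case by (intro tendsto_eventually) (auto simp: eventually_sequentially)
  next
    case Empty
    then show ?case by (simp add: resampling_distance_def)
  next
    case (Compl S)
    have "resampling_distance (indicator (configurations - S)) n = resampling_distance (indicator S) n" for n
      unfolding resampling_distance_def
    proof (intro Bochner_Integration.integral_cong refl)
      fix p assume "p \<in> space (P \<Otimes>\<^sub>M P)"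
      then have "fst p \<in> configurations" "glue (window n) (fst p) (snd p) \<in> configurations"
        by (auto simp: space_pair_measure intro: glue_configuration)
      then show "\<bar>indicator (configurations - S) (glue (window n) (fst p) (snd p)) -
          indicator (configurations - S) (fst p)\<bar> =
          \<bar>indicator S (glue (window n) (fst p) (snd p)) - indicator S (fst p) :: real\<bar>"
        by (simp add: indicator_def)
    qed
    then show ?case using Compl.IH by simp
  next
    case (Union S)
    have S: "S i \<in> events" for i using Union.hyps events by simp
    define T where "T k = (\<Union>i<k. S i)" for k
    have T: "T k \<in> events" for k unfolding T_def using S by auto
    have U: "(\<Union>i. S i) \<in> events" using S by auto
    show ?case
    proof (rule resampling_distance_tendsto_limit[where v = "\<lambda>k. indicator (T k)"])
      show "(\<lambda>k. \<integral>\<xi>. \<bar>indicator (\<Union>i. S i) \<xi> - indicator (T k) \<xi> :: real\<bar> \<partial>P) \<longlonglongrightarrow> 0"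
      proof -
        have "(\<lambda>k. \<integral>\<xi>. \<bar>indicator (\<Union>i. S i) \<xi> - indicator (T k) \<xi> :: real\<bar> \<partial>P) \<longlonglongrightarrow> (\<integral>\<xi>. (0::real) \<partial>P)"
        proof (rule integral_dominated_convergence[where w = "\<lambda>_. 1"])
          show "(\<lambda>\<xi>. \<bar>indicator (\<Union>i. S i) \<xi> - indicator (T k) \<xi> :: real\<bar>) \<in> borel_measurable P" for k
            using T U by measurable
          show "AE \<xi> in P. (\<lambda>k. \<bar>indicator (\<Union>i. S i) \<xi> - indicator (T k) \<xi> :: real\<bar>) \<longlonglongrightarrow> 0"
          proof (intro AE_I2 tendsto_eventually)
            fix \<xi> :: "'a measure"
            show "\<forall>\<^sub>F k in sequentially. \<bar>indicator (\<Union>i. S i) \<xi> - indicator (T k) \<xi> :: real\<bar> = 0"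
            proof (cases "\<xi> \<in> (\<Union>i. S i)")
              case True
              then obtain i where "\<xi> \<in> S i" by blast
              then have "\<xi> \<in> T k" if "k \<ge> Suc i" for k using that by (auto simp: T_def)
              then show ?thesis using True by (auto simp: eventually_sequentially intro!: exI[of _ "Suc i"])
            next
              case False
              then have "\<xi> \<notin> T k" for k by (auto simp: T_def)
              then show ?thesis using False by simp
            qed
          qed
        qed (auto simp: indicator_def)
        then show ?thesis by simp
      qed
      fix k
      have bound: "resampling_distance (indicator (T k)) n \<le> (\<Sum>i<k. resampling_distance (indicator (S i)) n)" for n
      proof -
        \<comment> \<open>If membership in the finite union differs between \<open>x\<close> and
          \<open>y\<close>, so does membership in some \<open>S i\<close>.\<close>
        have *: "\<bar>indicator (T k) x - indicator (T k) y\<bar> \<le> (\<Sum>i<k. \<bar>indicator (S i) x - indicator (S i) y\<bar> :: real)" for x y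
        proof (cases "x \<in> T k \<longleftrightarrow> y \<in> T k")
          case False
          then obtain i where "i < k" "(x \<in> S i) \<noteq> (y \<in> S i)" by (auto simp: T_def)
          then have "1 \<le> \<bar>indicator (S i) x - indicator (S i) y :: real\<bar>" by (auto simp: indicator_def)
          also have "\<dots> \<le> (\<Sum>i<k. \<bar>indicator (S i) x - indicator (S i) y\<bar>)"
            using \<open>i < k\<close> by (intro member_le_sum) auto
          finally show ?thesis by (rule order_trans[rotated]) (simp add: indicator_def)
        qed (auto simp: indicator_def intro!: sum_nonneg)
        have "resampling_distance (indicator (T k)) n \<le>
          (\<integral>p. (\<Sum>i<k. \<bar>indicator (S i) (glue (window n) (fst p) (snd p)) - indicator (S i) (fst p)\<bar>) \<partial>(P \<Otimes>\<^sub>M P))"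
          unfolding resampling_distance_def
          by (intro integral_mono Bochner_Integration.integrable_sum integrable_resampling
              integrable_indicator_event S T *)
        also have "\<dots> = (\<Sum>i<k. resampling_distance (indicator (S i)) n)"
          unfolding resampling_distance_def
          by (intro Bochner_Integration.integral_sum integrable_resampling integrable_indicator_event S)
        finally show ?thesis .
      qed
      have sum0: "(\<lambda>n. \<Sum>i<k. resampling_distance (indicator (S i)) n) \<longlonglongrightarrow> 0"
        using tendsto_sum[of "{..<k}" "\<lambda>i. resampling_distance (indicator (S i))" "\<lambda>_. 0" sequentially] Union.IH
        by simp
      show "resampling_distance (indicator (T k)) \<longlonglongrightarrow> 0"
        by (rule tendsto_sandwich[OF _ _ tendsto_const sum0])
          (auto simp: resampling_distance_nonneg bound)
    qed (use T U in \<open>auto intro: integrable_indicator_event\<close>)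
  qed
qed

lemma resampling_distance_tendsto:
  assumes "integrable P u"
  shows "resampling_distance u \<longlonglongrightarrow> 0"
  using assms
proof (induction u rule: integrable_induct)
  case (base A c)
  have "resampling_distance (\<lambda>\<xi>. indicator A \<xi> *\<^sub>R c) n = \<bar>c\<bar> * resampling_distance (indicator A) n" for n
  proof -
    have "\<bar>indicator A x *\<^sub>R c - indicator A y *\<^sub>R c\<bar> = \<bar>c\<bar> * \<bar>indicator A x - indicator A y\<bar>" for x y
      by (simp add: indicator_def)
    then show ?thesis unfolding resampling_distance_def by simp
  qed
  then show ?case
    using tendsto_mult_left[OF resampling_distance_indicator[OF base(1)], of "\<bar>c\<bar>"] by simp
next
  case (add f g)
  have bound: "resampling_distance (\<lambda>\<xi>. f \<xi> + g \<xi>) n \<le> resampling_distance f n + resampling_distance g n" for n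
  proof -
    have fg: "integrable P (\<lambda>\<xi>. f \<xi> + g \<xi>)" using add.hyps by auto
    have "resampling_distance (\<lambda>\<xi>. f \<xi> + g \<xi>) n \<le>
      (\<integral>p. \<bar>f (glue (window n) (fst p) (snd p)) - f (fst p)\<bar> +
        \<bar>g (glue (window n) (fst p) (snd p)) - g (fst p)\<bar> \<partial>(P \<Otimes>\<^sub>M P))"
      unfolding resampling_distance_def
      by (intro integral_mono integrable_resampling[OF fg] Bochner_Integration.integrable_add
        integrable_resampling add.hyps) linarith
    also have "\<dots> = resampling_distance f n + resampling_distance g n"
      unfolding resampling_distance_def
      by (intro Bochner_Integration.integral_add integrable_resampling add.hyps)
    finally show ?thesis .
  qed
  have "(\<lambda>n. resampling_distance f n + resampling_distance g n) \<longlonglongrightarrow> 0"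
    using tendsto_add[OF add.IH] by simp
  from tendsto_sandwich[OF _ _ tendsto_const this] show ?case
    by (auto simp: resampling_distance_nonneg bound)
next
  case (lim f s)
  show ?case
  proof (rule resampling_distance_tendsto_limit[where v = s])
    have "(\<lambda>k. \<integral>\<xi>. \<bar>f \<xi> - s k \<xi>\<bar> \<partial>P) \<longlonglongrightarrow> (\<integral>\<xi>. 0 \<partial>P)"
    proof (rule integral_dominated_convergence[where w = "\<lambda>\<xi>. 3 * \<bar>f \<xi>\<bar>"])
      show "(\<lambda>\<xi>. \<bar>f \<xi> - s k \<xi>\<bar>) \<in> borel_measurable P" for k using lim by auto
      show "integrable P (\<lambda>\<xi>. 3 * \<bar>f \<xi>\<bar>)" using lim by auto
      show "AE \<xi> in P. (\<lambda>k. \<bar>f \<xi> - s k \<xi>\<bar>) \<longlonglongrightarrow> 0"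
      proof (intro AE_I2)
        fix \<xi> assume "\<xi> \<in> space P"
        from tendsto_diff[OF tendsto_const lim.hyps(2)[OF this], of "f \<xi>"]
        have "(\<lambda>k. f \<xi> - s k \<xi>) \<longlonglongrightarrow> 0" by simp
        then show "(\<lambda>k. \<bar>f \<xi> - s k \<xi>\<bar>) \<longlonglongrightarrow> 0" by (rule tendsto_rabs_zero)
      qed
      show "AE \<xi> in P. norm \<bar>f \<xi> - s k \<xi>\<bar> \<le> 3 * \<bar>f \<xi>\<bar>" for k
      proof (intro AE_I2)
        fix \<xi> assume "\<xi> \<in> space P"
        from lim.hyps(3)[OF this, of k] show "norm \<bar>f \<xi> - s k \<xi>\<bar> \<le> 3 * \<bar>f \<xi>\<bar>" by simp
      qed
    qed auto
    then show "(\<lambda>k. \<integral>\<xi>. \<bar>f \<xi> - s k \<xi>\<bar> \<partial>P) \<longlonglongrightarrow> 0" by simp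
  qed (use lim in auto)
qed

end

section \<open>The modified logarithmic Sobolev inequality\<close>

lemma abs_ln_diff_le:
  fixes a u v :: real
  assumes "0 < a" "a \<le> u" "a \<le> v"
  shows "\<bar>ln u - ln v\<bar> \<le> \<bar>u - v\<bar> / a"
proof -
  have *: "ln x - ln y \<le> \<bar>x - y\<bar> / a" if "a \<le> x" "a \<le> y" for x y :: real
  proof -
    have "ln x - ln y = ln (x / y)" using that assms by (simp add: ln_div)
    also have "\<dots> \<le> x / y - 1" using that assms by (intro ln_le_minus_one) auto
    also have "\<dots> = (x - y) / y" using that assms by (simp add: field_simps)
    also have "\<dots> \<le> \<bar>x - y\<bar> / y" using that assms by (intro divide_right_mono) auto
    also have "\<dots> \<le> \<bar>x - y\<bar> / a" using that assms by (intro divide_left_mono) auto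
    finally show ?thesis .
  qed
  show ?thesis using *[OF assms(2,3)] *[OF assms(3,2)] by (simp add: abs_if split: if_splits)
qed

context bounded_functional
begin

definition cell_energy :: "nat \<Rightarrow> nat \<Rightarrow> 'a measure \<Rightarrow> ennreal" where
  "cell_energy n m \<xi> = (\<Sum>j<2^m. ennreal (relent (G \<xi>) (G (restr (- cell m n j) \<xi>))))"

lemma measurable_cell_energy: "cell_energy n m \<in> borel_measurable P"
proof -
  have [measurable]: "(\<lambda>\<xi>. relent (G \<xi>) (G (restr (- cell m n j) \<xi>))) \<in> borel_measurable P" for j
    by (rule borel_measurable_integrable[OF integrable_relent]) auto
  show ?thesis unfolding cell_energy_def[abs_def] by measurable
qed

text \<open>An empty cell contributes zero because emptying it changes nothing; an occupied cell
  contributes at most \<open>relent_bound\<close> and holds at least one point. The resulting bound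
  does not depend on \<open>m\<close>.\<close>

lemma cell_energy_le:
  assumes \<xi>: "\<xi> \<in> configurations"
  shows "cell_energy n m \<xi> \<le> ennreal relent_bound * emeasure \<xi> (window n)"
proof -
  have "cell_energy n m \<xi> \<le> (\<Sum>j<2^m. ennreal relent_bound * emeasure \<xi> (cell m n j))"
    unfolding cell_energy_def
  proof (intro sum_mono)
    fix j
    obtain k where k: "emeasure \<xi> (cell m n j) = of_nat k"
      using emeasure_bounded_nat[OF \<xi> cell_borel cell_subset_window] by blast
    show "ennreal (relent (G \<xi>) (G (restr (- cell m n j) \<xi>))) \<le> ennreal relent_bound * emeasure \<xi> (cell m n j)"
    proof (cases "k = 0")
      case True
      then show ?thesis using k restr_null[OF \<xi> cell_borel, of m n j] by simp
    next
      case False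
      have "ennreal (relent (G \<xi>) (G (restr (- cell m n j) \<xi>))) \<le> ennreal relent_bound * 1"
        using relent_le_bound[OF \<xi>, of "- cell m n j"] by (simp add: ennreal_leI)
      also have "\<dots> \<le> ennreal relent_bound * of_nat k"
      proof (rule mult_left_mono)
        have "(of_nat 1 :: ennreal) \<le> of_nat k" using False by (intro of_nat_mono) simp
        then show "(1 :: ennreal) \<le> of_nat k" by simp
      qed simp
      finally show ?thesis using k by simp
    qed
  qed
  also have "\<dots> = ennreal relent_bound * (\<Sum>j<2^m. emeasure \<xi> (cell m n j))" by (simp add: sum_distrib_left)
  also have "(\<Sum>j<2^m. emeasure \<xi> (cell m n j)) = emeasure \<xi> (\<Union>j<2^m. cell m n j)"
    using sets_configuration[OF \<xi>] disjoint_cells[of m n]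
    by (intro sum_emeasure) (auto simp: disjoint_family_on_def)
  finally show ?thesis by (simp add: Union_cells)
qed

text \<open>When no cell holds two points, emptying an occupied cell removes a single point, and
  different cells give different points. The factor \<open>c\<close> stays outside the integral
  since \<open>g\<close> is not assumed measurable.\<close>

lemma cell_energy_simple:
  fixes g :: "'a \<Rightarrow> ennreal"
  assumes \<xi>: "\<xi> \<in> configurations" and simple: "\<And>j. emeasure \<xi> (cell m n j) \<le> 1"
    and g: "\<And>x. emeasure \<xi> {x} > 0 \<Longrightarrow>
      ennreal (relent (G \<xi>) (G (diff_measure \<xi> (return borel x)))) \<le> c * g x"
  shows "cell_energy n m \<xi> \<le> c * (\<integral>\<^sup>+x. g x \<partial>\<xi>)"
proof -
  define J where "J = {j. j < 2^m \<and> emeasure \<xi> (cell m n j) = 1}"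
  have zero: "emeasure \<xi> (cell m n j) = 0" if j: "j < 2^m" "j \<notin> J" for j
  proof -
    obtain k where k: "emeasure \<xi> (cell m n j) = of_nat k"
      using emeasure_bounded_nat[OF \<xi> cell_borel cell_subset_window] by blast
    have "k \<le> 1" using simple[of j] unfolding k by (metis of_nat_1 of_nat_le_iff)
    moreover have "k \<noteq> 1" using j k by (auto simp: J_def)
    ultimately show ?thesis using k by simp
  qed
  have "\<exists>x. x \<in> cell m n j \<and> emeasure \<xi> {x} = 1 \<and> restr (- cell m n j) \<xi> = diff_measure \<xi> (return borel x)"
    if "j \<in> J" for j
    using single_point[OF \<xi> cell_borel cell_subset_window, of m n j] that by (auto simp: J_def)
  then obtain x where x: "\<And>j. j \<in> J \<Longrightarrow> x j \<in> cell m n j" "\<And>j. j \<in> J \<Longrightarrow> emeasure \<xi> {x j} = 1"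
    "\<And>j. j \<in> J \<Longrightarrow> restr (- cell m n j) \<xi> = diff_measure \<xi> (return borel (x j))"
    by metis
  \<comment> \<open>The code of the point recovers the index of its cell.\<close>
  have inj: "inj_on x J"
  proof (rule inj_on_inverseI)
    show "code m (x j) = j" if "j \<in> J" for j using x(1)[OF that] by (simp add: cell_def)
  qed
  have J: "finite J" "J \<subseteq> {..<2^m}" by (auto simp: J_def)
  have "cell_energy n m \<xi> = (\<Sum>j\<in>J. ennreal (relent (G \<xi>) (G (restr (- cell m n j) \<xi>))))"
    unfolding cell_energy_def
    using J zero restr_null[OF \<xi> cell_borel] by (intro sum.mono_neutral_right) auto
  also have "\<dots> \<le> (\<Sum>j\<in>J. c * (g (x j) * emeasure \<xi> {x j}))"
    using x g by (intro sum_mono) auto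
  also have "\<dots> = c * (\<Sum>y\<in>x ` J. g y * emeasure \<xi> {y})"
    using inj by (simp add: sum.reindex sum_distrib_left)
  also have "\<dots> \<le> c * (\<integral>\<^sup>+x. g x \<partial>\<xi>)"
    using J sets_configuration[OF \<xi>] by (intro mult_left_mono sum_le_nn_integral_points) auto
  finally show ?thesis .
qed

text \<open>The left side is free of \<open>m\<close> and lies below the mean cell energy of every
  level. The reverse Fatou lemma moves the limsup inside the integral, where almost every
  configuration is covered by \<open>cell_energy_simple\<close> from some level on.\<close>

lemma window_entropy_le:
  assumes g: "\<And>\<xi> x. \<xi> \<in> configurations \<Longrightarrow> emeasure \<xi> {x} > 0 \<Longrightarrow>
      ennreal (relent (G \<xi>) (G (diff_measure \<xi> (return borel x)))) \<le> c \<xi> * g \<xi> x"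
  shows "ennreal ((\<integral>\<xi>. G \<xi> * ln (average (window n) \<xi>) \<partial>P) - (\<integral>\<xi>. G \<xi> \<partial>P) * ln (\<integral>\<xi>. G \<xi> \<partial>P)) \<le>
    (\<integral>\<^sup>+\<xi>. c \<xi> * (\<integral>\<^sup>+x. g \<xi> x \<partial>\<xi>) \<partial>P)" (is "ennreal ?L \<le> _")
proof -
  have le: "ennreal ?L \<le> (\<integral>\<^sup>+\<xi>. cell_energy n m \<xi> \<partial>P)" for m
  proof -
    have "?L \<le> (\<Sum>j<2^m. \<integral>\<xi>. relent (G \<xi>) (G (restr (- cell m n j) \<xi>)) \<partial>P)"
      using entropy_tensorization[OF cell_borel disjoint_cells, of m n "2^m"] by (simp add: Union_cells)
    then have "ennreal ?L \<le> ennreal (\<Sum>j<2^m. \<integral>\<xi>. relent (G \<xi>) (G (restr (- cell m n j) \<xi>)) \<partial>P)"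
      by (rule ennreal_leI)
    also have "\<dots> = (\<Sum>j<2^m. ennreal (\<integral>\<xi>. relent (G \<xi>) (G (restr (- cell m n j) \<xi>)) \<partial>P))"
      by (intro sum_ennreal[symmetric] integral_nonneg_AE AE_I2 relent_G_nonneg) auto
    also have "\<dots> = (\<Sum>j<2^m. \<integral>\<^sup>+\<xi>. ennreal (relent (G \<xi>) (G (restr (- cell m n j) \<xi>))) \<partial>P)"
      by (intro sum.cong refl nn_integral_eq_integral[symmetric] integrable_relent AE_I2 relent_G_nonneg) auto
    also have "\<dots> = (\<integral>\<^sup>+\<xi>. cell_energy n m \<xi> \<partial>P)"
      unfolding cell_energy_def
      by (intro nn_integral_sum[symmetric] measurable_compose[OF _ measurable_ennreal]
          borel_measurable_integrable integrable_relent) auto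
    finally show ?thesis .
  qed
  have "ennreal ?L \<le> limsup (\<lambda>m. \<integral>\<^sup>+\<xi>. cell_energy n m \<xi> \<partial>P)"
    using le by (intro le_Limsup) auto
  also have "\<dots> \<le> (\<integral>\<^sup>+\<xi>. limsup (\<lambda>m. cell_energy n m \<xi>) \<partial>P)"
  proof (rule nn_integral_limsup[OF measurable_cell_energy])
    show "(\<lambda>\<xi>. ennreal relent_bound * emeasure \<xi> (window n)) \<in> borel_measurable P" by measurable
    show "AE \<xi> in P. cell_energy n m \<xi> \<le> ennreal relent_bound * emeasure \<xi> (window n)" for m
      by (intro AE_I2 cell_energy_le) simp
    have "(\<integral>\<^sup>+\<xi>. ennreal relent_bound * emeasure \<xi> (window n) \<partial>P) =
        ennreal relent_bound * (\<integral>\<^sup>+\<xi>. emeasure \<xi> (window n) \<partial>P)"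
      by (rule nn_integral_cmult) measurable
    then show "(\<integral>\<^sup>+\<xi>. ennreal relent_bound * emeasure \<xi> (window n) \<partial>P) < \<infinity>"
      using mean_count_finite[of n] by (simp add: ennreal_mult_less_top)
  qed
  also have "\<dots> \<le> (\<integral>\<^sup>+\<xi>. c \<xi> * (\<integral>\<^sup>+x. g \<xi> x \<partial>\<xi>) \<partial>P)"
  proof (rule nn_integral_mono_AE)
    show "AE \<xi> in P. limsup (\<lambda>m. cell_energy n m \<xi>) \<le> c \<xi> * (\<integral>\<^sup>+x. g \<xi> x \<partial>\<xi>)"
      using AE_simple[of n] AE_space
    proof eventually_elim
      case (elim \<xi>)
      then obtain m0 where m0: "\<forall>j<2^m0. emeasure \<xi> (cell m0 n j) \<le> 1" by blast
      have \<xi>: "\<xi> \<in> configurations" using elim by simp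
      have "cell_energy n m \<xi> \<le> c \<xi> * (\<integral>\<^sup>+x. g \<xi> x \<partial>\<xi>)" if "m \<ge> m0" for m
        by (rule cell_energy_simple[OF \<xi> simple_cells_mono[OF \<xi> m0 that] g[OF \<xi>]])
      then show ?case by (intro Limsup_bounded) (auto simp: eventually_sequentially)
    qed
  qed
  finally show ?thesis .
qed

text \<open>On values at least \<open>a\<close> the logarithm has Lipschitz constant
  \<open>1 / a\<close>, so convergence of the averages to \<open>G\<close> in mean is enough. Their
  distance to \<open>G\<close> is at most the resampling distance, by moving the absolute value
  inside the average.\<close>

lemma average_window_tendsto:
  "(\<lambda>n. \<integral>\<xi>. G \<xi> * ln (average (window n) \<xi>) \<partial>P) \<longlonglongrightarrow> (\<integral>\<xi>. G \<xi> * ln (G \<xi>) \<partial>P)"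
proof -
  have G_int: "integrable P G" by (rule integrable_bounded[OF finite_P(1), where B = b]) (auto simp: G_abs)
  have GlnG: "integrable P (\<lambda>\<xi>. G \<xi> * ln (G \<xi>))"
  proof (rule integrable_bounded[OF finite_P(1), where B = "b * (\<bar>ln a\<bar> + \<bar>ln b\<bar>)"])
    fix \<xi> assume "\<xi> \<in> space P"
    then show "\<bar>G \<xi> * ln (G \<xi>)\<bar> \<le> b * (\<bar>ln a\<bar> + \<bar>ln b\<bar>)"
      unfolding abs_mult using G_abs G_ge G_le b_pos by (intro mult_mono ln_abs_le) auto
  qed measurable
  have avg_int: "integrable P (\<lambda>\<xi>. \<bar>average (window n) \<xi> - G \<xi>\<bar>)" for n
  proof (rule integrable_bounded[OF finite_P(1), where B = "b + b"])
    show "(\<lambda>\<xi>. \<bar>average (window n) \<xi> - G \<xi>\<bar>) \<in> borel_measurable P" by measurable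
    fix \<xi> assume "\<xi> \<in> space P"
    then have "\<xi> \<in> configurations" by simp
    from average_abs[OF window_borel this, of n] G_abs[OF this]
    show "\<bar>\<bar>average (window n) \<xi> - G \<xi>\<bar>\<bar> \<le> b + b" by linarith
  qed
  have L1: "(\<integral>\<xi>. \<bar>average (window n) \<xi> - G \<xi>\<bar> \<partial>P) \<le> resampling_distance G n" for n
  proof -
    have int: "integrable (P \<Otimes>\<^sub>M P) (\<lambda>p. \<bar>G (glue (window n) (fst p) (snd p)) - G (fst p)\<bar>)"
      by (rule integrable_resampling[OF G_int])
    have "(\<integral>\<xi>. \<bar>average (window n) \<xi> - G \<xi>\<bar> \<partial>P) \<le> (\<integral>\<xi>. (\<integral>\<zeta>. \<bar>G (glue (window n) \<xi> \<zeta>) - G \<xi>\<bar> \<partial>P) \<partial>P)"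
    proof (intro integral_mono avg_int)
      show "integrable P (\<lambda>\<xi>. \<integral>\<zeta>. \<bar>G (glue (window n) \<xi> \<zeta>) - G \<xi>\<bar> \<partial>P)"
        using pair.integrable_fst'[OF int] by simp
      fix \<xi> assume "\<xi> \<in> space P"
      then have \<xi>: "\<xi> \<in> configurations" by simp
      have "average (window n) \<xi> - G \<xi> = (\<integral>\<zeta>. G (glue (window n) \<xi> \<zeta>) - G \<xi> \<partial>P)"
        unfolding average_def using integrable_G_glue_section[OF window_borel \<xi>] by simp
      also have "\<bar>\<dots>\<bar> \<le> (\<integral>\<zeta>. \<bar>G (glue (window n) \<xi> \<zeta>) - G \<xi>\<bar> \<partial>P)"
        by (rule integral_abs_bound)
      finally show "\<bar>average (window n) \<xi> - G \<xi>\<bar> \<le> (\<integral>\<zeta>. \<bar>G (glue (window n) \<xi> \<zeta>) - G \<xi>\<bar> \<partial>P)" .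
    qed
    also have "\<dots> = resampling_distance G n"
      using pair.integral_fst'[OF int] by (simp add: resampling_distance_def)
    finally show ?thesis .
  qed
  have le: "norm ((\<integral>\<xi>. G \<xi> * ln (average (window n) \<xi>) \<partial>P) - (\<integral>\<xi>. G \<xi> * ln (G \<xi>) \<partial>P))
      \<le> b / a * resampling_distance G n" for n
  proof -
    have "\<bar>(\<integral>\<xi>. G \<xi> * ln (average (window n) \<xi>) \<partial>P) - (\<integral>\<xi>. G \<xi> * ln (G \<xi>) \<partial>P)\<bar> =
        \<bar>\<integral>\<xi>. G \<xi> * ln (average (window n) \<xi>) - G \<xi> * ln (G \<xi>) \<partial>P\<bar>"
      using integrable_G_ln_average[OF window_borel, of n] GlnG by simp
    also have "\<dots> \<le> (\<integral>\<xi>. \<bar>G \<xi> * ln (average (window n) \<xi>) - G \<xi> * ln (G \<xi>)\<bar> \<partial>P)"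
      by (rule integral_abs_bound)
    also have "\<dots> \<le> (\<integral>\<xi>. b / a * \<bar>average (window n) \<xi> - G \<xi>\<bar> \<partial>P)"
    proof (rule integral_mono)
      show "integrable P (\<lambda>\<xi>. \<bar>G \<xi> * ln (average (window n) \<xi>) - G \<xi> * ln (G \<xi>)\<bar>)"
        using integrable_G_ln_average[OF window_borel, of n] GlnG by auto
      show "integrable P (\<lambda>\<xi>. b / a * \<bar>average (window n) \<xi> - G \<xi>\<bar>)"
        using avg_int[of n] by (intro integrable_mult_right) auto
      fix \<xi> assume "\<xi> \<in> space P"
      then have \<xi>: "\<xi> \<in> configurations" by simp
      have "\<bar>G \<xi> * ln (average (window n) \<xi>) - G \<xi> * ln (G \<xi>)\<bar> =
          \<bar>G \<xi>\<bar> * \<bar>ln (average (window n) \<xi>) - ln (G \<xi>)\<bar>"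
        by (simp add: abs_mult flip: right_diff_distrib)
      also have "\<dots> \<le> b * (\<bar>average (window n) \<xi> - G \<xi>\<bar> / a)"
        using abs_ln_diff_le[OF a average_bounds(1)[OF window_borel \<xi>] G_ge[OF \<xi>]] G_abs[OF \<xi>] b_pos
        by (intro mult_mono) auto
      finally show "\<bar>G \<xi> * ln (average (window n) \<xi>) - G \<xi> * ln (G \<xi>)\<bar> \<le> b / a * \<bar>average (window n) \<xi> - G \<xi>\<bar>"
        by simp
    qed
    also have "\<dots> = b / a * (\<integral>\<xi>. \<bar>average (window n) \<xi> - G \<xi>\<bar> \<partial>P)" by (rule integral_mult_right_zero)
    also have "\<dots> \<le> b / a * resampling_distance G n"
      using a b_pos L1 by (intro mult_left_mono) auto
    finally show ?thesis by simp
  qed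
  have lim: "(\<lambda>n. b / a * resampling_distance G n) \<longlonglongrightarrow> 0"
    using tendsto_mult_left[OF resampling_distance_tendsto[OF G_int], of "b / a"] by simp
  show ?thesis
    by (rule LIM_zero_cancel, rule Lim_null_comparison[OF always_eventually lim]) (use le in blast)
qed

text \<open>The entropy integrand is bounded by free functions \<open>c\<close> and
  \<open>g\<close>, so that a truncated \<open>G\<close> can be estimated directly by expressions in
  the untruncated functional.\<close>

theorem modified_log_sobolev:
  assumes "\<And>\<xi> x. \<xi> \<in> configurations \<Longrightarrow> emeasure \<xi> {x} > 0 \<Longrightarrow>
      ennreal (relent (G \<xi>) (G (diff_measure \<xi> (return borel x)))) \<le> c \<xi> * g \<xi> x"
  shows "ennreal ((\<integral>\<xi>. G \<xi> * ln (G \<xi>) \<partial>P) - (\<integral>\<xi>. G \<xi> \<partial>P) * ln (\<integral>\<xi>. G \<xi> \<partial>P)) \<le>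
    (\<integral>\<^sup>+\<xi>. c \<xi> * (\<integral>\<^sup>+x. g \<xi> x \<partial>\<xi>) \<partial>P)"
proof (rule LIMSEQ_le_const2)
  show "(\<lambda>n. ennreal ((\<integral>\<xi>. G \<xi> * ln (average (window n) \<xi>) \<partial>P) - (\<integral>\<xi>. G \<xi> \<partial>P) * ln (\<integral>\<xi>. G \<xi> \<partial>P)))
    \<longlonglongrightarrow> ennreal ((\<integral>\<xi>. G \<xi> * ln (G \<xi>) \<partial>P) - (\<integral>\<xi>. G \<xi> \<partial>P) * ln (\<integral>\<xi>. G \<xi> \<partial>P))"
    by (intro tendsto_ennrealI tendsto_diff average_window_tendsto tendsto_const)
qed (use window_entropy_le[where c = c and g = g, OF assms] in blast)

end

section \<open>Comparison and truncation\<close>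

lemma relent_exp: "relent (exp u) (exp v) = exp u * (exp (- (u - v)) - 1 + (u - v))"
proof -
  have "exp u * exp (- (u - v)) = exp v" by (simp flip: exp_add)
  then show ?thesis by (simp add: relent_def ln_div algebra_simps)
qed

lemma exp_minus_mono:
  fixes s t :: real
  assumes "0 \<le> s" "s \<le> t"
  shows "exp (- s) - 1 + s \<le> exp (- t) - 1 + t"
proof (rule DERIV_nonneg_imp_nondecreasing[OF assms(2), where f = "\<lambda>s. exp (- s) - 1 + s"])
  fix x assume "s \<le> x" "x \<le> t"
  show "\<exists>y. ((\<lambda>s. exp (- s) - 1 + s) has_real_derivative y) (at x) \<and> 0 \<le> y"
    by (rule exI[of _ "1 - exp (- x)"]) (use \<open>s \<le> x\<close> assms in \<open>auto intro!: derivative_eq_intros\<close>)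
qed

lemma exp_minus_nonneg: "0 \<le> exp (- s) - 1 + s" for s :: real
  using exp_ge_add_one_self[of "- s"] by simp

text \<open>Both sides vanish at \<open>0\<close>, so derivatives are compared. On the left it is
  \<open>1 - exp (- x) \<le> min 1 x\<close>, on the right \<open>x / ((1 - l) * (l + x))\<close>,
  and \<open>(1 - l) * (l + x) \<le> max 1 x\<close>, while
  \<open>min 1 x * max 1 x = x\<close>.\<close>

lemma exp_le_phi:
  assumes l: "0 \<le> l" "l < 1" and s: "0 \<le> s"
  shows "exp (- s) - 1 + s \<le> phi l s"
proof (cases "l = 0")
  case True
  then show ?thesis using s by (simp add: phi_def)
next
  case False
  then have l0: "l > 0" using l by simp
  define D where "D x = x / (1 - l) - l / (1 - l) * ln (1 + x / l) - (exp (- x) - 1 + x)" for x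
  have "D 0 \<le> D s"
  proof (rule DERIV_nonneg_imp_nondecreasing[OF s])
    fix x :: real assume x: "0 \<le> x" "x \<le> s"
    have pos: "1 + x / l > 0" using l0 x by (simp add: add_pos_nonneg)
    have ln': "((\<lambda>x. ln (1 + x / l)) has_real_derivative 1 / (l + x)) (at x)"
      using pos l0 x by (auto intro!: derivative_eq_intros simp: field_simps)
    have "(D has_real_derivative 1 / (1 - l) - l / (1 - l) * (1 / (l + x)) - (- exp (- x) + 1)) (at x)"
      unfolding D_def[abs_def]
      by (rule DERIV_diff[OF DERIV_diff[OF _ DERIV_cmult[OF ln']]]) (use l in \<open>auto intro!: derivative_eq_intros\<close>)
    moreover have "0 \<le> 1 / (1 - l) - l / (1 - l) * (1 / (l + x)) - (- exp (- x) + 1)"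
    proof -
      define e where "e = 1 - exp (- x)"
      have e: "0 \<le> e" "e \<le> 1" "e \<le> x"
        using x exp_ge_add_one_self[of "- x"] by (auto simp: e_def)
      have main: "e * ((1 - l) * (l + x)) \<le> x"
      proof (cases "x \<ge> 1")
        case True
        have "(1 - l) * (l + x) = x - l * (x - (1 - l))" by (simp add: algebra_simps)
        also have "\<dots> \<le> x" using True l by simp
        finally have *: "(1 - l) * (l + x) \<le> x" .
        have "e * ((1 - l) * (l + x)) \<le> 1 * ((1 - l) * (l + x))"
          using e l x by (intro mult_right_mono) auto
        then show ?thesis using * by simp
      next
        case False
        have "(1 - l) * (l + x) \<le> (1 - l) * (l + 1)" using False l by (intro mult_left_mono) auto
        also have "\<dots> \<le> 1" by (simp add: algebra_simps)
        finally have *: "(1 - l) * (l + x) \<le> 1" .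
        have "e * ((1 - l) * (l + x)) \<le> x * 1" using * e l x by (intro mult_mono) auto
        then show ?thesis by simp
      qed
      have "1 / (1 - l) - l / (1 - l) * (1 / (l + x)) = x / ((1 - l) * (l + x))"
        using l l0 x by (simp add: divide_simps)
      moreover have "e \<le> x / ((1 - l) * (l + x))"
        using main l l0 x by (subst pos_le_divide_eq) auto
      ultimately show ?thesis by (simp add: e_def)
    qed
    ultimately show "\<exists>y. (D has_real_derivative y) (at x) \<and> 0 \<le> y" by blast
  qed
  then show ?thesis using False by (simp add: D_def phi_def)
qed

section \<open>Truncation of the functional\<close>

definition clip :: "real \<Rightarrow> real \<Rightarrow> real" where
  "clip K x = max (- K) (min x K)"

text \<open>Clipping shrinks increments, and \<open>exp (- s) - 1 + s\<close> grows with
  \<open>s \<ge> 0\<close>. The factor \<open>exp u\<close> can only increase under clipping when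
  \<open>u < - K\<close>; but then \<open>u\<close> and \<open>v\<close> are both clipped to
  \<open>- K\<close> and the left side vanishes.\<close>

lemma relent_exp_clip_le:
  assumes K: "0 \<le> K" and l: "0 \<le> l" "l < 1" and vu: "v \<le> u"
  shows "relent (exp (clip K u)) (exp (clip K v)) \<le> exp u * phi l (u - v)"
proof (cases "u < - K")
  case True
  then have "clip K u = clip K v" using vu by (simp add: clip_def)
  moreover have "0 \<le> phi l (u - v)"
    using exp_le_phi[OF l, of "u - v"] exp_minus_nonneg[of "u - v"] vu by simp
  ultimately show ?thesis by simp
next
  case False
  define s where "s = clip K u - clip K v"
  have s: "0 \<le> s" "s \<le> u - v" using vu K by (auto simp: s_def clip_def min_def max_def)
  have "relent (exp (clip K u)) (exp (clip K v)) = exp (clip K u) * (exp (- s) - 1 + s)"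
    by (simp add: relent_exp s_def)
  also have "\<dots> \<le> exp u * (exp (- (u - v)) - 1 + (u - v))"
    using False s exp_minus_mono[OF s] exp_minus_nonneg[of s]
    by (intro mult_mono) (auto simp: clip_def)
  also have "\<dots> \<le> exp u * phi l (u - v)"
    using exp_le_phi[OF l, of "u - v"] vu by (intro mult_left_mono) auto
  finally show ?thesis .
qed

lemma clip_tendsto: "(\<lambda>k. clip (real k) x) \<longlonglongrightarrow> x"
proof (rule tendsto_eventually)
  obtain k0 where k0: "\<bar>x\<bar> \<le> real k0" using real_arch_simple by blast
  have "clip (real k) x = x" if "k \<ge> k0" for k
  proof -
    have "\<bar>x\<bar> \<le> real k" using that k0 by linarith
    then show ?thesis by (auto simp: clip_def)
  qed
  then show "\<forall>\<^sub>F k in sequentially. clip (real k) x = x" by (auto simp: eventually_sequentially)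
qed

lemma exp_clip_le: "0 \<le> K \<Longrightarrow> exp (clip K x) \<le> exp x + 1"
proof -
  assume K: "0 \<le> K"
  have "exp (clip K x) \<le> exp (max x 0)" using K by (auto simp: clip_def)
  also have "\<dots> \<le> exp x + 1" by (auto simp: max_def add_increasing)
  finally show ?thesis .
qed

text \<open>The \<open>+ 1\<close> is for \<open>x < - K\<close>, where clipping enlarges the
  exponential and \<open>K * exp (- K) \<le> 1\<close> has to be used.\<close>

lemma abs_clip_exp_le:
  assumes K: "0 \<le> K"
  shows "\<bar>clip K x\<bar> * exp (clip K x) \<le> \<bar>x\<bar> * exp x + 1"
proof (cases "x < - K")
  case True
  have "K \<le> exp K" using exp_ge_add_one_self[of K] by linarith
  then have "K * exp (- K) \<le> 1" by (simp add: exp_minus field_simps)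
  moreover have "0 \<le> \<bar>x\<bar> * exp x" by simp
  ultimately show ?thesis using True K by (simp add: clip_def)
next
  case False
  then have "\<bar>clip K x\<bar> \<le> \<bar>x\<bar>" "clip K x \<le> x" using K by (auto simp: clip_def)
  then have "\<bar>clip K x\<bar> * exp (clip K x) \<le> \<bar>x\<bar> * exp x" by (intro mult_mono) auto
  then show ?thesis by simp
qed

text \<open>This derives integrability of the exponential itself from that of its product with the
  absolute value.\<close>

lemma exp_le_abs_exp: "exp x \<le> exp 1 + \<bar>x\<bar> * exp x" for x :: real
proof (cases "x \<le> 1")
  case True
  then have "exp x \<le> exp 1" by simp
  moreover have "0 \<le> \<bar>x\<bar> * exp x" by simp
  ultimately show ?thesis by linarith
next
  case False
  then have "1 * exp x \<le> \<bar>x\<bar> * exp x" by (intro mult_right_mono) auto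
  then show ?thesis using exp_ge_zero[of 1] by linarith
qed

lemma (in prob_space) entropy_exp_clip_tendsto:
  assumes Y: "Y \<in> borel_measurable M" and int: "integrable M (\<lambda>\<omega>. \<bar>Y \<omega>\<bar> * exp (Y \<omega>))"
  shows "(\<lambda>k. entropy_exp M (\<lambda>\<omega>. clip (real k) (Y \<omega>))) \<longlonglongrightarrow> entropy_exp M Y"
proof -
  have [measurable]: "(\<lambda>\<omega>. clip (real k) (Y \<omega>)) \<in> borel_measurable M" for k
    unfolding clip_def using Y by measurable
  note Y [measurable]
  have int_exp: "integrable M (\<lambda>\<omega>. exp (Y \<omega>))"
  proof (rule Bochner_Integration.integrable_bound[where f = "\<lambda>\<omega>. exp 1 + \<bar>Y \<omega>\<bar> * exp (Y \<omega>)"])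
    show "integrable M (\<lambda>\<omega>. exp 1 + \<bar>Y \<omega>\<bar> * exp (Y \<omega>))" using int by simp
    show "AE \<omega> in M. norm (exp (Y \<omega>)) \<le> norm (exp 1 + \<bar>Y \<omega>\<bar> * exp (Y \<omega>))"
    proof (intro AE_I2)
      fix \<omega>
      show "norm (exp (Y \<omega>)) \<le> norm (exp 1 + \<bar>Y \<omega>\<bar> * exp (Y \<omega>))"
        using exp_le_abs_exp[of "Y \<omega>"] by simp
    qed
  qed measurable
  have lim1: "(\<lambda>k. \<integral>\<omega>. clip (real k) (Y \<omega>) * exp (clip (real k) (Y \<omega>)) \<partial>M) \<longlonglongrightarrow> (\<integral>\<omega>. Y \<omega> * exp (Y \<omega>) \<partial>M)"
  proof (rule integral_dominated_convergence[where w = "\<lambda>\<omega>. \<bar>Y \<omega>\<bar> * exp (Y \<omega>) + 1"])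
    show "integrable M (\<lambda>\<omega>. \<bar>Y \<omega>\<bar> * exp (Y \<omega>) + 1)" using int by simp
    show "AE \<omega> in M. (\<lambda>k. clip (real k) (Y \<omega>) * exp (clip (real k) (Y \<omega>))) \<longlonglongrightarrow> Y \<omega> * exp (Y \<omega>)"
      by (intro AE_I2 tendsto_mult tendsto_exp clip_tendsto)
    show "AE \<omega> in M. norm (clip (real k) (Y \<omega>) * exp (clip (real k) (Y \<omega>))) \<le> \<bar>Y \<omega>\<bar> * exp (Y \<omega>) + 1" for k
      using abs_clip_exp_le by (simp add: abs_mult)
  qed measurable
  have lim2: "(\<lambda>k. \<integral>\<omega>. exp (clip (real k) (Y \<omega>)) \<partial>M) \<longlonglongrightarrow> (\<integral>\<omega>. exp (Y \<omega>) \<partial>M)"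
  proof (rule integral_dominated_convergence[where w = "\<lambda>\<omega>. exp (Y \<omega>) + 1"])
    show "integrable M (\<lambda>\<omega>. exp (Y \<omega>) + 1)" using int_exp by simp
    show "AE \<omega> in M. (\<lambda>k. exp (clip (real k) (Y \<omega>))) \<longlonglongrightarrow> exp (Y \<omega>)"
      by (intro AE_I2 tendsto_exp clip_tendsto)
    show "AE \<omega> in M. norm (exp (clip (real k) (Y \<omega>))) \<le> exp (Y \<omega>) + 1" for k
      using exp_clip_le by simp
  qed measurable
  \<comment> \<open>Required for continuity of \<open>ln\<close> at the limit.\<close>
  have "(\<integral>\<omega>. exp (Y \<omega>) \<partial>M) \<noteq> 0"
  proof
    assume "(\<integral>\<omega>. exp (Y \<omega>) \<partial>M) = 0"
    then have "AE \<omega> in M. exp (Y \<omega>) = 0"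
      using integral_nonneg_eq_0_iff_AE[OF int_exp] by simp
    then show False by simp
  qed
  then show ?thesis
    unfolding entropy_exp_def by (intro tendsto_diff tendsto_mult tendsto_ln lim1 lim2)
qed

text \<open>Measurability of \<eta> for the counting sigma-algebra is read off from its counts: the
  inclusion of the vague Borel sets in that sigma-algebra points in the other direction.\<close>

lemma poisson_law_distr:
  fixes \<nu> :: "'a::{metric_space, second_countable_topology} measure"
  assumes \<nu>: "sets \<nu> = sets borel" "\<And>x r. emeasure \<nu> (cball x r) < \<infinity>" "\<And>x. emeasure \<nu> {x} = 0"
    and \<eta>: "poisson_process M \<nu> \<eta>"
  shows "\<eta> \<in> M \<rightarrow>\<^sub>M counting_space" and "poisson_law (distr M counting_space \<eta>) \<nu>"
proof -
  interpret M: prob_space M using \<eta> by (simp add: poisson_process_def)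
  have conf: "\<eta> \<omega> \<in> configurations" if "\<omega> \<in> space M" for \<omega>
    using \<eta> measurable_space[of \<eta> M configuration_space] that by (simp add: poisson_process_def)
  have window: "emeasure \<nu> (window n) < \<infinity>" for n
    unfolding window_def by (rule \<nu>(2))
  have bounded: "emeasure \<nu> A < \<infinity>" if "A \<subseteq> window n" for A n
    using emeasure_mono[OF that, of \<nu>] window[of n] \<nu>(1) by (simp add: le_less_trans)
  have proc: "M.indep_vars (\<lambda>_. borel) (\<lambda>i \<omega>. emeasure (\<eta> \<omega>) (A i)) {..<l}"
      "\<And>i. i < l \<Longrightarrow> poisson_variable M (\<lambda>\<omega>. emeasure (\<eta> \<omega>) (A i)) (measure \<nu> (A i))"
    if "\<And>i. i < l \<Longrightarrow> A i \<in> sets borel \<and> (\<exists>n. A i \<subseteq> window n)" "disjoint_family_on A {..<l}"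
    for l :: nat and A
    using \<eta> that bounded unfolding poisson_process_def by blast+
  show m: "\<eta> \<in> M \<rightarrow>\<^sub>M counting_space"
  proof (rule measurable_counting_space[OF conf])
    fix A :: "'a set" and n assume "A \<in> sets borel" "A \<subseteq> window n"
    then show "(\<lambda>\<omega>. emeasure (\<eta> \<omega>) A) \<in> borel_measurable M"
      using proc(2)[of 1 "\<lambda>_. A" 0] by (auto simp: poisson_variable_def disjoint_family_on_def)
  qed
  interpret P: prob_space "distr M counting_space \<eta>" by (rule M.prob_space_distr[OF m])
  show "poisson_law (distr M counting_space \<eta>) \<nu>"
  proof unfold_locales
    fix l :: nat and A :: "nat \<Rightarrow> 'a set" and k
    assume A: "\<And>i. i < l \<Longrightarrow> A i \<in> sets borel \<and> (\<exists>n. A i \<subseteq> window n)"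
      and disj: "disjoint_family_on A {..<l}"
    define S where "S = {\<xi> \<in> configurations. \<forall>i<l. emeasure \<xi> (A i) = of_nat (k i)}"
    have S: "S \<in> sets counting_space"
    proof -
      have "{\<xi> \<in> space counting_space. \<forall>i\<in>{..<l}. emeasure \<xi> (A i) = of_nat (k i)} \<in> sets counting_space"
      proof (intro sets.sets_Collect_finite_All)
        fix i assume "i \<in> {..<l}"
        then have [measurable]: "A i \<in> sets borel" using A by blast
        show "{\<xi> \<in> space counting_space. emeasure \<xi> (A i) = of_nat (k i)} \<in> sets counting_space" by measurable
      qed simp
      moreover have "S = {\<xi> \<in> space counting_space. \<forall>i\<in>{..<l}. emeasure \<xi> (A i) = of_nat (k i)}"
        unfolding S_def by (simp only: space_counting_space Ball_def lessThan_iff)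
      ultimately show ?thesis by (simp only:)
    qed
    have "measure (distr M counting_space \<eta>) S = M.prob (\<eta> -` S \<inter> space M)"
      by (rule measure_distr[OF m S])
    \<comment> \<open>The product rule for independent variables asks for a nonempty index set; for
      \<open>l = 0\<close> the event is the whole space and the product is empty.\<close>
    also have "\<dots> = (\<Prod>i<l. poisson_weight (measure \<nu> (A i)) (k i))"
    proof (cases "l = 0")
      case True
      then have "\<eta> -` S \<inter> space M = space M" using conf by (auto simp: S_def)
      then show ?thesis using True by (simp add: M.prob_space)
    next
      case False
      have "\<eta> -` S \<inter> space M = (\<Inter>i\<in>{..<l}. (\<lambda>\<omega>. emeasure (\<eta> \<omega>) (A i)) -` {of_nat (k i)} \<inter> space M)"
        using conf False by (auto simp: S_def)
      also have "M.prob \<dots> = (\<Prod>i<l. M.prob ((\<lambda>\<omega>. emeasure (\<eta> \<omega>) (A i)) -` {of_nat (k i)} \<inter> space M))"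
        by (rule M.indep_varsD_finite[OF proc(1)[OF A disj]]) (use False in auto)
      also have "\<dots> = (\<Prod>i<l. poisson_weight (measure \<nu> (A i)) (k i))"
      proof (intro prod.cong refl)
        fix i assume "i \<in> {..<l}"
        then have "poisson_variable M (\<lambda>\<omega>. emeasure (\<eta> \<omega>) (A i)) (measure \<nu> (A i))"
          using proc(2)[OF A disj] by simp
        moreover have "(\<lambda>\<omega>. emeasure (\<eta> \<omega>) (A i)) -` {of_nat (k i)} \<inter> space M =
            {\<omega> \<in> space M. emeasure (\<eta> \<omega>) (A i) = of_nat (k i)}" by auto
        ultimately show "M.prob ((\<lambda>\<omega>. emeasure (\<eta> \<omega>) (A i)) -` {of_nat (k i)} \<inter> space M) =
            poisson_weight (measure \<nu> (A i)) (k i)"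
          unfolding poisson_variable_def poisson_weight_def by simp
      qed
      finally show ?thesis .
    qed
    finally show "measure (distr M counting_space \<eta>) {\<xi> \<in> configurations. \<forall>i<l. emeasure \<xi> (A i) = of_nat (k i)} =
      (\<Prod>i<l. poisson_weight (measure \<nu> (A i)) (k i))" unfolding S_def .
  qed (use \<nu> window in auto)
qed

text \<open>The comparison takes place in \<open>ereal\<close> because the right-hand side may be
  infinite, while the entropy enters as a real number. Monotonicity makes every increment at a
  removed point nonnegative, which is the range where \<open>phi\<close> dominates the relative
  entropy.\<close>

theorem corollary5p2:
  fixes \<nu> :: "'a::polish_space measure"
    and M :: "'w measure"
    and \<eta> :: "'w \<Rightarrow> 'a measure"
    and F :: "'a measure \<Rightarrow> real"
    and l :: real
  assumes "sets \<nu> = sets borel"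
    and "sigma_finite_measure \<nu>"
    and "\<And>x r. emeasure \<nu> (cball x r) < \<infinity>"
    and "\<And>x. emeasure \<nu> {x} = 0"
    and "poisson_process M \<nu> \<eta>"
    and "F \<in> borel_measurable configuration_space"
    and "convex_functional F"
    and "nondecreasing_functional F"
    and "integrable M (\<lambda>\<omega>. \<bar>F (\<eta> \<omega>)\<bar> * exp (F (\<eta> \<omega>)))"
    and "0 \<le> l" and "l < 1"
  shows "ereal (entropy_exp M (\<lambda>\<omega>. F (\<eta> \<omega>))) \<le>
    enn2ereal (\<integral>\<^sup>+\<omega>. ennreal (exp (F (\<eta> \<omega>))) *
      (\<integral>\<^sup>+x. ennreal (phi l (diff_minus F x (\<eta> \<omega>))) \<partial>\<eta> \<omega>) \<partial>M)"
proof -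
  define P where "P = distr M counting_space \<eta>"
  have \<eta>: "\<eta> \<in> M \<rightarrow>\<^sub>M counting_space"
    using assms(1,3-5) by (rule poisson_law_distr)
  interpret P: poisson_law P \<nu>
    unfolding P_def using assms(1,3-5) by (rule poisson_law_distr)
  have F: "F \<in> borel_measurable counting_space"
    using assms(6) by (rule measurable_counting_from_configuration_space)
  then have FP: "F \<in> borel_measurable P" by (simp add: P_def)
  define E where "E \<xi> = ennreal (exp (F \<xi>)) * (\<integral>\<^sup>+x. ennreal (phi l (diff_minus F x \<xi>)) \<partial>\<xi>)" for \<xi>
  have "ennreal (entropy_exp P (\<lambda>\<xi>. clip (real k) (F \<xi>))) \<le> (\<integral>\<^sup>+\<xi>. E \<xi> \<partial>P)" for k
  proof -
    define G where "G \<xi> = exp (clip (real k) (F \<xi>))" for \<xi>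
    interpret bounded_functional P \<nu> G "exp (- real k)" "exp (real k)"
    proof unfold_locales
      show "G \<in> borel_measurable P" unfolding G_def[abs_def] clip_def using FP by measurable
    qed (auto simp: G_def clip_def)
    have "ennreal ((\<integral>\<xi>. G \<xi> * ln (G \<xi>) \<partial>P) - (\<integral>\<xi>. G \<xi> \<partial>P) * ln (\<integral>\<xi>. G \<xi> \<partial>P)) \<le> (\<integral>\<^sup>+\<xi>. E \<xi> \<partial>P)"
      unfolding E_def
    proof (rule modified_log_sobolev)
      fix \<xi> :: "'a measure" and x assume \<xi>: "\<xi> \<in> configurations" and x: "emeasure \<xi> {x} > 0"
      have "emeasure (diff_measure \<xi> (return borel x)) A \<le> emeasure \<xi> A" if "A \<in> sets borel" for A
        unfolding emeasure_remove_dirac[OF \<xi> x that] by (rule diff_le_self_ennreal)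
      then have "F (diff_measure \<xi> (return borel x)) \<le> F \<xi>"
        using assms(8) \<xi> remove_dirac_in_configurations[OF \<xi> x] unfolding nondecreasing_functional_def by blast
      then have "relent (G \<xi>) (G (diff_measure \<xi> (return borel x))) \<le> exp (F \<xi>) * phi l (diff_minus F x \<xi>)"
        unfolding G_def diff_minus_def using assms(10,11) by (intro relent_exp_clip_le) auto
      then show "ennreal (relent (G \<xi>) (G (diff_measure \<xi> (return borel x)))) \<le>
          ennreal (exp (F \<xi>)) * ennreal (phi l (diff_minus F x \<xi>))"
        by (simp add: ennreal_leI flip: ennreal_mult')
    qed
    then show ?thesis by (simp add: entropy_exp_def G_def mult.commute)
  qed
  moreover have "(\<lambda>k. ennreal (entropy_exp P (\<lambda>\<xi>. clip (real k) (F \<xi>)))) \<longlonglongrightarrow> ennreal (entropy_exp P F)"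
  proof (intro tendsto_ennrealI P.entropy_exp_clip_tendsto FP)
    show "integrable P (\<lambda>\<xi>. \<bar>F \<xi>\<bar> * exp (F \<xi>))"
      unfolding P_def using F assms(9) by (subst integrable_distr_eq[OF \<eta>]) auto
  qed
  ultimately have "ennreal (entropy_exp P F) \<le> (\<integral>\<^sup>+\<xi>. E \<xi> \<partial>P)"
    by (intro LIMSEQ_le_const2[where a = "\<integral>\<^sup>+\<xi>. E \<xi> \<partial>P"]) auto
  \<comment> \<open>\<open>E\<close> is not known to be measurable, so the change of variables is
    used as an inequality.\<close>
  also have "\<dots> \<le> (\<integral>\<^sup>+\<omega>. E (\<eta> \<omega>) \<partial>M)"
    unfolding P_def by (rule nn_integral_distr_le[OF \<eta>])
  also have "entropy_exp P F = entropy_exp M (\<lambda>\<omega>. F (\<eta> \<omega>))"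
    unfolding entropy_exp_def P_def using F by (simp add: integral_distr[OF \<eta>])
  finally have "enn2ereal (ennreal (entropy_exp M (\<lambda>\<omega>. F (\<eta> \<omega>)))) \<le> enn2ereal (\<integral>\<^sup>+\<omega>. E (\<eta> \<omega>) \<partial>M)"
    by (simp add: less_eq_ennreal.rep_eq)
  \<comment> \<open>\<open>ennreal\<close> sends negative numbers to \<open>0\<close>, so this
    direction holds whatever the sign of the entropy.\<close>
  moreover have "ereal (entropy_exp M (\<lambda>\<omega>. F (\<eta> \<omega>))) \<le> enn2ereal (ennreal (entropy_exp M (\<lambda>\<omega>. F (\<eta> \<omega>))))"
    by (cases "0 \<le> entropy_exp M (\<lambda>\<omega>. F (\<eta> \<omega>))") (simp_all add: ennreal_neg zero_ennreal.rep_eq)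
  ultimately show ?thesis unfolding E_def by (rule order_trans[rotated])
qed

end
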